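(* Let $d\ge 1$ and let $\mathcal F$ be an iterated function system consisting of contractive similarities of $\mathbb R^d$ and satisfying the open set condition. Let $\mathcal K$ be the limit set of $\mathcal F$, let $s=\dim_H(\mathcal K)$, and let $\mu$ be the restriction of the $s$-dimensional Hausdorff measure to $\mathcal K$. Then $$\dim_H\left(\mathrm{Sing}(d)\cap\mathcal K\right)\le s-\min_{1\le \ell\le d}\frac{(d-\ell+1)\,\alpha_\ell(\mu)}{d+1}.$$
   Context: **IFS.** An iterated function system (IFS) on $\mathbb R^d$ is a finite collection $\mathcal F=\{h_i:i\in\Lambda\}$ of maps $h_i(\mathbf x)=\rho_iO_i\mathbf x+b_i$ with $0<\rho_i<1$, $O_i\in \mathrm{SO}(d,\mathbb R)$, $b_i\in\mathbb R^d$. Its limit set is the unique nonempty compact set $\mathcal K\subset\mathbb R^d$ with $\mathcal K=\bigcup_{i\in\Lambda}h_i(\mathcal K)$. $\mathcal F$ satisfies the open set condition if there is a nonempty open $U\subset\mathbb R^d$ with $h_i(U)\subseteq U$ for all $i$ and $h_i(U)\cap h_j(U)=\emptyset$ for all $i\ne j$. **Singular vectors.** $\mathbf x\in\mathbb R^d$ is singular if for every $0<\varepsilon<1$ there is $N_0\in\mathbb N$ such that for all integers $N\ge N_0$ there is a non-zero $(p,\mathbf q)\in\mathbb Z\times\mathbb Z^d$ with $|\mathbf q\cdot\mathbf x+p|\le\varepsilon/N$ and $\|\mathbf q\|\le N^{1/d}$ (with $\|\cdot\|$ the supremum norm; any other norm gives the same notion). $\mathrm{Sing}(d)$ is the set of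 singular vectors in $\mathbb R^d$. **The exponents $\alpha_\ell$.** For $0\le k\le d$, $\mathcal A(d,k)$ is the collection of all $k$-dimensional affine subspaces of $\mathbb R^d$; $\mathcal L^{(\varepsilon)}$ is the open Euclidean $\varepsilon$-neighborhood of $\mathcal L$. For a compactly supported Borel measure $\mu$ on $\mathbb R^d$ and $1\le\ell\le d$, $$\alpha_\ell(\mu)=\liminf_{\varepsilon\to0}\frac{\log\sup_{\mathcal L\in\mathcal A(d,d-\ell)}\mu(\mathcal L^{(\varepsilon)})}{\log\varepsilon}.$$ $\dim_H$ denotes Hausdorff dimension. *)

theory Defs
  imports "HOL-Analysis.Analysis"
begin

section \<open>Hausdorff measure and Hausdorff dimension\<close>

text \<open>
  The case distinctions implement the conventions that the empty set contributes \<open>0\<close> and that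
  \<open>0\<^sup>0 = 1\<close> for nonempty sets, so that \<open>s = 0\<close> gives counting measure (in HOL, \<open>0 powr 0 = 0\<close>).
\<close>

definition diam_power :: "real \<Rightarrow> 'a::metric_space set \<Rightarrow> ennreal" where
  "diam_power s U =
     (if U = {} then 0 else if s = 0 then 1 else ennreal (diameter U powr s))"

text \<open>
  Boundedness of the covering sets has to be required separately, because \<^const>\<open>diameter\<close> is
  unspecified on unbounded sets.
\<close>

definition hausdorff_pre :: "real \<Rightarrow> real \<Rightarrow> 'a::metric_space set \<Rightarrow> ennreal" where
  "hausdorff_pre s \<delta> A =
     (INF U\<in>{U :: nat \<Rightarrow> 'a set. (\<forall>i. bounded (U i) \<and> diameter (U i) \<le> \<delta>) \<and> A \<subseteq> (\<Union>i. U i)}.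
        \<Sum>i. diam_power s (U i))"

definition hausdorff_outer :: "real \<Rightarrow> 'a::metric_space set \<Rightarrow> ennreal" where
  "hausdorff_outer s A = (SUP \<delta>\<in>{0<..}. hausdorff_pre s \<delta> A)"

text \<open>
  \<^const>\<open>measure_of\<close> silently yields the zero measure when the given set function is not countably
  additive on the given sets; lemma \<open>emeasure_hausdorff_measure\<close> below shows that this does not
  happen here.
\<close>

definition hausdorff_measure :: "real \<Rightarrow> 'a::metric_space measure" where
  "hausdorff_measure s = measure_of UNIV (sets borel) (hausdorff_outer s)"

definition hausdorff_dim :: "'a::metric_space set \<Rightarrow> ereal" where
  "hausdorff_dim A = (INF s\<in>{s. 0 \<le> s \<and> hausdorff_outer s A = 0}. ereal s)"

text \<open>
  The restriction \<open>A \<mapsto> \<H>\<^sup>s(A \<inter> K)\<close>, as a Borel measure on the whole space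
  (\<^const>\<open>restrict_space\<close> would change the underlying space to \<open>K\<close>).
\<close>

definition hausdorff_measure_on :: "real \<Rightarrow> 'a::metric_space set \<Rightarrow> 'a measure" where
  "hausdorff_measure_on s K = density (hausdorff_measure s) (indicator K)"

lemma hausdorff_pre_lower:
  assumes "\<And>i. bounded (U i)" "\<And>i. diameter (U i) \<le> \<delta>" "A \<subseteq> (\<Union>i. U i)"
  shows "hausdorff_pre s \<delta> A \<le> (\<Sum>i. diam_power s (U i))"
  unfolding hausdorff_pre_def using assms by (intro INF_lower) auto

lemma hausdorff_pre_mono: "A \<subseteq> B \<Longrightarrow> hausdorff_pre s \<delta> A \<le> hausdorff_pre s \<delta> B"
  unfolding hausdorff_pre_def by (rule INF_superset_mono) auto

lemma hausdorff_pre_antimono: "\<delta> \<le> \<delta>' \<Longrightarrow> hausdorff_pre s \<delta>' A \<le> hausdorff_pre s \<delta> A"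
  unfolding hausdorff_pre_def by (rule INF_superset_mono) (auto intro: order_trans)

lemma hausdorff_pre_le_outer: "0 < \<delta> \<Longrightarrow> hausdorff_pre s \<delta> A \<le> hausdorff_outer s A"
  unfolding hausdorff_outer_def by (rule SUP_upper) auto

lemma hausdorff_outer_mono: "A \<subseteq> B \<Longrightarrow> hausdorff_outer s A \<le> hausdorff_outer s B"
  unfolding hausdorff_outer_def by (rule SUP_mono) (auto intro: hausdorff_pre_mono)

lemma hausdorff_outer_empty [simp]: "hausdorff_outer s {} = 0"
proof -
  have "hausdorff_pre s \<delta> ({} :: 'a set) = 0" if "0 < \<delta>" for \<delta>
    using hausdorff_pre_lower[of "\<lambda>_. {} :: 'a set" \<delta> "{}" s] that by (simp add: diam_power_def)
  then show ?thesis
    unfolding hausdorff_outer_def by (simp add: SUP_constant)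
qed

lemma hausdorff_pre_subadd:
  fixes A :: "nat \<Rightarrow> 'a::metric_space set"
  shows "hausdorff_pre s \<delta> (\<Union>i. A i) \<le> (\<Sum>i. hausdorff_pre s \<delta> (A i))"
proof (rule ennreal_le_epsilon)
  fix e :: real assume e: "0 < e" and fin: "(\<Sum>i. hausdorff_pre s \<delta> (A i)) < top"
  define c where "c i = ennreal (e * (1/2) ^ Suc i)" for i
  have "\<exists>U. (\<forall>j. bounded (U j) \<and> diameter (U j) \<le> \<delta>) \<and> A i \<subseteq> (\<Union>j. U j) \<and>
          (\<Sum>j. diam_power s (U j)) \<le> hausdorff_pre s \<delta> (A i) + c i" for i
  proof -
    have "hausdorff_pre s \<delta> (A i) < hausdorff_pre s \<delta> (A i) + c i"
      using e fin by (auto simp: c_def less_top dest!: ennreal_suminf_lessD)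
    then obtain U where "(\<forall>j. bounded (U j) \<and> diameter (U j) \<le> \<delta>) \<and> A i \<subseteq> (\<Union>j. U j)"
        "(\<Sum>j. diam_power s (U j)) < hausdorff_pre s \<delta> (A i) + c i"
      unfolding hausdorff_pre_def INF_less_iff by auto
    then show ?thesis using less_imp_le by blast
  qed
  then obtain U where U: "\<And>i j. bounded (U i j)" "\<And>i j. diameter (U i j) \<le> \<delta>"
      "\<And>i. A i \<subseteq> (\<Union>j. U i j)"
      "\<And>i. (\<Sum>j. diam_power s (U i j)) \<le> hausdorff_pre s \<delta> (A i) + c i"
    by metis
  have cov: "(\<Union>i. A i) \<subseteq> (\<Union>k. case_prod U (prod_decode k))"
  proof
    fix x assume "x \<in> (\<Union>i. A i)"
    then obtain i j where "x \<in> U i j" using U(3) by blast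
    then have "x \<in> case_prod U (prod_decode (prod_encode (i,j)))" by simp
    then show "x \<in> (\<Union>k. case_prod U (prod_decode k))" by (rule UN_I[OF UNIV_I])
  qed
  have "hausdorff_pre s \<delta> (\<Union>i. A i) \<le> (\<Sum>k. diam_power s (case_prod U (prod_decode k)))"
    using U(1,2) cov by (intro hausdorff_pre_lower) (auto split: prod.splits)
  also have "\<dots> = (\<Sum>i. \<Sum>j. diam_power s (U i j))"
    by (rule suminf_ennreal_2dimen) simp
  also have "\<dots> \<le> (\<Sum>i. hausdorff_pre s \<delta> (A i) + c i)"
    by (intro suminf_le U(4)) auto
  also have "\<dots> = (\<Sum>i. hausdorff_pre s \<delta> (A i)) + (\<Sum>i. c i)"
    by (intro suminf_add[symmetric]) auto
  also have "(\<Sum>i. c i) = ennreal e"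
  proof -
    have "(\<lambda>i. e * (1/2) ^ Suc i) sums (e * 1)"
      by (intro sums_mult power_half_series)
    then show ?thesis unfolding c_def using e
      by (intro suminf_ennreal_eq) auto
  qed
  finally show "hausdorff_pre s \<delta> (\<Union>i. A i) \<le> (\<Sum>i. hausdorff_pre s \<delta> (A i)) + ennreal e" .
qed

lemma hausdorff_outer_subadd:
  fixes A :: "nat \<Rightarrow> 'a::metric_space set"
  shows "hausdorff_outer s (\<Union>i. A i) \<le> (\<Sum>i. hausdorff_outer s (A i))"
  unfolding hausdorff_outer_def[of s "\<Union>i. A i"]
proof (rule SUP_least)
  fix \<delta> :: real assume "\<delta> \<in> {0<..}"
  then show "hausdorff_pre s \<delta> (\<Union>i. A i) \<le> (\<Sum>i. hausdorff_outer s (A i))"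
    by (intro order_trans[OF hausdorff_pre_subadd] suminf_le) (auto intro: hausdorff_pre_le_outer)
qed

lemma hausdorff_outer_measure_space: "outer_measure_space UNIV (hausdorff_outer s)"
  unfolding outer_measure_space_def positive_def increasing_def countably_subadditive_def
  by (auto intro: hausdorff_outer_mono hausdorff_outer_subadd)

lemma hausdorff_pre_separated:
  fixes A B :: "'a::metric_space set"
  assumes r: "\<And>x y. x \<in> A \<Longrightarrow> y \<in> B \<Longrightarrow> \<delta> < dist x y" and "0 < \<delta>"
  shows "hausdorff_pre s \<delta> A + hausdorff_pre s \<delta> B \<le> hausdorff_pre s \<delta> (A \<union> B)"
  unfolding hausdorff_pre_def[of s \<delta> "A \<union> B"]
proof (rule INF_greatest)
  fix U :: "nat \<Rightarrow> 'a set"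
  assume "U \<in> {U. (\<forall>i. bounded (U i) \<and> diameter (U i) \<le> \<delta>) \<and> A \<union> B \<subseteq> (\<Union>i. U i)}"
  then have U: "\<And>i. bounded (U i)" "\<And>i. diameter (U i) \<le> \<delta>" "A \<union> B \<subseteq> (\<Union>i. U i)"
    by auto
  define V W where "V i = (if U i \<inter> A = {} then {} else U i)"
    and "W i = (if U i \<inter> A = {} then U i else {})" for i
  have "B \<subseteq> (\<Union>i. W i)"
  proof
    fix y assume y: "y \<in> B"
    then obtain i where i: "y \<in> U i" using U(3) by blast
    have "U i \<inter> A = {}"
    proof (rule ccontr)
      assume "U i \<inter> A \<noteq> {}"
      then obtain x where "x \<in> U i" "x \<in> A" by blast
      then show False
        using r[of x y] y diameter_bounded_bound[OF U(1), of x i y] i U(2)[of i] by simp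
    qed
    then show "y \<in> (\<Union>i. W i)" using i by (auto simp: W_def)
  qed
  then have "hausdorff_pre s \<delta> B \<le> (\<Sum>i. diam_power s (W i))"
    using U \<open>0 < \<delta>\<close> by (intro hausdorff_pre_lower) (auto simp: W_def)
  moreover have "A \<subseteq> (\<Union>i. V i)"
    using U(3) unfolding V_def by (fastforce split: if_splits)
  then have "hausdorff_pre s \<delta> A \<le> (\<Sum>i. diam_power s (V i))"
    using U \<open>0 < \<delta>\<close> by (intro hausdorff_pre_lower) (auto simp: V_def)
  ultimately have "hausdorff_pre s \<delta> A + hausdorff_pre s \<delta> B
      \<le> (\<Sum>i. diam_power s (V i)) + (\<Sum>i. diam_power s (W i))"
    by (rule add_mono[rotated])
  also have "\<dots> = (\<Sum>i. diam_power s (V i) + diam_power s (W i))"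
    by (intro suminf_add) auto
  also have "\<dots> = (\<Sum>i. diam_power s (U i))"
    by (intro suminf_cong) (auto simp: V_def W_def diam_power_def)
  finally show "hausdorff_pre s \<delta> A + hausdorff_pre s \<delta> B \<le> (\<Sum>i. diam_power s (U i))" .
qed

lemma hausdorff_outer_separated:
  fixes A B :: "'a::metric_space set"
  assumes r: "\<And>x y. x \<in> A \<Longrightarrow> y \<in> B \<Longrightarrow> r \<le> dist x y" and "0 < r"
  shows "hausdorff_outer s A + hausdorff_outer s B \<le> hausdorff_outer s (A \<union> B)"
proof -
  have "hausdorff_outer s A + hausdorff_outer s B
      = (SUP \<delta>\<in>{0<..}. hausdorff_pre s \<delta> A + hausdorff_pre s \<delta> B)"
    unfolding hausdorff_outer_def
  proof (rule SUP_add_directed_ennreal[symmetric])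
    fix d d' :: real assume "d \<in> {0<..}" "d' \<in> {0<..}"
    then show "\<exists>k\<in>{0<..}. hausdorff_pre s d A + hausdorff_pre s d' B
        \<le> hausdorff_pre s k A + hausdorff_pre s k B"
      by (intro bexI[of _ "min d d'"] add_mono hausdorff_pre_antimono) auto
  qed
  also have "\<dots> \<le> hausdorff_outer s (A \<union> B)"
  proof (rule SUP_least)
    fix \<delta> :: real assume d: "\<delta> \<in> {0<..}"
    define k where "k = min \<delta> (r / 2)"
    have k: "0 < k" "k < r" "k \<le> \<delta>" using d \<open>0 < r\<close> by (auto simp: k_def min_def)
    have "hausdorff_pre s \<delta> A + hausdorff_pre s \<delta> B \<le> hausdorff_pre s k A + hausdorff_pre s k B"
      using k by (intro add_mono hausdorff_pre_antimono)
    also have "\<dots> \<le> hausdorff_pre s k (A \<union> B)"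
      using k r by (intro hausdorff_pre_separated) (auto intro: less_le_trans)
    also have "\<dots> \<le> hausdorff_outer s (A \<union> B)"
      using k by (intro hausdorff_pre_le_outer)
    finally show "hausdorff_pre s \<delta> A + hausdorff_pre s \<delta> B \<le> hausdorff_outer s (A \<union> B)" .
  qed
  finally show ?thesis .
qed

lemma hausdorff_outer_closed:
  fixes C X :: "'a::metric_space set"
  assumes "closed C"
  shows "hausdorff_outer s (X \<inter> C) + hausdorff_outer s (X - C) \<le> hausdorff_outer s X"
proof (cases "C = {} \<or> hausdorff_outer s X = top")
  case True
  then show ?thesis by auto
next
  case False
  let ?f = "hausdorff_outer s :: 'a set \<Rightarrow> ennreal"
  define g where "g x = infdist x C" for x
  have C: "C \<noteq> {}" and fin: "?f X < top" using False by (auto simp: less_top)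
  have sep: "?f A + ?f B \<le> ?f (A \<union> B)"
    if "\<And>x. x \<in> A \<Longrightarrow> a \<le> g x" "\<And>x. x \<in> B \<Longrightarrow> g x \<le> b" "b < a" for A B a b
  proof (rule hausdorff_outer_separated)
    fix x y assume "x \<in> A" "y \<in> B"
    moreover have "g x \<le> g y + dist x y" unfolding g_def by (rule infdist_triangle)
    ultimately show "a - b \<le> dist x y" using that(1)[of x] that(2)[of y] by linarith
  qed (use that in auto)
  define B where "B n = {x \<in> X. 1 / real (n + 2) \<le> g x}" for n
  define R where "R n = {x \<in> X. 1 / real (n + 3) \<le> g x \<and> g x < 1 / real (n + 2)}" for n
  have half: "(\<Sum>k<m. ?f (R (2 * k + j))) \<le> ?f (\<Union>k<m. R (2 * k + j))" for m j
  proof (induction m)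
    case (Suc m)
    have "(\<Sum>k<Suc m. ?f (R (2 * k + j))) \<le> ?f (\<Union>k<m. R (2 * k + j)) + ?f (R (2 * m + j))"
      using Suc by (simp add: add_right_mono)
    also have "\<dots> \<le> ?f ((\<Union>k<m. R (2 * k + j)) \<union> R (2 * m + j))"
    proof (rule sep)
      fix x assume "x \<in> (\<Union>k<m. R (2 * k + j))"
      then obtain k where k: "k < m" "1 / real (2 * k + j + 3) \<le> g x"
        by (auto simp: R_def)
      have "1 / real (2 * m + j + 1) \<le> 1 / real (2 * k + j + 3)"
        using k(1) by (intro divide_left_mono) auto
      then show "1 / real (2 * m + j + 1) \<le> g x" using k(2) by linarith
    next
      fix x assume "x \<in> R (2 * m + j)"
      then show "g x \<le> 1 / real (2 * m + j + 2)" by (auto simp: R_def)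
    next
      show "1 / real (2 * m + j + 2) < 1 / real (2 * m + j + 1)"
        by (intro divide_strict_left_mono) auto
    qed
    also have "(\<Union>k<m. R (2 * k + j)) \<union> R (2 * m + j) = (\<Union>k<Suc m. R (2 * k + j))"
      by (auto simp: lessThan_Suc)
    finally show ?case .
  qed simp
  have half': "(\<Sum>k<m. ?f (R (2 * k + j))) \<le> ?f X" for m j
    by (rule order_trans[OF half]) (auto intro!: hausdorff_outer_mono simp: R_def)
  define T where "T = (\<Sum>k. ?f (R k))"
  have "T \<le> ?f X + ?f X"
    unfolding T_def
  proof (rule suminf_le_const)
    fix n
    have "(\<Sum>k<n. ?f (R k)) \<le> (\<Sum>k<2 * n. ?f (R k))"
      by (rule sum_mono2) auto
    also have "\<dots> = (\<Sum>k<n. ?f (R (2 * k + 0))) + (\<Sum>k<n. ?f (R (2 * k + 1)))"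
      by (induction n) (auto simp: algebra_simps)
    also have "\<dots> \<le> ?f X + ?f X" by (intro add_mono half')
    finally show "(\<Sum>k<n. ?f (R k)) \<le> ?f X + ?f X" .
  qed auto
  also have "\<dots> < top" using fin by simp
  finally have T: "T < top" .
  have sub: "?f (\<Union>i. A i) \<le> (\<Sum>i. ?f (A i))" for A
    by (rule hausdorff_outer_subadd)
  have "(\<Sum>k<n. ?f (R k)) + (?f (X \<inter> C) + ?f (X - C)) \<le> ?f X + T" for n
  proof -
    define A where "A i = (case i of 0 \<Rightarrow> B n | Suc k \<Rightarrow> R (k + n))" for i
    have "X - C \<subseteq> (\<Union>i. A i)"
    proof
      fix x assume x: "x \<in> X - C"
      then have "0 < g x"
        using \<open>closed C\<close> C unfolding g_def
        by (metis DiffD2 in_closed_iff_infdist_zero infdist_nonneg less_eq_real_def)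
      then obtain k0 where k0: "1 / real (Suc k0) < g x" using nat_approx_posE by (metis inverse_eq_divide)
      have ex: "\<exists>k. 1 / real (k + 2) \<le> g x"
      proof
        have "1 / real (k0 + 2) \<le> 1 / real (Suc k0)" by (intro divide_left_mono) auto
        then show "1 / real (k0 + 2) \<le> g x" using k0 by linarith
      qed
      define k where "k = (LEAST k. 1 / real (k + 2) \<le> g x)"
      have k: "1 / real (k + 2) \<le> g x" unfolding k_def by (rule LeastI_ex[OF ex])
      show "x \<in> (\<Union>i. A i)"
      proof (cases "k \<le> n")
        case True
        then have "1 / real (n + 2) \<le> 1 / real (k + 2)" by (intro divide_left_mono) auto
        then have "x \<in> A 0" using x k by (auto simp: A_def B_def)
        then show ?thesis by blast
      next
        case False
        then obtain m where m: "k = Suc (m + n)"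
          by (metis add.commute less_imp_Suc_add not_le)
        have "\<not> 1 / real (m + n + 2) \<le> g x"
          using not_less_Least[of "m + n" "\<lambda>k. 1 / real (k + 2) \<le> g x"] m
          unfolding k_def[symmetric] by simp
        then have "x \<in> A (Suc m)" using x k m by (auto simp: A_def R_def add_ac)
        then show ?thesis by blast
      qed
    qed
    then have "?f (X - C) \<le> (\<Sum>i. ?f (A i))"
      by (rule order_trans[OF hausdorff_outer_mono sub])
    also have "\<dots> = ?f (B n) + (\<Sum>k. ?f (R (k + n)))"
      using suminf_offset[of "\<lambda>i. ?f (A i)" 1] by (simp add: A_def)
    finally have 1: "?f (X - C) \<le> ?f (B n) + (\<Sum>k. ?f (R (k + n)))" .
    have "?f (B n) + ?f (X \<inter> C) \<le> ?f (B n \<union> (X \<inter> C))"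
    proof (rule sep)
      show "0 < 1 / real (n + 2)" by simp
    qed (auto simp: B_def g_def)
    also have "\<dots> \<le> ?f X" by (rule hausdorff_outer_mono) (auto simp: B_def)
    finally have 2: "?f (B n) + ?f (X \<inter> C) \<le> ?f X" .
    have 3: "T = (\<Sum>k. ?f (R (k + n))) + (\<Sum>k<n. ?f (R k))"
      unfolding T_def by (subst suminf_offset[of _ n]) (auto simp: add.commute)
    have "(\<Sum>k<n. ?f (R k)) + (?f (X \<inter> C) + ?f (X - C))
        \<le> (\<Sum>k<n. ?f (R k)) + (?f (X \<inter> C) + (?f (B n) + (\<Sum>k. ?f (R (k + n)))))"
      by (intro add_left_mono 1)
    also have "\<dots> = (?f (B n) + ?f (X \<inter> C)) + T"
      unfolding 3 by (simp add: add_ac)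
    also have "\<dots> \<le> ?f X + T" by (intro add_right_mono 2)
    finally show ?thesis .
  qed
  then have "T + (?f (X \<inter> C) + ?f (X - C)) \<le> ?f X + T"
    unfolding T_def by (intro ennreal_suminf_bound_add) auto
  then show ?thesis
    using T by (auto simp: add.commute[of _ T] ennreal_add_left_cancel_le)
qed

lemma emeasure_hausdorff_measure:
  fixes A :: "'a::metric_space set"
  assumes "A \<in> sets borel"
  shows "emeasure (hausdorff_measure s) A = hausdorff_outer s A"
proof -
  interpret sigma_algebra "UNIV :: 'a set" UNIV
    using sigma_algebra_Pow[of "UNIV :: 'a set"] by simp
  define L where "L = lambda_system (UNIV :: 'a set) UNIV (hausdorff_outer s)"
  have ms: "measure_space UNIV L (hausdorff_outer s)"
    unfolding L_def by (rule caratheodory_lemma[OF hausdorff_outer_measure_space])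
  have "C \<in> L" if "closed C" for C
  proof -
    have "hausdorff_outer s X \<le> hausdorff_outer s (X \<inter> C) + hausdorff_outer s (X - C)" for X
    proof -
      define D where "D i = (case i of 0 \<Rightarrow> X \<inter> C | Suc 0 \<Rightarrow> X - C | _ \<Rightarrow> {})" for i :: nat
      have "hausdorff_outer s X \<le> hausdorff_outer s (\<Union>i. D i)"
      proof (rule hausdorff_outer_mono)
        have "X = D 0 \<union> D 1" by (auto simp: D_def)
        then show "X \<subseteq> (\<Union>i. D i)" by blast
      qed
      also have "\<dots> \<le> (\<Sum>i. hausdorff_outer s (D i))" by (rule hausdorff_outer_subadd)
      also have "\<dots> = (\<Sum>i\<in>{0, 1}. hausdorff_outer s (D i))"
        by (rule suminf_finite) (auto simp: D_def split: nat.splits)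
      finally show ?thesis by (simp add: D_def)
    qed
    then show ?thesis
      unfolding L_def lambda_system_eq using hausdorff_outer_closed[OF that, of s]
      by (auto intro!: antisym)
  qed
  then have "sigma_sets UNIV (Collect closed) \<subseteq> L"
    using ms by (intro sigma_algebra.sigma_sets_subset) (auto simp: measure_space_def)
  then have sub: "sets (borel :: 'a measure) \<subseteq> L"
    by (simp add: borel_eq_closed)
  have "measure_space UNIV (sets (borel :: 'a measure)) (hausdorff_outer s)"
    using ms sub sets.sigma_algebra_axioms[of "borel :: 'a measure"]
    by (auto simp: measure_space_def positive_def countably_additive_def)
  then show ?thesis
    unfolding hausdorff_measure_def using assms sets.sigma_sets_eq[of "borel :: 'a measure"]
    by (subst emeasure_measure_of_sigma) (auto simp: measure_space_def)
qed

lemma sets_hausdorff_measure [simp, measurable_cong]: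
  "sets (hausdorff_measure s :: 'a::metric_space measure) = sets borel"
  unfolding hausdorff_measure_def using sets.sigma_sets_eq[of "borel :: 'a measure"]
  by (simp add: sets_measure_of_conv)

lemma emeasure_hausdorff_measure_on:
  fixes A K :: "'a::metric_space set"
  assumes "A \<in> sets borel" "K \<in> sets borel"
  shows "emeasure (hausdorff_measure_on s K) A = hausdorff_outer s (A \<inter> K)"
proof -
  have "emeasure (hausdorff_measure_on s K) A
      = (\<integral>\<^sup>+x. indicator (A \<inter> K) x \<partial>hausdorff_measure s)"
    unfolding hausdorff_measure_on_def using assms
    by (subst emeasure_density)
       (auto intro!: nn_integral_cong simp del: nn_integral_indicator split: split_indicator)
  also have "\<dots> = emeasure (hausdorff_measure s) (A \<inter> K)"
    using assms by (intro nn_integral_indicator) simp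
  finally show ?thesis using assms by (simp add: emeasure_hausdorff_measure)
qed


section \<open>Iterated function systems\<close>

definition contractive_similarity :: "(real ^ 'n \<Rightarrow> real ^ 'n) \<Rightarrow> bool" where
  "contractive_similarity f \<longleftrightarrow>
     (\<exists>(\<rho>::real) (Q :: real ^ 'n ^ 'n) b. 0 < \<rho> \<and> \<rho> < 1 \<and> rotation_matrix Q \<and>
        f = (\<lambda>x. \<rho> *\<^sub>R (Q *v x) + b))"

definition iterated_function_system :: "'i set \<Rightarrow> ('i \<Rightarrow> real ^ 'n \<Rightarrow> real ^ 'n) \<Rightarrow> bool" where
  "iterated_function_system \<Lambda> h \<longleftrightarrow> finite \<Lambda> \<and> (\<forall>i\<in>\<Lambda>. contractive_similarity (h i))"

definition is_limit_set ::
    "'i set \<Rightarrow> ('i \<Rightarrow> 'a::topological_space \<Rightarrow> 'a) \<Rightarrow> 'a set \<Rightarrow> bool" where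
  "is_limit_set \<Lambda> h K \<longleftrightarrow> compact K \<and> K \<noteq> {} \<and> K = (\<Union>i\<in>\<Lambda>. h i ` K)"

definition open_set_condition ::
    "'i set \<Rightarrow> ('i \<Rightarrow> 'a::topological_space \<Rightarrow> 'a) \<Rightarrow> bool" where
  "open_set_condition \<Lambda> h \<longleftrightarrow>
     (\<exists>U. open U \<and> U \<noteq> {} \<and> (\<forall>i\<in>\<Lambda>. h i ` U \<subseteq> U) \<and>
        (\<forall>i\<in>\<Lambda>. \<forall>j\<in>\<Lambda>. i \<noteq> j \<longrightarrow> h i ` U \<inter> h j ` U = {}))"


section \<open>Singular vectors\<close>

definition of_int_vec :: "int ^ 'n \<Rightarrow> real ^ 'n" where
  "of_int_vec q = (\<chi> i. of_int (q $ i))"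

text \<open>
  \<^const>\<open>infnorm\<close> is the supremum norm.  The case \<open>N = 0\<close>, where HOL sets \<open>\<epsilon> / 0 = 0\<close>, is harmless:
  \<open>N\<^sub>0\<close> may always be taken positive.
\<close>

definition singular_vector :: "real ^ 'n \<Rightarrow> bool" where
  "singular_vector x \<longleftrightarrow>
     (\<forall>\<epsilon>::real. 0 < \<epsilon> \<and> \<epsilon> < 1 \<longrightarrow>
        (\<exists>N\<^sub>0::nat. \<forall>N\<ge>N\<^sub>0. \<exists>(p::int) (q :: int ^ 'n). (p, q) \<noteq> (0, 0) \<and>
           \<bar>of_int_vec q \<bullet> x + of_int p\<bar> \<le> \<epsilon> / real N \<and>
           infnorm (of_int_vec q) \<le> real N powr (1 / real CARD('n))))"

definition Sing :: "(real ^ 'n) set" where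
  "Sing = {x. singular_vector x}"


section \<open>The exponents \<open>\<alpha>\<^sub>\<ell>\<close>\<close>

definition affine_subspaces :: "nat \<Rightarrow> 'a::euclidean_space set set" where
  "affine_subspaces k = {L. affine L \<and> aff_dim L = int k}"

definition open_nbhd :: "real \<Rightarrow> 'a::metric_space set \<Rightarrow> 'a set" where
  "open_nbhd \<epsilon> L = (\<Union>x\<in>L. ball x \<epsilon>)"

definition ln_ennreal :: "ennreal \<Rightarrow> ereal" where
  "ln_ennreal x =
     (if x = 0 then -\<infinity> else if x = \<infinity> then \<infinity> else ereal (ln (enn2real x)))"

definition alpha :: "nat \<Rightarrow> 'a::euclidean_space measure \<Rightarrow> ereal" where
  "alpha l \<mu> =
     Liminf (at_right 0)
       (\<lambda>\<epsilon>. ln_ennreal (SUP L\<in>affine_subspaces (DIM('a) - l). emeasure \<mu> (open_nbhd \<epsilon> L))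
             / ereal (ln \<epsilon>))"

end

theory Submission
  imports Defs "HOL-Real_Asymp.Real_Asymp"
begin

text \<open>
  A vector \<open>x\<close> is singular iff the lattices \<open>g\<^sub>t u(x) \<int>\<^sup>d\<^sup>+\<^sup>1\<close> leave every compact set, where \<open>g\<^sub>t\<close> is the
  Dani diagonal flow. The excursions are measured by the height \<open>sup\<^sub>S cov(S)\<^bsup>-\<beta>(dim S)\<^esup>\<close>, where \<open>S\<close> ranges
  over the rational subspaces. For a single \<open>S\<close> of rank \<open>\<ell>\<close>, the covolume grows by \<open>e\<^bsup>t(d-\<ell>+1)/d\<^esup>\<close> unless \<open>x\<close>
  is close to an affine subspace of codimension \<open>\<ell>\<close>, which the exponent \<open>\<alpha>\<^sub>\<ell>\<close> makes rare; so the average of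
  \<open>cov(S)\<^bsup>-\<beta>\<^esup>\<close> over a piece of the fractal contracts for \<open>\<beta> < \<alpha>\<^sub>\<ell>\<close>. Taking \<open>\<beta>(\<ell>)\<close> close to
  \<open>\<delta> / (d - \<ell> + 1)\<close> gives all ranks the same contraction rate and makes \<open>1 / \<beta>\<close> concave in the rank, so by
  submodularity of the covolume at most one \<open>S\<close> of each rank comes near the supremum once the height is
  large. Hence the height itself contracts on average, the total weight of the pieces on which it stays
  large decays exponentially, and these pieces cover the singular vectors.
\<close>

section \<open>Discrete subgroups and their densities\<close>

text \<open>The height is a supremum over infinitely many subspaces, whereas averaging contracts
  each term separately, and a sum cannot be exchanged with a supremum. Uniqueness in each rank
  removes this obstacle: at a high point at most \<open>CARD('n)\<close> subspaces compete, and all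
  others start so far below the supremum that even the fastest growth over one step cannot bring
  them up to it. Each step loses a constant and a factor linear in its logarithmic length
  \<open>k\<close>; a long step absorbs both, at the price of an arbitrarily small part of the rate.
  Nothing is gained at low points, so only words are followed whose pieces meet a set of points that
  have short vectors at all times from some \<open>n0\<close> on. The bound in the theorem is the
  rate at the worst rank. Expanding the variable \<open>x\<close> by a factor b multiplies the
  covolume in rank l, at a typical point, by b to the power (d+1-l)/(d+1), where d =
  \<open>CARD('n)\<close>. Its power with exponent -\<beta>, for \<beta> below the decay exponent of
  rank l, therefore decays with rate \<beta> (d+1-l)/(d+1).\<close>

definition discrete_subgroup :: "'a::euclidean_space set \<Rightarrow> bool" where
  "discrete_subgroup X \<longleftrightarrow> 0 \<in> X \<and> (\<forall>x\<in>X. \<forall>y\<in>X. x - y \<in> X) \<and> (\<forall>R. finite {x \<in> X. norm x \<le> R})"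

definition ball_count :: "'a::euclidean_space set \<Rightarrow> real \<Rightarrow> nat" where
  "ball_count X R = card {x \<in> X. norm x \<le> R}"

text \<open>
  Up to factors depending only on the dimension this is the reciprocal covolume of \<open>X\<close> in its span;
  counting points makes submodularity accessible without exterior powers or adapted bases.
\<close>

definition density_of :: "'a::euclidean_space set \<Rightarrow> real" where
  "density_of X = (INF R\<in>{0<..}. real (ball_count X R) / R ^ dim X)"

lemma discrete_subgroup_finite: "discrete_subgroup X \<Longrightarrow> finite {x \<in> X. norm x \<le> R}"
  by (simp add: discrete_subgroup_def)

lemma discrete_subgroup_add:
  assumes "discrete_subgroup X" "x \<in> X" "y \<in> X" shows "x + y \<in> X"
proof -
  have "0 - y \<in> X" using assms unfolding discrete_subgroup_def by blast
  then have "x - (0 - y) \<in> X" using assms unfolding discrete_subgroup_def by blast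
  then show ?thesis by simp
qed

lemma card_le_fibres:
  assumes "finite F" "f ` F \<subseteq> G" "finite G" "\<And>z. z \<in> G \<Longrightarrow> card {x\<in>F. f x = z} \<le> m"
  shows "card F \<le> card G * m"
proof -
  have "card F = (\<Sum>z\<in>G. card {x\<in>F. f x = z})"
    using sum.group[OF assms(1,3,2), of "\<lambda>_. 1::nat"] by simp
  also have "\<dots> \<le> (\<Sum>z\<in>G. m)" by (intro sum_mono assms(4))
  finally show ?thesis by simp
qed

text \<open>Cut the box into cells of side R / DIM('a). Two points of one cell differ by an element
  of \<open>X\<close> of norm at most R, so a cell holds at most \<open>ball_count X R\<close>
  points, and the product bounds the number of cells. The widths may differ from one direction to
  another, which is what \<open>density_expand\<close> exploits.\<close>

lemma box_count:
  fixes X :: "'a::euclidean_space set"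
  assumes X: "discrete_subgroup X" and B: "pairwise orthogonal B" "\<And>b. b \<in> B \<Longrightarrow> norm b = 1"
    and XB: "X \<subseteq> span B" and R: "0 < R" and w: "\<And>b. b \<in> B \<Longrightarrow> 0 \<le> w b"
  shows "finite {x \<in> X. \<forall>b\<in>B. \<bar>x \<bullet> b\<bar> \<le> w b}" (is "finite ?F")
    and "real (card {x \<in> X. \<forall>b\<in>B. \<bar>x \<bullet> b\<bar> \<le> w b})
      \<le> (\<Prod>b\<in>B. 2 * real DIM('a) * w b / R + 2) * real (ball_count X R)"
proof -
  have ind: "independent B" using B by (intro pairwise_orthogonal_independent) force+
  then have finB: "finite B" and cB: "card B \<le> DIM('a)"
    using independent_bound by auto
  have ex: "(\<Sum>b\<in>B. (x \<bullet> b) *\<^sub>R b) = x" if "x \<in> span B" for x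
    using orthonormal_basis_expand[OF B that finB] .
  have nle: "norm x \<le> (\<Sum>b\<in>B. \<bar>x \<bullet> b\<bar>)" if "x \<in> span B" for x
  proof -
    have "norm x = norm (\<Sum>b\<in>B. (x \<bullet> b) *\<^sub>R b)" using ex[OF that] by simp
    also have "\<dots> \<le> (\<Sum>b\<in>B. norm ((x \<bullet> b) *\<^sub>R b))" by (rule norm_sum)
    also have "\<dots> = (\<Sum>b\<in>B. \<bar>x \<bullet> b\<bar>)" using B(2) by (intro sum.cong) auto
    finally show ?thesis .
  qed
  have "?F \<subseteq> {x\<in>X. norm x \<le> (\<Sum>b\<in>B. w b)}"
  proof safe
    fix x assume "x \<in> X" "\<forall>b\<in>B. \<bar>x \<bullet> b\<bar> \<le> w b"
    then have "norm x \<le> (\<Sum>b\<in>B. \<bar>x \<bullet> b\<bar>)" "(\<Sum>b\<in>B. \<bar>x \<bullet> b\<bar>) \<le> (\<Sum>b\<in>B. w b)"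
      using nle[of x] XB by (auto intro: sum_mono)
    then show "norm x \<le> (\<Sum>b\<in>B. w b)" by linarith
  qed
  then show finF: "finite ?F" using discrete_subgroup_finite[OF X] finite_subset by blast
  define \<sigma> where "\<sigma> = R / real DIM('a)"
  have \<sigma>: "\<sigma> > 0" using R by (simp add: \<sigma>_def)
  define f where "f x = (\<lambda>b\<in>B. \<lfloor>(x \<bullet> b) / \<sigma>\<rfloor>)" for x
  define G where "G = (\<Pi>\<^sub>E b\<in>B. {\<lfloor>- (w b / \<sigma>)\<rfloor> .. \<lfloor>w b / \<sigma>\<rfloor>})"
  have "f ` ?F \<subseteq> G"
  proof (intro image_subsetI)
    fix x assume x: "x \<in> ?F"
    show "f x \<in> G" unfolding f_def G_def
    proof (rule restrict_PiE_iff[THEN iffD2], intro ballI)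
      fix b assume b: "b \<in> B"
      have "- w b \<le> x \<bullet> b" "x \<bullet> b \<le> w b" using x b by (auto simp: abs_le_iff)
      then have "- (w b / \<sigma>) \<le> (x \<bullet> b) / \<sigma>" "(x \<bullet> b) / \<sigma> \<le> w b / \<sigma>"
        using \<sigma> by (auto simp: field_simps)
      then show "\<lfloor>(x \<bullet> b) / \<sigma>\<rfloor> \<in> {\<lfloor>- (w b / \<sigma>)\<rfloor>..\<lfloor>w b / \<sigma>\<rfloor>}"
        by (auto intro: floor_mono)
    qed
  qed
  moreover have "finite G" unfolding G_def using finB by (intro finite_PiE) auto
  moreover have "card {x\<in>?F. f x = z} \<le> ball_count X R" if "z \<in> G" for z
  proof (cases "{x\<in>?F. f x = z} = {}")
    case False
    then obtain x0 where x0: "x0 \<in> ?F" "f x0 = z" by blast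
    have "(\<lambda>x. x - x0) ` {x\<in>?F. f x = z} \<subseteq> {x\<in>X. norm x \<le> R}"
    proof (intro image_subsetI)
      fix x assume x: "x \<in> {x\<in>?F. f x = z}"
      have d: "\<bar>(x - x0) \<bullet> b\<bar> \<le> \<sigma>" if b: "b \<in> B" for b
      proof -
        have "\<lfloor>(x \<bullet> b) / \<sigma>\<rfloor> = \<lfloor>(x0 \<bullet> b) / \<sigma>\<rfloor>"
          using x x0(2) b unfolding f_def by (auto dest: fun_cong[where x=b] simp: restrict_def)
        then have "\<bar>(x \<bullet> b) / \<sigma> - (x0 \<bullet> b) / \<sigma>\<bar> \<le> 1" by linarith
        then have "\<bar>((x - x0) \<bullet> b) / \<sigma>\<bar> \<le> 1" by (simp add: diff_divide_distrib inner_diff_left)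
        then show ?thesis using \<sigma> by (simp add: abs_divide)
      qed
      have "x - x0 \<in> X" using x x0 X unfolding discrete_subgroup_def by blast
      moreover from this have "norm (x - x0) \<le> (\<Sum>b\<in>B. \<bar>(x - x0) \<bullet> b\<bar>)" using XB nle by blast
      moreover have "\<dots> \<le> (\<Sum>b\<in>B. \<sigma>)" by (intro sum_mono d)
      moreover have "\<dots> \<le> R"
      proof -
        have "real (card B) * \<sigma> \<le> real DIM('a) * \<sigma>" using cB \<sigma> by (intro mult_right_mono) auto
        then show ?thesis by (simp add: \<sigma>_def)
      qed
      ultimately show "x - x0 \<in> {x\<in>X. norm x \<le> R}" by auto
    qed
    moreover have "inj_on (\<lambda>x. x - x0) {x\<in>?F. f x = z}" by (auto simp: inj_on_def)
    ultimately show ?thesis unfolding ball_count_def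
      using card_inj_on_le discrete_subgroup_finite[OF X] by blast
  next
    case True
    show ?thesis unfolding True by simp
  qed
  ultimately have "card ?F \<le> card G * ball_count X R"
    using card_le_fibres[OF finF, of f G "ball_count X R"] by blast
  then have "real (card ?F) \<le> real (card G) * real (ball_count X R)"
    by (simp only: of_nat_mult[symmetric] of_nat_le_iff)
  also have "real (card G) \<le> (\<Prod>b\<in>B. 2 * real DIM('a) * w b / R + 2)"
  proof -
    have "real (card G) = (\<Prod>b\<in>B. real (card {\<lfloor>- (w b / \<sigma>)\<rfloor> .. \<lfloor>w b / \<sigma>\<rfloor>}))"
      unfolding G_def using finB by (simp add: card_PiE)
    also have "\<dots> \<le> (\<Prod>b\<in>B. 2 * real DIM('a) * w b / R + 2)"
    proof (intro prod_mono conjI)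
      fix b assume "b \<in> B"
      have 0: "w b / \<sigma> \<ge> 0" using w[OF \<open>b \<in> B\<close>] \<sigma> by simp
      then have "real (card {\<lfloor>- (w b / \<sigma>)\<rfloor> .. \<lfloor>w b / \<sigma>\<rfloor>}) \<le> 2 * (w b / \<sigma>) + 2"
        by simp linarith
      also have "\<dots> = 2 * real DIM('a) * w b / R + 2" by (simp add: \<sigma>_def)
      finally show "real (card {\<lfloor>- (w b / \<sigma>)\<rfloor> .. \<lfloor>w b / \<sigma>\<rfloor>}) \<le> 2 * real DIM('a) * w b / R + 2" .
    qed auto
    finally show ?thesis .
  qed
  finally show "real (card ?F) \<le> (\<Prod>b\<in>B. 2 * real DIM('a) * w b / R + 2) * real (ball_count X R)"
    by (simp add: mult_right_mono)
qed

lemma density_bdd: "bdd_below ((\<lambda>R. real (ball_count X R) / R ^ dim X) ` {0<..})"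
  by (rule bdd_belowI[of _ 0]) auto

lemma density_nonneg: "0 \<le> density_of X"
  unfolding density_of_def by (rule cINF_greatest) auto

lemma density_le: "0 < R \<Longrightarrow> density_of X \<le> real (ball_count X R) / R ^ dim X"
  unfolding density_of_def by (rule cINF_lower[OF density_bdd]) auto

lemma density_greatest:
  assumes "\<And>R. 0 < R \<Longrightarrow> c \<le> real (ball_count X R) / R ^ dim X" shows "c \<le> density_of X"
  unfolding density_of_def using assms by (intro cINF_greatest) auto

lemma density_cancel:
  assumes "\<And>R. 0 < R \<Longrightarrow> real (ball_count X (R / l)) / (R / l) ^ dim X * C \<ge> t" "0 < l" "0 < C"
  shows "t \<le> C * density_of X"
proof -
  have "t / C \<le> density_of X"
  proof (rule density_greatest)
    fix R :: real assume "0 < R"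
    then show "t / C \<le> real (ball_count X R) / R ^ dim X"
      using assms(1)[of "R * l"] assms(2,3) by (simp add: field_simps)
  qed
  then show ?thesis using assms(3) by (simp add: field_simps)
qed

text \<open>Normalised counts are decreasing in the radius up to a dimensional constant. Hence the
  infimum in \<open>density_of\<close> governs the counts at all large radii and not only near one
  of them.\<close>

lemma ball_count_scale:
  fixes X :: "'a::euclidean_space set"
  assumes X: "discrete_subgroup X" and R: "0 < R" "R \<le> R'"
  shows "real (ball_count X R') / R' ^ dim X
    \<le> (2 * real DIM('a) + 2) ^ DIM('a) * (real (ball_count X R) / R ^ dim X)"
proof -
  obtain B where B: "B \<subseteq> span X" "pairwise orthogonal B" "\<And>x. x \<in> B \<Longrightarrow> norm x = 1"
     "independent B" "card B = dim (span X)" "span B = span X"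
    using orthonormal_basis_subspace[of "span X"] by auto
  have X': "X \<subseteq> span B" using B(6) span_superset by blast
  have cB: "card B = dim X" using B(5) by simp
  have finB: "finite B" using B(4) independent_bound by blast
  let ?D = "real DIM('a)"
  let ?F = "{x \<in> X. \<forall>b\<in>B. \<bar>x \<bullet> b\<bar> \<le> R'}"
  have "ball_count X R' \<le> card ?F" unfolding ball_count_def
  proof (rule card_mono)
    show "finite ?F" using box_count(1)[OF X B(2,3) X' R(1), of "\<lambda>_. R'"] R by auto
    show "{x \<in> X. norm x \<le> R'} \<subseteq> ?F"
    proof safe
      fix x b :: 'a assume "norm x \<le> R'" "b \<in> B"
      then show "\<bar>x \<bullet> b\<bar> \<le> R'" using Cauchy_Schwarz_ineq2[of x b] B(3)[of b] by simp
    qed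
  qed
  then have "real (ball_count X R') \<le> real (card ?F)" by simp
  also have "\<dots> \<le> (\<Prod>b\<in>B. 2 * ?D * R' / R + 2) * real (ball_count X R)"
    using box_count(2)[OF X B(2,3) X' R(1), of "\<lambda>_. R'"] R by auto
  also have "(\<Prod>b\<in>B. 2 * ?D * R' / R + 2) = (2 * ?D * R' / R + 2) ^ dim X"
    by (simp add: cB)
  also have "\<dots> \<le> ((2 * ?D + 2) * (R' / R)) ^ dim X"
    using R by (intro power_mono) (auto simp: field_simps)
  also have "\<dots> = (2 * ?D + 2) ^ dim X * (R' / R) ^ dim X" by (rule power_mult_distrib)
  also have "(2 * ?D + 2) ^ dim X \<le> (2 * ?D + 2) ^ DIM('a)"
    by (intro power_increasing) (auto simp: dim_subset_UNIV)
  finally have "real (ball_count X R') \<le> (2 * ?D + 2) ^ DIM('a) * (R' / R) ^ dim X * real (ball_count X R)"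
    using R by (simp add: mult_right_mono)
  then have "real (ball_count X R') / R' ^ dim X
     \<le> (2 * ?D + 2) ^ DIM('a) * (R' / R) ^ dim X * real (ball_count X R) / R' ^ dim X"
    using R by (intro divide_right_mono) auto
  also have "\<dots> = (2 * ?D + 2) ^ DIM('a) * (real (ball_count X R) / R ^ dim X)"
    using R by (simp add: power_divide)
  finally show ?thesis .
qed

lemma ball_count_eventually_le:
  fixes X :: "'a::euclidean_space set"
  assumes X: "discrete_subgroup X" and e: "0 < e"
  obtains R0 where "0 < R0"
    "\<And>R. R0 \<le> R \<Longrightarrow> real (ball_count X R) \<le> (2 * real DIM('a) + 2) ^ DIM('a) * (density_of X + e) * R ^ dim X"
proof -
  have "density_of X < density_of X + e" using e by simp
  then have "\<exists>R0\<in>{0<..}. real (ball_count X R0) / R0 ^ dim X < density_of X + e"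
    unfolding density_of_def by (subst (asm) cINF_less_iff) (use density_bdd in auto)
  then obtain R0 where R0: "0 < R0" "real (ball_count X R0) / R0 ^ dim X < density_of X + e"
    by auto
  show ?thesis
  proof (rule that[OF R0(1)])
    fix R assume R: "R0 \<le> R"
    have "real (ball_count X R) / R ^ dim X \<le> (2 * real DIM('a) + 2) ^ DIM('a) * (density_of X + e)"
      by (rule order_trans[OF ball_count_scale[OF X R0(1) R] mult_left_mono]) (use R0(2) in auto)
    then show "real (ball_count X R) \<le> (2 * real DIM('a) + 2) ^ DIM('a) * (density_of X + e) * R ^ dim X"
      using R R0(1) by (simp add: field_simps)
  qed
qed

text \<open>The fibres of the addition map on \<open>X1 \<times> X2\<close> are translates of \<open>X1 \<inter> X2\<close>.\<close>

lemma ball_count_sum_Int: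
  fixes X1 X2 Y :: "'a::euclidean_space set"
  assumes X: "discrete_subgroup X1" "discrete_subgroup X2" "discrete_subgroup Y"
    and Y: "X1 \<subseteq> Y" "X2 \<subseteq> Y"
  shows "ball_count X1 R * ball_count X2 R \<le> ball_count Y (2 * R) * ball_count (X1 \<inter> X2) (2 * R)"
proof -
  let ?F = "{x \<in> X1. norm x \<le> R} \<times> {x \<in> X2. norm x \<le> R}"
  let ?f = "\<lambda>(x, y). x + y"
  have finF: "finite ?F" by (intro finite_cartesian_product discrete_subgroup_finite X)
  have "card ?F \<le> card {x \<in> Y. norm x \<le> 2 * R} * ball_count (X1 \<inter> X2) (2 * R)"
  proof (rule card_le_fibres[OF finF, of ?f])
    show "?f ` ?F \<subseteq> {x \<in> Y. norm x \<le> 2 * R}"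
    proof (clarsimp, intro conjI)
      fix a b assume ab: "a \<in> X1" "norm a \<le> R" "b \<in> X2" "norm b \<le> R"
      show "a + b \<in> Y" using discrete_subgroup_add[OF X(3)] ab Y by blast
      show "norm (a + b) \<le> 2 * R" using norm_triangle_ineq[of a b] ab by linarith
    qed
    show "finite {x \<in> Y. norm x \<le> 2 * R}" by (rule discrete_subgroup_finite[OF X(3)])
    fix z
    show "card {x\<in>?F. ?f x = z} \<le> ball_count (X1 \<inter> X2) (2 * R)"
    proof (cases "{x\<in>?F. ?f x = z} = {}")
      case False
      then obtain a0 b0 where 0: "(a0, b0) \<in> ?F" "a0 + b0 = z" by auto
      have "(\<lambda>(x,y). x - a0) ` {x\<in>?F. ?f x = z} \<subseteq> {x\<in>X1 \<inter> X2. norm x \<le> 2 * R}"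
      proof (clarsimp, intro conjI)
        fix a b assume ab: "a \<in> X1" "norm a \<le> R" "b \<in> X2" "norm b \<le> R" "z = a + b"
        show "a - a0 \<in> X1" using 0 ab X(1) unfolding discrete_subgroup_def by blast
        have "a - a0 = b0 - b" using ab(5) 0(2) by (simp add: algebra_simps)
        then show "a - a0 \<in> X2" using 0 ab X(2) unfolding discrete_subgroup_def by auto
        show "norm (a - a0) \<le> 2 * R" using 0 ab norm_triangle_ineq4[of a a0] by auto
      qed
      moreover have "inj_on (\<lambda>(x,y). x - a0) {x\<in>?F. ?f x = z}"
        by (auto simp: inj_on_def)
      moreover have "finite {x\<in>X1 \<inter> X2. norm x \<le> 2 * R}"
        by (rule finite_subset[OF _ discrete_subgroup_finite[OF X(1)]]) auto
      ultimately show ?thesis unfolding ball_count_def by (intro card_inj_on_le)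
      next
      case True
      show ?thesis unfolding True by simp
    qed
  qed
  then show ?thesis by (simp add: ball_count_def card_cartesian_product)
qed

lemma discrete_subgroup_Int: "discrete_subgroup X \<Longrightarrow> discrete_subgroup Y \<Longrightarrow> discrete_subgroup (X \<inter> Y)"
  unfolding discrete_subgroup_def by (auto intro: finite_subset[of _ "{x \<in> X. norm x \<le> _}"])

text \<open>Both sides of \<open>ball_count_sum_Int\<close> grow like powers of R: comparing degrees
  gives the ranks, comparing leading coefficients the inequality. The rank formula is not mere
  linear algebra, since discrete subgroups may intersect in less than their spans do; positive
  densities and the common discrete group \<open>Y\<close> exclude this.\<close>

lemma density_submodular:
  fixes X1 X2 Y :: "'a::euclidean_space set"
  assumes X: "discrete_subgroup X1" "discrete_subgroup X2" "discrete_subgroup Y"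
    and Y: "X1 \<subseteq> Y" "X2 \<subseteq> Y" "Y \<subseteq> span (X1 \<union> X2)"
    and pos: "0 < density_of X1" "0 < density_of X2"
  shows "dim X1 + dim X2 = dim Y + dim (X1 \<inter> X2)"
    and "density_of X1 * density_of X2
      \<le> (4 * real DIM('a) + 4) ^ (2 * DIM('a)) * (density_of Y * density_of (X1 \<inter> X2))"
proof -
  define c where "c = (2 * real DIM('a) + 2) ^ DIM('a)"
  have c: "c > 0" by (simp add: c_def)
  let ?I = "X1 \<inter> X2"
  let ?t = "density_of X1 * density_of X2"
  define r where "r = dim Y + dim ?I"
  define q where "q = dim X1 + dim X2"
  have I: "discrete_subgroup ?I" by (rule discrete_subgroup_Int[OF X(1,2)])
  \<comment> \<open>The infima need not be attained, hence the slack e; it is sent to 0 once the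
    degrees are known to agree.\<close>
  have key: "\<exists>R0>0. \<forall>R\<ge>R0. ?t * R ^ q
      \<le> c\<^sup>2 * ((density_of Y + e) * (density_of ?I + e)) * (2 * R) ^ r" if e: "0 < e" for e
  proof -
    obtain R1 where R1: "0 < R1" "\<And>R. R1 \<le> R \<Longrightarrow> real (ball_count Y R) \<le> c * (density_of Y + e) * R ^ dim Y"
      using ball_count_eventually_le[OF X(3) e] unfolding c_def by metis
    obtain R2 where R2: "0 < R2" "\<And>R. R2 \<le> R \<Longrightarrow>
      real (ball_count ?I R) \<le> c * (density_of ?I + e) * R ^ dim ?I"
      using ball_count_eventually_le[OF I e] unfolding c_def by metis
    show ?thesis
    proof (intro exI[of _ "max R1 R2"] conjI allI impI)
      show "max R1 R2 > 0" using R1 by simp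
      fix R assume R: "max R1 R2 \<le> R"
      then have R0: "R > 0" "R1 \<le> 2 * R" "R2 \<le> 2 * R" using R1 R2 by auto
      have "density_of X1 \<le> real (ball_count X1 R) / R ^ dim X1"
           "density_of X2 \<le> real (ball_count X2 R) / R ^ dim X2" using R0 by (auto intro: density_le)
      then have "density_of X1 * R ^ dim X1 \<le> real (ball_count X1 R)"
           "density_of X2 * R ^ dim X2 \<le> real (ball_count X2 R)" using R0 by (auto simp: field_simps)
      then have "(density_of X1 * R ^ dim X1) * (density_of X2 * R ^ dim X2)
          \<le> real (ball_count X1 R) * real (ball_count X2 R)"
        using R0 by (intro mult_mono mult_nonneg_nonneg density_nonneg) auto
      also have "\<dots> \<le> real (ball_count Y (2 * R)) * real (ball_count ?I (2 * R))"
        using ball_count_sum_Int[OF X Y(1,2), of R] by (simp only: of_nat_mult[symmetric] of_nat_le_iff)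
      also have "\<dots> \<le> (c * (density_of Y + e) * (2*R) ^ dim Y) * (c * (density_of ?I + e) * (2*R) ^ dim ?I)"
        using R0 e c density_nonneg[of Y] by (intro mult_mono R1(2) R2(2)) auto
      finally show "?t * R ^ q \<le> c\<^sup>2 * ((density_of Y + e) * (density_of ?I + e)) * (2 * R) ^ r"
        by (simp add: q_def r_def power_add power2_eq_square mult_ac)
    qed
  qed
  have t: "?t > 0" using pos by simp
  \<comment> \<open>With a larger degree on the left the estimate \<open>key\<close> would fail for
    large R, because \<open>?t\<close> is positive.\<close>
  have "q \<le> r"
  proof (rule ccontr)
    assume "\<not> q \<le> r"
    then obtain k where k: "q = Suc (r + k)" using less_imp_Suc_add[of r q] by auto
    obtain R0 where R0: "R0 > 0" "\<And>R. R \<ge> R0 \<Longrightarrow> ?t * R ^ q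
      \<le> c\<^sup>2 * ((density_of Y + 1) * (density_of ?I + 1)) * (2 * R) ^ r" using key[of 1] by auto
    define C where "C = c\<^sup>2 * ((density_of Y + 1) * (density_of ?I + 1)) * 2 ^ r"
    define R where "R = max (max R0 1) (C / ?t + 1)"
    have R: "R \<ge> R0" "R \<ge> 1" "R > C / ?t" by (auto simp: R_def)
    have "?t * R ^ q \<le> C * R ^ r" using R0(2)[OF R(1)] by (simp add: C_def power_mult_distrib mult_ac)
    then have "?t * R ^ Suc k * R ^ r \<le> C * R ^ r" by (simp add: k power_add mult_ac)
    then have "?t * R ^ Suc k \<le> C" using R by (simp add: mult_le_cancel_right)
    moreover have "R \<le> R ^ Suc k" using R(2) self_le_power[of R "Suc k"] by simp
    then have "?t * R \<le> ?t * R ^ Suc k" using t by (intro mult_left_mono) auto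
    moreover have "C < ?t * R" using R(3) t by (simp add: field_simps)
    ultimately show False by linarith
  qed
  \<comment> \<open>This direction is linear algebra for the spans, whose intersection contains that
    of the subgroups.\<close>
  moreover have "r \<le> q"
  proof -
    have "dim Y \<le> dim (span (X1 \<union> X2))" using Y(3) dim_subset by blast
    also have "span (X1 \<union> X2) = {x + y |x y. x \<in> span X1 \<and> y \<in> span X2}"
      by (auto simp: span_Un)
    finally have "dim Y + dim (span X1 \<inter> span X2) \<le> dim (span X1) + dim (span X2)"
      using dim_sums_Int[OF subspace_span[of X1] subspace_span[of X2]] by simp
    moreover have "dim ?I \<le> dim (span X1 \<inter> span X2)"
      by (intro dim_subset) (auto intro: span_base)
    ultimately show ?thesis by (simp add: q_def r_def)
  qed
  ultimately have qr: "q = r" by simp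
  then show "dim X1 + dim X2 = dim Y + dim ?I" by (simp add: q_def r_def)
  have e: "?t \<le> c\<^sup>2 * 2 ^ r * ((density_of Y + e) * (density_of ?I + e))" if "0 < e" for e
  proof -
    obtain R where "R > 0" "?t * R ^ q
      \<le> c\<^sup>2 * ((density_of Y + e) * (density_of ?I + e)) * (2 * R) ^ r" using key[OF \<open>0 < e\<close>] by blast
    then show ?thesis by (simp add: qr power_mult_distrib mult_ac)
  qed
  have "((\<lambda>e. c\<^sup>2 * 2 ^ r * ((density_of Y + e) * (density_of ?I + e))) \<longlongrightarrow>
      c\<^sup>2 * 2 ^ r * ((density_of Y + 0) * (density_of ?I + 0))) (at_right 0)"
    by (intro tendsto_intros)
  then have "?t \<le> c\<^sup>2 * 2 ^ r * ((density_of Y + 0) * (density_of ?I + 0))"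
    by (rule tendsto_lowerbound) (auto simp: eventually_at_filter intro!: e always_eventually)
  also have "\<dots> \<le> c\<^sup>2 * 2 ^ (2 * DIM('a)) * (density_of Y * density_of ?I)"
  proof -
    have "r \<le> 2 * DIM('a)" unfolding r_def using dim_subset_UNIV[of Y] dim_subset_UNIV[of ?I] by linarith
    then have "c\<^sup>2 * 2 ^ r \<le> c\<^sup>2 * 2 ^ (2 * DIM('a))" by (intro mult_left_mono power_increasing) auto
    then show ?thesis unfolding add_0_right by (rule mult_right_mono) (simp add: density_nonneg)
  qed
  also have "c\<^sup>2 * 2 ^ (2 * DIM('a)) = (4 * real DIM('a) + 4) ^ (2 * DIM('a))"
  proof -
    have "c\<^sup>2 = (2 * real DIM('a) + 2) ^ (2 * DIM('a))"
      unfolding c_def power_mult[symmetric] by (simp only: mult.commute)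
    moreover have "4 * real DIM('a) + 4 = (2 * real DIM('a) + 2) * 2" by simp
    ultimately show ?thesis by (simp only: power_mult_distrib)
  qed
  finally show "?t \<le> (4 * real DIM('a) + 4) ^ (2 * DIM('a)) * (density_of Y * density_of ?I)" .
qed

section \<open>Densities under linear maps\<close>

lemma discrete_subgroup_linear_image:
  fixes f :: "'a::euclidean_space \<Rightarrow> 'a"
  assumes X: "discrete_subgroup X" and f: "linear f" and c: "\<And>x. x \<in> X \<Longrightarrow> norm x \<le> c * norm (f x)" "0 < c"
  shows "discrete_subgroup (f ` X)"
    and "ball_count (f ` X) R \<le> card {x \<in> X. norm (f x) \<le> R}"
proof -
  have fin: "finite {x \<in> X. norm (f x) \<le> R}" for R
  proof (rule finite_subset[OF _ discrete_subgroup_finite[OF X, of "c * R"]], safe)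
    fix x assume "x \<in> X" "norm (f x) \<le> R"
    then have "c * norm (f x) \<le> c * R" using c(2) by simp
    then show "norm x \<le> c * R" using c(1)[OF \<open>x \<in> X\<close>] by linarith
  qed
  have eq: "{y \<in> f ` X. norm y \<le> R} = f ` {x \<in> X. norm (f x) \<le> R}" for R by auto
  show "ball_count (f ` X) R \<le> card {x \<in> X. norm (f x) \<le> R}"
    unfolding ball_count_def eq by (rule card_image_le[OF fin])
  show "discrete_subgroup (f ` X)"
    unfolding discrete_subgroup_def eq
  proof (intro conjI ballI allI)
    show "0 \<in> f ` X" using X linear_0[OF f] unfolding discrete_subgroup_def by force
    fix x y assume "x \<in> f ` X" "y \<in> f ` X"
    then obtain a b where "x = f a" "y = f b" "a \<in> X" "b \<in> X" by auto
    moreover have "a - b \<in> X" using X \<open>a \<in> X\<close> \<open>b \<in> X\<close> unfolding discrete_subgroup_def by blast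
    ultimately show "x - y \<in> f ` X" using linear_diff[OF f, of a b] by (auto intro: rev_image_eqI)
  next
    fix R show "finite (f ` {x \<in> X. norm (f x) \<le> R})" using fin by simp
  qed
qed

text \<open>A linear map that shrinks norms at most by the factor c brings no point into the ball of
  radius R from outside the ball of radius c R. This crude bound serves both for the flow and for
  the change of base point.\<close>

lemma density_linear_le:
  fixes f :: "'a::euclidean_space \<Rightarrow> 'a"
  assumes X: "discrete_subgroup X" and f: "linear f" and c: "\<And>x. norm x \<le> c * norm (f x)" "0 < c"
  shows "density_of (f ` X) \<le> c ^ dim X * density_of X" and "dim (f ` X) = dim X"
proof -
  have inj: "inj f"
  proof (rule injI)
    fix x y assume "f x = f y"
    then have "f (x - y) = 0" using linear_diff[OF f] by simp
    then show "x = y" using c(1)[of "x - y"] by simp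
  qed
  show dim: "dim (f ` X) = dim X" by (rule dim_image_eq[OF f]) (use inj in \<open>auto simp: inj_on_def\<close>)
  show "density_of (f ` X) \<le> c ^ dim X * density_of X"
  proof (rule density_cancel[where l = "1 / c"])
    fix R :: real assume R: "0 < R"
    have "ball_count (f ` X) R \<le> card {x \<in> X. norm (f x) \<le> R}"
      by (rule discrete_subgroup_linear_image(2)[OF X f c])
    also have "\<dots> \<le> ball_count X (R / (1 / c))" unfolding ball_count_def
    proof (intro card_mono discrete_subgroup_finite[OF X], safe)
      fix x assume "norm (f x) \<le> R"
      then have "c * norm (f x) \<le> c * R" using c(2) by simp
      then show "norm x \<le> R / (1 / c)" using c(1)[of x] by (simp add: mult.commute)
    qed
    finally have "real (ball_count (f ` X) R) / R ^ dim X \<le> real (ball_count X (R / (1 / c))) / R ^ dim X"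
      using R by (intro divide_right_mono) auto
    moreover have "density_of (f ` X) \<le> real (ball_count (f ` X) R) / R ^ dim X"
      using density_le[OF R, of "f ` X"] by (simp add: dim)
    ultimately show "density_of (f ` X) \<le> real (ball_count X (R / (1 / c))) / (R / (1 / c)) ^ dim X
        * c ^ dim X"
      using c(2) by (simp add: power_mult_distrib)
  qed (use c in auto)
qed

section \<open>Rational subspaces under the diagonal flow\<close>

text \<open>On \<open>span X\<close> the first coordinate is \<open>norm u0\<close> times the
  coordinate along the unit vector \<open>u\<close>, where \<open>u0\<close> is the projection of
  (1, 0); the vector \<open>v\<close> certifies that \<open>norm u0\<close> is at least m. A point
  whose image has norm at most R thus lies in a box of width R / (\<kappa>1 m) along
  \<open>u\<close> and of width R / \<kappa>2 in the other \<open>dim X - 1\<close> directions.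
  Counting this box against the ball of radius R / \<kappa>1 gives the factor.\<close>

lemma density_expand:
  fixes X :: "(real \<times> 'b::euclidean_space) set"
  assumes X: "discrete_subgroup X" and l: "0 < \<kappa>2" "\<kappa>2 \<le> \<kappa>1"
    and v: "v \<in> span X" "v \<noteq> 0" "m * norm v \<le> \<bar>fst v\<bar>" "0 < m"
  shows "density_of ((\<lambda>(p, q). (\<kappa>1 * p, \<kappa>2 *\<^sub>R q)) ` X)
    \<le> (2 * real DIM(real \<times> 'b) + 2) ^ DIM(real \<times> 'b) * (\<kappa>1 / \<kappa>2) ^ (dim X - 1) / (m * \<kappa>1 ^ dim X)
        * density_of X"
    (is "density_of (?A ` X) \<le> _")
proof -
  let ?D = "real DIM(real \<times> 'b)"
  define e0 :: "real \<times> 'b" where "e0 = (1, 0)"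
  have e0: "fst x = e0 \<bullet> x" for x :: "real \<times> 'b" by (cases x) (simp add: e0_def)
  obtain u0 z where u0: "u0 \<in> span X" "\<And>w. w \<in> span X \<Longrightarrow> orthogonal z w" "e0 = u0 + z"
    using orthogonal_subspace_decomp_exists[of X e0] by metis
  have fst_u0: "fst x = u0 \<bullet> x" if "x \<in> span X" for x
    using u0(2)[OF that] e0[of x] u0(3) by (simp add: inner_add_left orthogonal_def)
  have "m * norm v \<le> norm u0 * norm v"
    using v(3) fst_u0[OF v(1)] Cauchy_Schwarz_ineq2[of u0 v] by linarith
  then have mu: "m \<le> norm u0" using v(2) by simp
  then have u0n: "norm u0 > 0" using v(4) by linarith
  define u where "u = u0 /\<^sub>R norm u0"
  have u: "norm u = 1" "u \<in> span X" using u0n u0(1) by (auto simp: u_def span_scale)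
  have fst_u: "fst x = norm u0 * (x \<bullet> u)" if "x \<in> span X" for x
    using fst_u0[OF that] u0n by (simp add: u_def inner_commute)
  define S1 where "S1 = {x \<in> span X. x \<bullet> u = 0}"
  have "subspace S1" unfolding S1_def subspace_def
    by (auto simp: span_0 span_add span_scale inner_add_left)
  then obtain B1 where B1: "B1 \<subseteq> S1" "pairwise orthogonal B1" "\<And>x. x \<in> B1 \<Longrightarrow> norm x = 1"
     "independent B1" "span B1 = S1"
    using orthonormal_basis_subspace[of S1] by metis
  define B where "B = insert u B1"
  have uB1: "u \<notin> B1" using B1(1) u(1) by (auto simp: S1_def norm_eq_1)
  have Bo: "pairwise orthogonal B"
    unfolding B_def pairwise_insert using B1(1,2)
    by (auto simp: S1_def orthogonal_def inner_commute)
  have Bn: "\<And>b. b \<in> B \<Longrightarrow> norm b = 1" using B1(3) u(1) by (auto simp: B_def)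
  have Bi: "independent B" using Bo Bn[of 0] by (intro pairwise_orthogonal_independent) auto
  have BX: "B \<subseteq> span X" using B1(1) u(2) by (auto simp: B_def S1_def)
  have XB: "span X \<subseteq> span B"
  proof
    fix x assume x: "x \<in> span X"
    have "x - (x \<bullet> u) *\<^sub>R u \<in> S1"
      unfolding S1_def using x u by (auto simp: span_diff span_scale inner_diff_left norm_eq_1)
    then have "x - (x \<bullet> u) *\<^sub>R u \<in> span B" using B1(5) span_mono[of B1 B] by (auto simp: B_def)
    moreover have "(x \<bullet> u) *\<^sub>R u \<in> span B" by (auto simp: B_def intro: span_scale span_base)
    ultimately have "(x - (x \<bullet> u) *\<^sub>R u) + (x \<bullet> u) *\<^sub>R u \<in> span B" by (rule span_add)
    then show "x \<in> span B" by simp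
  qed
  have finB1: "finite B1" using B1(4) independent_bound by blast
  have "card B = dim X" using basis_card_eq_dim[OF BX XB Bi] by simp
  then have "dim X = Suc (card B1)" using uB1 finB1 by (simp add: B_def)
  then have cB1: "card B1 = dim X - 1" and dX: "dim X \<noteq> 0" by linarith+
  have l1: "\<kappa>1 > 0" using l by simp
  have An: "\<kappa>2 * norm x \<le> norm (?A x)" for x
  proof -
    have "(\<kappa>2 * norm x)\<^sup>2 = (\<kappa>2 * \<bar>fst x\<bar>)\<^sup>2 + (\<kappa>2 * norm (snd x))\<^sup>2"
      by (simp add: norm_prod_def power_mult_distrib algebra_simps)
    also have "\<dots> \<le> (\<kappa>1 * \<bar>fst x\<bar>)\<^sup>2 + (\<kappa>2 * norm (snd x))\<^sup>2"
      using l by (intro add_right_mono power_mono mult_right_mono) auto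
    also have "\<dots> = (norm (?A x))\<^sup>2" using l by (cases x) (simp add: norm_prod_def power_mult_distrib)
    finally show ?thesis by (rule power2_le_imp_le) simp
  qed
  have lin: "linear ?A"
    by (rule linearI) (auto simp: algebra_simps split: prod.splits)
  have An': "norm x \<le> 1 / \<kappa>2 * norm (?A x)" for x
    using An[of x] l by (simp add: field_simps)
  have k2: "0 < 1 / \<kappa>2" using l by simp
  have dimA: "dim (?A ` X) = dim X"
    by (rule density_linear_le(2)[OF X lin An' k2])
  define C where "C = (2 * ?D + 2) ^ DIM(real \<times> 'b) * (\<kappa>1 / \<kappa>2) ^ (dim X - 1) / (m * \<kappa>1 ^ dim X)"
  have Cpos: "C > 0" unfolding C_def using l l1 v(4)
    by (intro divide_pos_pos mult_pos_pos zero_less_power) auto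
  \<comment> \<open>Lets the additive 2 of \<open>box_count\<close> be absorbed into a multiple of 1
    / m.\<close>
  have m1: "m \<le> 1"
  proof -
    have "\<bar>fst v\<bar> \<le> norm v" using norm_fst_le[of "fst v" "snd v"] by simp
    then have "m * norm v \<le> 1 * norm v" using v(3) by linarith
    then show ?thesis using v(2) by (simp add: mult_le_cancel_right)
  qed
  have "density_of (?A ` X) \<le> C * density_of X"
  proof (rule density_cancel[OF _ l1 Cpos])
    fix R :: real assume R: "0 < R"
    define w where "w b = (if b = u then R / (\<kappa>1 * m) else R / \<kappa>2)" for b
    have w0: "0 \<le> w b" for b using R l l1 v(4) by (auto simp: w_def)
    have R1: "R / \<kappa>1 > 0" using R l1 by simp
    have XB': "X \<subseteq> span B" using XB span_superset by blast
    let ?F = "{x \<in> X. \<forall>b\<in>B. \<bar>x \<bullet> b\<bar> \<le> w b}"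
    have "ball_count (?A ` X) R \<le> card {x \<in> X. norm (?A x) \<le> R}"
      by (rule discrete_subgroup_linear_image(2)[OF X lin An' k2])
    also have "\<dots> \<le> card ?F"
    proof (rule card_mono)
      show "finite ?F" using box_count(1)[OF X Bo Bn XB' R1, of w] w0 by blast
      show "{x \<in> X. norm (?A x) \<le> R} \<subseteq> ?F"
      proof (intro subsetI CollectI conjI ballI)
        fix x assume x: "x \<in> {x \<in> X. norm (?A x) \<le> R}"
        then show "x \<in> X" by simp
        then have xs: "x \<in> span X" by (rule span_base)
        fix b assume b: "b \<in> B"
        show "\<bar>x \<bullet> b\<bar> \<le> w b"
        proof (cases "b = u")
          case True
          have "\<kappa>1 * \<bar>fst x\<bar> = \<bar>fst (?A x)\<bar>" using l1 by (cases x) (simp add: abs_mult)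
          also have "\<dots> \<le> norm (?A x)" using norm_fst_le[of "fst (?A x)" "snd (?A x)"] by simp
          finally have "\<kappa>1 * \<bar>fst x\<bar> \<le> R" using x by simp
          then have "\<kappa>1 * (norm u0 * \<bar>x \<bullet> u\<bar>) \<le> R" using fst_u[OF xs] by (simp add: abs_mult)
          moreover have "\<kappa>1 * (m * \<bar>x \<bullet> u\<bar>) \<le> \<kappa>1 * (norm u0 * \<bar>x \<bullet> u\<bar>)"
            using mu l1 by (intro mult_left_mono mult_right_mono) auto
          ultimately have "\<kappa>1 * (m * \<bar>x \<bullet> u\<bar>) \<le> R" by (rule order_trans[rotated])
          then show ?thesis using True l1 v(4) by (simp add: w_def field_simps)
        next
          case False
          have "\<bar>x \<bullet> b\<bar> \<le> norm x" using Cauchy_Schwarz_ineq2[of x b] Bn[OF b] by simp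
          also have "\<dots> \<le> R / \<kappa>2" using An[of x] x l by (auto simp: field_simps)
          finally show ?thesis using False by (simp add: w_def)
        qed
      qed
    qed
    finally have "real (ball_count (?A ` X) R) \<le> real (card ?F)" by simp
    also have "\<dots> \<le> (\<Prod>b\<in>B. 2 * ?D * w b / (R / \<kappa>1) + 2) * real (ball_count X (R / \<kappa>1))"
      using box_count(2)[OF X Bo Bn XB' R1, of w] w0 by blast
    also have "(\<Prod>b\<in>B. 2 * ?D * w b / (R / \<kappa>1) + 2)
        = (2 * ?D * w u / (R / \<kappa>1) + 2) * (\<Prod>b\<in>B1. 2 * ?D * w b / (R / \<kappa>1) + 2)"
      unfolding B_def using uB1 finB1 by simp
    also have "(\<Prod>b\<in>B1. 2 * ?D * w b / (R / \<kappa>1) + 2) = (\<Prod>b\<in>B1. 2 * ?D * (\<kappa>1 / \<kappa>2) + 2)"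
      using uB1 R l l1 by (intro prod.cong) (auto simp: w_def)
    also have "\<dots> = (2 * ?D * (\<kappa>1 / \<kappa>2) + 2) ^ (dim X - 1)" by (simp add: cB1)
    also have "2 * ?D * w u / (R / \<kappa>1) + 2 = 2 * ?D / m + 2" using R l1 by (simp add: w_def)
    also have "(2 * ?D / m + 2) * (2 * ?D * (\<kappa>1 / \<kappa>2) + 2) ^ (dim X - 1)
       \<le> ((2 * ?D + 2) / m) * ((2 * ?D + 2) * (\<kappa>1 / \<kappa>2)) ^ (dim X - 1)"
    proof (intro mult_mono power_mono)
      have "2 \<le> 2 / m" using m1 v(4) by (simp add: field_simps)
      then show "2 * ?D / m + 2 \<le> (2 * ?D + 2) / m" by (simp add: add_divide_distrib)
      have "1 \<le> \<kappa>1 / \<kappa>2" using l by (simp add: field_simps)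
      then show "2 * ?D * (\<kappa>1 / \<kappa>2) + 2 \<le> (2 * ?D + 2) * (\<kappa>1 / \<kappa>2)"
        unfolding distrib_right by (intro add_mono) auto
    qed (use v(4) l l1 in auto)
    also have "\<dots> = (2 * ?D + 2) ^ dim X * (\<kappa>1 / \<kappa>2) ^ (dim X - 1) / m"
      unfolding power_mult_distrib using power_eq_if[of "2 * ?D + 2" "dim X"] dX by simp
    also have "\<dots> \<le> (2 * ?D + 2) ^ DIM(real \<times> 'b) * (\<kappa>1 / \<kappa>2) ^ (dim X - 1) / m"
      using l l1 v(4) by (intro divide_right_mono mult_right_mono power_increasing dim_subset_UNIV) auto
    also have "\<dots> = C * \<kappa>1 ^ dim X" unfolding C_def using l1 by simp
    finally have "real (ball_count (?A ` X) R) \<le> C * \<kappa>1 ^ dim X * real (ball_count X (R / \<kappa>1))"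
      by (simp add: mult_right_mono)
    then have "real (ball_count (?A ` X) R) / R ^ dim X
        \<le> C * \<kappa>1 ^ dim X * real (ball_count X (R / \<kappa>1)) / R ^ dim X"
      using R by (intro divide_right_mono) auto
    also have "\<dots> = real (ball_count X (R / \<kappa>1)) / (R / \<kappa>1) ^ dim X * C"
      using l1 by (simp add: power_divide)
    finally show "density_of (?A ` X) \<le> real (ball_count X (R / \<kappa>1)) / (R / \<kappa>1) ^ dim X * C"
      using density_le[OF R, of "?A ` X"] by (simp add: dimA)
  qed
  then show ?thesis by (simp add: C_def)
qed

section \<open>The integer lattice, rational subspaces and the Dani flow\<close>

definition integer_points :: "(real \<times> (real ^ 'n)) set" where
  "integer_points = {(of_int p, of_int_vec q) | p q. True}"

text \<open>
  The parameter \<open>y = e\<^bsup>t(d+1)/d\<^esup>\<close> is the expansion rate in the variable \<open>x\<close>: at parameter \<open>y\<close> the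
  lattices of two points at distance \<open>1 / y\<close> are comparable.
\<close>

definition flow :: "real \<Rightarrow> real ^ 'n \<Rightarrow> real \<times> (real ^ 'n) \<Rightarrow> real \<times> (real ^ 'n)" where
  "flow y x = (\<lambda>(p, q). (y powr (real CARD('n) / (real CARD('n) + 1)) * (p
      + q \<bullet> x), y powr (- 1 / (real CARD('n) + 1)) *\<^sub>R q))"

definition rational_subspace :: "(real \<times> (real ^ 'n)) set \<Rightarrow> bool" where
  "rational_subspace S \<longleftrightarrow> span (integer_points \<inter> S) = S"

text \<open>Small covolume means large density, so the negative powers of the covolume in the
  overview become positive powers here.\<close>

definition lattice_density :: "real \<Rightarrow> real ^ 'n \<Rightarrow> (real \<times> (real ^ 'n)) set \<Rightarrow> real" where
  "lattice_density y x S = density_of (flow y x ` (integer_points \<inter> S))"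

lemma finite_card_int_box:
  fixes A :: "int set" assumes "finite A"
  shows "finite {q :: int ^ 'n. \<forall>i. q $ i \<in> A}" "card {q :: int ^ 'n. \<forall>i. q $ i \<in> A} \<le> card A ^ CARD('n)"
proof -
  have sub: "{q :: int ^ 'n. \<forall>i. q $ i \<in> A} \<subseteq> vec_lambda ` (\<Pi>\<^sub>E i\<in>(UNIV :: 'n set). A)"
  proof
    fix q :: "int ^ 'n" assume "q \<in> {q. \<forall>i. q $ i \<in> A}"
    then have "vec_nth q \<in> (\<Pi>\<^sub>E i\<in>UNIV. A)" by auto
    then have "vec_lambda (vec_nth q) \<in> vec_lambda ` (\<Pi>\<^sub>E i\<in>(UNIV :: 'n set). A)" by (rule imageI)
    then show "q \<in> vec_lambda ` (\<Pi>\<^sub>E i\<in>(UNIV :: 'n set). A)" by simp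
  qed
  have fin: "finite (\<Pi>\<^sub>E i\<in>(UNIV :: 'n set). A)" using assms by (intro finite_PiE) auto
  show "finite {q :: int ^ 'n. \<forall>i. q $ i \<in> A}" by (rule finite_subset[OF sub]) (use fin in simp)
  have "card {q :: int ^ 'n. \<forall>i. q $ i \<in> A} \<le> card (vec_lambda ` (\<Pi>\<^sub>E i\<in>(UNIV :: 'n set). A))"
    by (rule card_mono[OF _ sub]) (use fin in simp)
  also have "\<dots> \<le> card (\<Pi>\<^sub>E i\<in>(UNIV :: 'n set). A)" by (rule card_image_le[OF fin])
  also have "\<dots> = card A ^ CARD('n)" by (simp add: card_PiE)
  finally show "card {q :: int ^ 'n. \<forall>i. q $ i \<in> A} \<le> card A ^ CARD('n)" .
qed

lemma of_int_vec_simps [simp]: "of_int_vec 0 = 0" "of_int_vec (a - b) = of_int_vec a - of_int_vec b"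
  "of_int_vec a $ i = of_int (a $ i)"
  by (auto simp: of_int_vec_def vec_eq_iff)

lemma of_int_vec_eq_0 [simp]: "of_int_vec q = 0 \<longleftrightarrow> q = 0"
  by (auto simp: of_int_vec_def vec_eq_iff)

lemma discrete_integer_points: "discrete_subgroup (integer_points :: (real \<times> (real ^ 'n)) set)"
  unfolding discrete_subgroup_def
proof (intro conjI ballI allI)
  show "0 \<in> (integer_points :: (real \<times> (real ^ 'n)) set)"
    unfolding integer_points_def by (auto simp: zero_prod_def intro!: exI[of _ 0])
  fix v w :: "real \<times> (real ^ 'n)" assume "v \<in> integer_points" "w \<in> integer_points"
  then obtain p q p' q' where "v = (of_int p, of_int_vec q)" "w = (of_int p', of_int_vec q')"
    by (auto simp: integer_points_def)
  then have "v - w = (of_int (p - p'), of_int_vec (q - q'))" by simp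
  then show "v - w \<in> integer_points" unfolding integer_points_def by blast
next
  fix R :: real
  define A where "A = {- \<lceil>R\<rceil> .. \<lceil>R\<rceil>}"
  have "{v \<in> integer_points. norm v \<le> R}
     \<subseteq> (\<lambda>(p, q). (of_int p, of_int_vec q)) ` (A \<times> {q :: int ^ 'n. \<forall>i. q $ i \<in> A})"
  proof safe
    fix a :: real and b :: "real ^ 'n" assume *: "(a, b) \<in> integer_points" "norm (a, b) \<le> R"
    then obtain p q where pq: "a = of_int p" "b = of_int_vec q" by (auto simp: integer_points_def)
    have "\<bar>a\<bar> \<le> R" using norm_fst_le[of a b] *(2) by simp
    then have "p \<in> A" unfolding A_def pq by simp linarith
    moreover have "q $ i \<in> A" for i
    proof -
      have "\<bar>b $ i\<bar> \<le> R" using norm_snd_le[of b a] component_le_norm_cart[of b i] *(2) by linarith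
      then show ?thesis unfolding A_def pq by simp linarith
    qed
    ultimately show "(a, b) \<in> (\<lambda>(p, q). (of_int p, of_int_vec q)) ` (A \<times> {q :: int ^ 'n. \<forall>i. q $ i \<in> A})"
      using pq by (intro image_eqI[of _ _ "(p, q)"]) auto
  qed
  moreover have "finite (A \<times> {q :: int ^ 'n. \<forall>i. q $ i \<in> A})"
    by (intro finite_cartesian_product finite_card_int_box) (auto simp: A_def)
  ultimately show "finite {v :: real \<times> (real ^ 'n). v \<in> integer_points \<and> norm v \<le> R}"
    by (meson finite_imageI finite_subset)
qed

lemma discrete_integer_subspace:
  "subspace S \<Longrightarrow> discrete_subgroup (integer_points \<inter> S)"
  using discrete_integer_points unfolding discrete_subgroup_def
  by (auto simp: subspace_0 subspace_diff intro: finite_subset[of _ "{x \<in> integer_points. norm x \<le> _}"])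

lemma linear_flow: "linear (flow y x)"
  by (rule linearI) (auto simp: flow_def algebra_simps split: prod.splits)

lemma inj_flow: "0 < y \<Longrightarrow> inj (flow y x)"
  unfolding linear_injective_0[OF linear_flow] by (auto simp: flow_def zero_prod_def)

lemma flow_bounded_below:
  assumes "0 < y" obtains c where "0 < c" "\<And>v. norm v \<le> c * norm (flow y x v)"
proof -
  obtain B where "B > 0" "\<And>v. B * norm v \<le> norm (flow y x v)"
    using linear_inj_bounded_below_pos[OF linear_flow inj_flow[OF assms]] by metis
  then show ?thesis by (intro that[of "1 / B"]) (auto simp: field_simps)
qed

lemma discrete_flow:
  assumes "0 < y" "discrete_subgroup X" shows "discrete_subgroup (flow y x ` X)"
  using flow_bounded_below[OF assms(1)] discrete_subgroup_linear_image(1)[OF assms(2) linear_flow] by metis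

lemma dim_flow [simp]: "0 < y \<Longrightarrow> dim (flow y x ` X) = dim X"
  by (rule dim_image_eq[OF linear_flow inj_on_subset[OF inj_flow subset_UNIV]])

lemma rational_subspace_subspace: "rational_subspace S \<Longrightarrow> subspace S"
  unfolding rational_subspace_def using subspace_span by metis

lemma rational_subspace_dim: "rational_subspace S \<Longrightarrow> dim (integer_points \<inter> S) = dim S"
  unfolding rational_subspace_def using dim_span by metis

lemma flow_mult: "0 < y \<Longrightarrow> 0 < b \<Longrightarrow> flow (y * b) (x :: real ^ 'n) v
   = (\<lambda>(p, q). (b powr (real CARD('n) / (real CARD('n) + 1)) * p, b powr (- 1 / (real CARD('n)
       + 1)) *\<^sub>R q)) (flow y x v)"
  by (cases v) (simp add: flow_def powr_mult mult_ac)

text \<open>The two diagonal entries of the flow have quotient \<open>y\<close>, so that after the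
  flow a change of base point is a shear by the vector \<open>y *\<^sub>R (x' - x)\<close>.\<close>

lemma flow_move:
  assumes "0 < y"
  shows "flow y (x' :: real ^ 'n) v = (\<lambda>(p, q). (p + y * (q \<bullet> (x' - x)), q)) (flow y x v)"
proof -
  have "y powr (real CARD('n) / (real CARD('n) + 1)) = y * y powr (- 1 / (real CARD('n) + 1))"
  proof -
    have "real CARD('n) / (real CARD('n) + 1) = 1 + (- 1) / (real CARD('n) + 1)" by (simp add: field_simps)
    then have "y powr (real CARD('n) / (real CARD('n) + 1)) = y powr (1 + (- 1) / (real CARD('n) + 1))"
      by (simp only:)
    also have "\<dots> = y powr 1 * y powr (- 1 / (real CARD('n) + 1))" by (rule powr_add)
    finally show ?thesis using assms by simp
  qed
  then show ?thesis by (cases v) (simp add: flow_def algebra_simps inner_diff_right)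
qed

text \<open>The flow shortens a vector by at most b powr (1 / (d + 1)), its contraction of the
  second component. This growth bound holds at every point and is the fallback wherever expansion
  cannot be guaranteed.\<close>

lemma lattice_density_step:
  fixes x :: "real ^ 'n"
  assumes y: "0 < y" and b: "1 \<le> b" and S: "rational_subspace S"
  shows "lattice_density (y * b) x S \<le> b powr (dim S / (real CARD('n) + 1)) * lattice_density y x S"
proof -
  let ?d = "real CARD('n)"
  let ?A = "(\<lambda>(p, q). (b powr (?d / (?d + 1)) * p, b powr (- 1 / (?d + 1)) *\<^sub>R q)) :: real \<times> (real ^ 'n) \<Rightarrow> _"
  let ?X = "flow y x ` (integer_points \<inter> S)"
  let ?c = "b powr (1 / (?d + 1))"
  have c: "?c > 0" using b by simp
  have X: "discrete_subgroup ?X"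
    by (intro discrete_flow y discrete_integer_subspace rational_subspace_subspace S)
  have lin: "linear ?A" by (rule linearI) (auto simp: algebra_simps split: prod.splits)
  have An: "norm v \<le> ?c * norm (?A v)" for v
  proof -
    have "norm v \<le> norm (?c *\<^sub>R ?A v)"
    proof -
      have "\<bar>fst v\<bar> \<le> \<bar>?c * (b powr (?d / (?d + 1)) * fst v)\<bar>"
      proof -
        have "1 \<le> b powr (1 / (?d + 1) + ?d / (?d + 1))" using b by (intro ge_one_powr_ge_zero) auto
        then have "1 * \<bar>fst v\<bar> \<le> b powr (1 / (?d + 1) + ?d / (?d + 1)) * \<bar>fst v\<bar>"
          by (intro mult_right_mono) auto
        then show ?thesis by (simp add: powr_add abs_mult)
      qed
      moreover have "snd v = ?c *\<^sub>R (b powr (- 1 / (?d + 1)) *\<^sub>R snd v)"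
        using b by (simp add: powr_add[symmetric])
      ultimately show ?thesis
        unfolding norm_prod_def by (cases v) (auto intro!: real_sqrt_le_mono add_mono
            abs_le_square_iff[THEN iffD1])
    qed
    then show ?thesis using b by simp
  qed
  have "flow (y * b) x ` (integer_points \<inter> S) = ?A ` ?X"
    unfolding image_image by (rule image_cong[OF refl], rule flow_mult) (use y b in auto)
  then have "lattice_density (y * b) x S \<le> ?c ^ dim ?X * lattice_density y x S"
    unfolding lattice_density_def using density_linear_le(1)[OF X lin An c] by simp
  also have "?c ^ dim ?X = b powr (dim S / (?d + 1))"
    using b y by (simp add: rational_subspace_dim[OF S] powr_realpow[symmetric] powr_powr)
  finally show ?thesis .
qed

text \<open>The shear of \<open>flow_move\<close> shrinks norms by at most 1 + y * dist x x', a
  constant for points at distance of order 1 / y.\<close>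

lemma lattice_density_move:
  fixes x x' :: "real ^ 'n"
  assumes y: "0 < y" and S: "rational_subspace S"
  shows "lattice_density y x' S \<le> (1 + y * dist x x') ^ (CARD('n) + 1) * lattice_density y x S"
proof -
  let ?A = "(\<lambda>(p, q). (p + y * (q \<bullet> (x' - x)), q)) :: real \<times> (real ^ 'n) \<Rightarrow> _"
  let ?X = "flow y x ` (integer_points \<inter> S)"
  let ?c = "1 + y * dist x x'"
  have c: "?c > 0" "?c \<ge> 1" using y by (auto simp: add_pos_nonneg)
  have X: "discrete_subgroup ?X"
    by (intro discrete_flow y discrete_integer_subspace rational_subspace_subspace S)
  have lin: "linear ?A" by (rule linearI) (auto simp: algebra_simps inner_add_left split: prod.splits)
  have An: "norm v \<le> ?c * norm (?A v)" for v
  proof -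
    have eq: "v = ?A v - (y * (snd v \<bullet> (x' - x)), 0)" by (cases v) simp
    have "norm v \<le> norm (?A v) + norm (y * (snd v \<bullet> (x' - x)), 0 :: real ^ 'n)"
      by (subst eq) (rule norm_triangle_ineq4)
    also have "norm (y * (snd v \<bullet> (x' - x)), 0 :: real ^ 'n) \<le> y * dist x x' * norm (?A v)"
    proof -
      have "\<bar>snd v \<bullet> (x' - x)\<bar> \<le> norm (snd v) * dist x x'"
        using Cauchy_Schwarz_ineq2[of "snd v" "x' - x"] by (simp add: dist_norm norm_minus_commute)
      also have "norm (snd v) \<le> norm (?A v)" by (cases v) (simp add: norm_snd_le)
      finally have "\<bar>snd v \<bullet> (x' - x)\<bar> \<le> norm (?A v) * dist x x'" by (simp add: mult_right_mono)
      then have "y * \<bar>snd v \<bullet> (x' - x)\<bar> \<le> y * (norm (?A v) * dist x x')" using y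
        by (intro mult_left_mono) auto
      then show ?thesis using y by (simp add: norm_prod_def abs_mult mult_ac)
    qed
    finally show ?thesis by (simp add: algebra_simps)
  qed
  have "flow y x' ` (integer_points \<inter> S) = ?A ` ?X"
    unfolding image_image by (rule image_cong[OF refl]) (rule flow_move[OF y])
  then have "lattice_density y x' S \<le> ?c ^ dim ?X * lattice_density y x S"
    unfolding lattice_density_def using density_linear_le(1)[OF X lin An c(1)] by simp
  also have "?c ^ dim ?X \<le> ?c ^ (CARD('n) + 1)"
    using dim_subset_UNIV[of ?X] c by (intro power_increasing) auto
  finally show ?thesis by (simp add: mult_right_mono density_nonneg lattice_density_def)
qed

lemma lattice_density_nonneg: "0 \<le> lattice_density y x S"
  by (simp add: lattice_density_def density_nonneg)

lemma zero_in_integer_points: "0 \<in> integer_points"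
  using discrete_integer_points unfolding discrete_subgroup_def by blast

lemma lattice_density_zero: "lattice_density y x {0} = 1"
proof -
  have "flow y x ` (integer_points \<inter> {0}) = {0}"
    by (simp add: linear_0[OF linear_flow] zero_in_integer_points)
  moreover have cnt: "ball_count {0 :: real \<times> (real ^ 'n)} R = 1" if "0 < R" for R
  proof -
    have "{x \<in> {0}. norm x \<le> R} = {0 :: real \<times> (real ^ 'n)}" using that by auto
    then show ?thesis by (simp add: ball_count_def)
  qed
  moreover have "(INF R\<in>{0<..}. real (ball_count {0 :: real \<times> (real ^ 'n)} R)) = (INF R\<in>{0::real<..}. 1)"
    by (intro INF_cong) (auto simp: cnt)
  ultimately show ?thesis by (simp add: lattice_density_def density_of_def)
qed

lemma integer_points_scale:
  "v \<in> integer_points \<Longrightarrow> real k *\<^sub>R v \<in> integer_points"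
proof (induction k)
  case 0
  then show ?case using zero_in_integer_points by simp
next
  case (Suc k)
  then have "real k *\<^sub>R v + v \<in> integer_points"
    using discrete_subgroup_add[OF discrete_integer_points] by blast
  then show ?case by (simp add: algebra_simps)
qed

lemma rational_subspace_line:
  assumes "v \<in> integer_points" shows "rational_subspace (span {v})"
proof -
  have "{v} \<subseteq> integer_points \<inter> span {v}" using assms by (auto intro: span_base)
  then have "span {v} \<subseteq> span (integer_points \<inter> span {v})" by (rule span_mono)
  moreover have "span (integer_points \<inter> span {v}) \<subseteq> span {v}" by (intro span_minimal) auto
  ultimately show ?thesis by (simp add: rational_subspace_def)
qed

text \<open>The multiples of \<open>v\<close> alone supply enough points in every ball. In rank one
  this turns a short vector into a large density.\<close>

lemma lattice_density_line:
  assumes v: "v \<in> integer_points" "v \<noteq> 0" and y: "0 < y"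
  shows "1 / norm (flow y x v) \<le> lattice_density y x (span {v})"
proof -
  let ?X = "flow y x ` (integer_points \<inter> span {v})"
  have f0: "norm (flow y x v) > 0"
    using v(2) linear_injective_0[OF linear_flow] inj_flow[OF y] zero_less_norm_iff by metis
  have X: "discrete_subgroup ?X" by (intro discrete_flow y discrete_integer_subspace) simp
  have "dim ?X = 1"
    using y rational_subspace_dim[OF rational_subspace_line[OF v(1)]] v(2) by simp
  have "1 / norm (flow y x v) \<le> density_of ?X"
  proof (rule density_greatest)
    fix R :: real assume R: "0 < R"
    \<comment> \<open>The multiple 0 counts as well: there are m + 1 points, which is at least the
      unrounded quotient.\<close>
    define m where "m = nat \<lfloor>R / norm (flow y x v)\<rfloor>"
    have m: "R / norm (flow y x v) \<le> real (m + 1)" "real m \<le> R / norm (flow y x v)"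
      using R f0 unfolding m_def by (auto, linarith+)
    have "(\<lambda>k. real k *\<^sub>R flow y x v) ` {..m} \<subseteq> {w \<in> ?X. norm w \<le> R}"
    proof (intro image_subsetI CollectI conjI)
      fix k assume "k \<in> {..m}"
      then have k: "k \<le> m" by simp
      have "real k *\<^sub>R v \<in> integer_points \<inter> span {v}"
        using integer_points_scale[OF v(1)] by (auto intro: span_scale span_base)
      then show "real k *\<^sub>R flow y x v \<in> ?X" using linear_scale[OF linear_flow, of y x "real k" v]
        by (metis imageI)
      have "real k * norm (flow y x v) \<le> real m * norm (flow y x v)" using k by (intro mult_right_mono) auto
      also have "\<dots> \<le> R" using m(2) f0 by (simp add: field_simps)
      finally show "norm (real k *\<^sub>R flow y x v) \<le> R" by simp
    qed
    moreover have "inj_on (\<lambda>k. real k *\<^sub>R flow y x v) {..m}" using f0 by (auto simp: inj_on_def)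
    ultimately have "card {..m} \<le> ball_count ?X R" unfolding ball_count_def
      using card_inj_on_le discrete_subgroup_finite[OF X] by blast
    then have "R / norm (flow y x v) \<le> real (ball_count ?X R)" using m(1) by simp
    then show "1 / norm (flow y x v) \<le> real (ball_count ?X R) / R ^ dim ?X"
      using R f0 unfolding \<open>dim ?X = 1\<close> by (simp add: field_simps)
  qed
  then show ?thesis by (simp add: lattice_density_def)
qed

text \<open>The bound depends on \<open>y\<close> and \<open>x\<close>, as only finiteness of the
  supremum in the height is at stake. The count at radius 1 works for all ranks at once, since every
  power of 1 is 1.\<close>

lemma lattice_density_bdd:
  fixes x :: "real ^ 'n"
  assumes y: "0 < y"
  obtains N where "1 \<le> N" "\<And>S. rational_subspace S \<Longrightarrow> lattice_density y x S \<le> N"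
proof
  let ?Y = "flow y x ` (integer_points :: (real \<times> (real ^ 'n)) set)"
  have Y: "discrete_subgroup ?Y" by (intro discrete_flow y discrete_integer_points)
  show "1 \<le> 1 + real (ball_count ?Y 1)" by simp
  fix S :: "(real \<times> (real ^ 'n)) set"
  assume "rational_subspace S"
  have "lattice_density y x S \<le> real (ball_count (flow y x ` (integer_points \<inter> S)) 1)"
    unfolding lattice_density_def using density_le[of 1 "flow y x ` (integer_points \<inter> S)"] by simp
  also have "ball_count (flow y x ` (integer_points \<inter> S)) 1 \<le> ball_count ?Y 1"
    unfolding ball_count_def by (rule card_mono[OF discrete_subgroup_finite[OF Y]]) auto
  finally show "lattice_density y x S \<le> 1 + real (ball_count ?Y 1)" by simp
qed

lemma dim_integer_points: "dim (integer_points :: (real \<times> (real ^ 'n)) set) = CARD('n) + 1"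
  and rational_subspace_UNIV: "rational_subspace (UNIV :: (real \<times> (real ^ 'n)) set)"
proof -
  let ?Z = "integer_points :: (real \<times> (real ^ 'n)) set"
  have "Basis \<subseteq> ?Z"
  proof
    fix b :: "real \<times> (real ^ 'n)" assume "b \<in> Basis"
    then consider "b = (1, 0)" | i where "b = (0, axis i 1)"
      by (auto simp: Basis_prod_def Basis_vec_def)
    then show "b \<in> ?Z"
    proof cases
      case 1
      then show ?thesis unfolding integer_points_def by (auto intro!: exI[of _ 1] exI[of _ 0])
    next
      case (2 i)
      have "of_int_vec (axis i 1) = (axis i 1 :: real ^ 'n)"
        by (auto simp: of_int_vec_def vec_eq_iff axis_def)
      then show ?thesis unfolding integer_points_def using 2
        by (auto intro!: exI[of _ "axis i 1 :: int ^ 'n"] exI[of _ "0 :: int"])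
    qed
  qed
  then have s: "span ?Z = UNIV" using span_mono[of Basis ?Z] by auto
  then show "rational_subspace (UNIV :: (real \<times> (real ^ 'n)) set)" by (simp add: rational_subspace_def)
  show "dim ?Z = CARD('n) + 1" using s dim_span[of ?Z] by simp
qed

text \<open>The whole lattice has covolume 1 at all times. The count takes the radius T at which an
  image in the ball forces p + q . x to have absolute value at most 1 and q to have norm at most y:
  at most three values of p for each of at most (3 y)^d vectors q, against T^(d + 1) = y^d.\<close>

lemma lattice_density_UNIV:
  fixes x :: "real ^ 'n"
  assumes y: "1 \<le> y"
  shows "lattice_density y x UNIV \<le> 3 ^ (CARD('n) + 1)"
proof -
  let ?d = "real CARD('n)"
  define T where "T = y powr (?d / (?d + 1))"
  define m where "m = \<lfloor>y\<rfloor>"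
  let ?Y = "flow y x ` (integer_points :: (real \<times> (real ^ 'n)) set)"
  have y0: "y > 0" using y by simp
  have T: "T > 0" using y by (simp add: T_def)
  have Tpow: "T ^ (CARD('n) + 1) = y ^ CARD('n)"
  proof -
    have "T ^ (CARD('n) + 1) = T powr (?d + 1)" using powr_realpow[OF T, of "CARD('n) + 1"]
      by (simp add: add.commute)
    also have "\<dots> = y powr (?d / (?d + 1) * (?d + 1))" unfolding T_def by (rule powr_powr)
    also have "?d / (?d + 1) * (?d + 1) = ?d" by simp
    finally show ?thesis using y0 by (simp add: powr_realpow)
  qed
  have Ty: "T * y powr (1 / (?d + 1)) = y"
    using y unfolding T_def by (simp add: powr_add[symmetric] add_divide_distrib[symmetric])
  define Q where "Q = {q :: int ^ 'n. \<forall>i. q $ i \<in> {-m..m}}"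
  have Q: "finite Q" "card Q \<le> (nat (2 * m + 1)) ^ CARD('n)"
    unfolding Q_def using finite_card_int_box[of "{-m..m}", where 'n = 'n] by auto
  have "{v \<in> ?Y. norm v \<le> T}
     \<subseteq> (\<lambda>(q, j). flow y x (of_int (\<lfloor>- (of_int_vec q \<bullet> x)\<rfloor> + j), of_int_vec q)) ` (Q \<times> {-1..1})"
  proof
    fix v' assume "v' \<in> {v \<in> ?Y. norm v \<le> T}"
    then obtain v where v': "v' = flow y x v" and v: "v \<in> integer_points" "norm (flow y x v) \<le> T"
      by blast
    then obtain p q where pq: "v = (of_int p, of_int_vec q)" by (auto simp: integer_points_def)
    have fl: "flow y x v = (T * (of_int p + of_int_vec q \<bullet> x), y powr (- 1 / (?d + 1)) *\<^sub>R of_int_vec q)"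
      by (simp add: flow_def pq T_def)
    have "norm (T * (of_int p + of_int_vec q \<bullet> x)) \<le> T"
      using v(2) unfolding fl by (metis norm_fst_le order_trans)
    then have "\<bar>of_int p + of_int_vec q \<bullet> x\<bar> \<le> 1" using T by (simp add: abs_mult)
    then have "p - \<lfloor>- (of_int_vec q \<bullet> x)\<rfloor> \<in> {-1..1}" by simp linarith
    moreover have "q \<in> Q"
    proof -
      have "norm (y powr (- 1 / (?d + 1)) *\<^sub>R (of_int_vec q :: real ^ 'n)) \<le> T"
        using v(2) unfolding fl by (metis norm_snd_le order_trans)
      then have "norm (of_int_vec q :: real ^ 'n) / y powr (1 / (?d + 1)) \<le> T"
        by (simp add: powr_minus_divide)
      then have "norm (of_int_vec q :: real ^ 'n) \<le> T * y powr (1 / (?d + 1))"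
        using y0 by (simp add: field_simps)
      then have n: "norm (of_int_vec q :: real ^ 'n) \<le> y" using Ty by simp
      have "q $ i \<in> {-m..m}" for i
      proof -
        have "\<bar>(of_int_vec q :: real ^ 'n) $ i\<bar> \<le> y" using component_le_norm_cart n order_trans by blast
        then show ?thesis unfolding m_def by simp linarith
      qed
      then show ?thesis by (simp add: Q_def)
    qed
    ultimately show "v' \<in> (\<lambda>(q, j). flow y x (of_int (\<lfloor>- (of_int_vec q \<bullet> x)\<rfloor>
        + j), of_int_vec q)) ` (Q \<times> {-1..1})"
      by (intro image_eqI[of _ _ "(q, p - \<lfloor>- (of_int_vec q \<bullet> x)\<rfloor>)"]) (auto simp: pq v')
  qed
  then have "ball_count ?Y T \<le> card ((\<lambda>(q, j). flow y x (of_int (\<lfloor>- (of_int_vec q \<bullet> x)\<rfloor>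
      + j), of_int_vec q)) ` (Q \<times> {-1..1}))"
    unfolding ball_count_def by (intro card_mono finite_imageI finite_cartesian_product Q) auto
  also have "\<dots> \<le> card (Q \<times> {-1..1::int})" using Q by (intro card_image_le) auto
  also have "\<dots> \<le> (nat (2 * m + 1)) ^ CARD('n) * 3" using Q by (simp add: card_cartesian_product)
  finally have "real (ball_count ?Y T) \<le> real ((nat (2 * m + 1)) ^ CARD('n) * 3)" by (rule of_nat_mono)
  also have "\<dots> \<le> (3 * y) ^ CARD('n) * 3"
  proof -
    have "real (nat (2 * m + 1)) \<le> 3 * y" using y unfolding m_def by linarith
    then show ?thesis using power_mono[of "real (nat (2 * m + 1))" "3 * y" "CARD('n)"] by simp
  qed
  also have "\<dots> = 3 ^ (CARD('n) + 1) * T ^ (CARD('n) + 1)"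
    unfolding Tpow by (simp add: power_mult_distrib)
  finally have "real (ball_count ?Y T) / T ^ (CARD('n) + 1) \<le> 3 ^ (CARD('n) + 1)"
    using T by (simp add: field_simps)
  moreover have "density_of ?Y \<le> real (ball_count ?Y T) / T ^ (CARD('n) + 1)"
    using density_le[OF T, of ?Y] y0 by (simp add: dim_integer_points)
  ultimately show ?thesis by (simp add: lattice_density_def)
qed

text \<open>\<open>S3\<close> is the sum, but \<open>S4\<close> is spanned by the common integer
  points, which makes it rational by construction; that it has the full dimension of the
  intersection comes out of the growth argument in \<open>density_submodular\<close>.\<close>

lemma lattice_density_submodular:
  fixes x :: "real ^ 'n"
  assumes y: "0 < y" and S: "rational_subspace S1" "rational_subspace S2"
    and pos: "0 < lattice_density y x S1" "0 < lattice_density y x S2"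
  obtains S3 S4 where "rational_subspace S3" "rational_subspace S4" "S4 \<subseteq> S1 \<inter> S2"
    "dim S1 + dim S2 = dim S3 + dim S4"
    "lattice_density y x S1 * lattice_density y x S2
       \<le> (4 * real CARD('n) + 8) ^ (2 * CARD('n) + 2) * (lattice_density y x S3 * lattice_density y x S4)"
proof -
  define S3 where "S3 = span (S1 \<union> S2)"
  define S4 where "S4 = span (integer_points \<inter> (S1 \<inter> S2))"
  have ss: "subspace S1" "subspace S2" using S rational_subspace_subspace by auto
  have 4: "S4 \<subseteq> S1 \<inter> S2" unfolding S4_def using ss by (intro span_minimal subspace_inter) auto
  have eq4: "integer_points \<inter> S4 = integer_points \<inter> S1 \<inter> (integer_points \<inter> S2)"
    using 4 span_superset[of "integer_points \<inter> (S1 \<inter> S2)"] unfolding S4_def by blast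
  have r4: "rational_subspace S4"
    unfolding rational_subspace_def eq4 by (simp add: S4_def Int_ac)
  have r3: "rational_subspace S3"
    unfolding rational_subspace_def
  proof
    show "span (integer_points \<inter> S3) \<subseteq> S3"
      unfolding S3_def by (metis inf_le2 span_mono span_span)
    have "S1 \<subseteq> span (integer_points \<inter> S3)" "S2 \<subseteq> span (integer_points \<inter> S3)"
      using S span_mono[of "integer_points \<inter> S1" "integer_points \<inter> S3"]
        span_mono[of "integer_points \<inter> S2" "integer_points \<inter> S3"] span_superset[of "S1 \<union> S2"]
      unfolding rational_subspace_def S3_def[symmetric] by blast+
    then show "S3 \<subseteq> span (integer_points \<inter> S3)" unfolding S3_def by (intro span_minimal) auto
  qed
  let ?X = "\<lambda>S. flow y x ` (integer_points \<inter> S)"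
  have d: "discrete_subgroup (?X S1)" "discrete_subgroup (?X S2)" "discrete_subgroup (?X S3)"
    by (intro discrete_flow y discrete_integer_subspace rational_subspace_subspace S r3)+
  have X4: "?X S1 \<inter> ?X S2 = ?X S4"
    unfolding eq4 by (rule image_Int[OF inj_flow[OF y], symmetric])
  have sub: "?X S1 \<subseteq> ?X S3" "?X S2 \<subseteq> ?X S3"
    using span_superset[of "S1 \<union> S2"] unfolding S3_def by auto
  have sp: "?X S3 \<subseteq> span (?X S1 \<union> ?X S2)"
  proof -
    have "integer_points \<inter> S3 \<subseteq> span (integer_points \<inter> S1 \<union> integer_points \<inter> S2)"
    proof -
      have "S1 \<subseteq> span (integer_points \<inter> S1 \<union> integer_points \<inter> S2)"
        using S(1) span_mono[of "integer_points \<inter> S1"] unfolding rational_subspace_def by (metis Un_upper1)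
      moreover have "S2 \<subseteq> span (integer_points \<inter> S1 \<union> integer_points \<inter> S2)"
        using S(2) span_mono[of "integer_points \<inter> S2"] unfolding rational_subspace_def by (metis Un_upper2)
      ultimately have "S3 \<subseteq> span (integer_points \<inter> S1 \<union> integer_points \<inter> S2)"
        unfolding S3_def by (intro span_minimal) auto
      then show ?thesis by blast
    qed
    then have "?X S3 \<subseteq> flow y x ` span (integer_points \<inter> S1 \<union> integer_points \<inter> S2)" by blast
    also have "\<dots> = span (?X S1 \<union> ?X S2)"
      unfolding image_Un[symmetric] by (rule linear_span_image[OF linear_flow, symmetric])
    finally show ?thesis .
  qed
  note sm = density_submodular[OF d sub sp, unfolded X4, folded lattice_density_def, OF pos]
  have dd: "dim S1 + dim S2 = dim S3 + dim S4"
    using sm(1) y by (simp add: rational_subspace_dim S r3 r4)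
  have "4 * real DIM(real \<times> (real ^ 'n)) + 4 = 4 * real CARD('n) + 8"
    "2 * DIM(real \<times> (real ^ 'n)) = 2 * CARD('n) + 2" by simp_all
  then have "lattice_density y x S1 * lattice_density y x S2
       \<le> (4 * real CARD('n) + 8) ^ (2 * CARD('n) + 2) * (lattice_density y x S3 * lattice_density y x S4)"
    using sm(2) by (simp only:)
  then show thesis using that r3 r4 4 dd by blast
qed

lemma affine_subspaces_nonempty:
  assumes "k \<le> DIM('a)" shows "\<exists>A. A \<in> (affine_subspaces k :: 'a::euclidean_space set set)"
proof -
  obtain T where "subspace T" "dim T = k" "T \<subseteq> (UNIV :: 'a set)"
    using choose_subspace_of_subspace[of k UNIV] assms by auto
  then show ?thesis
    by (auto simp: affine_subspaces_def subspace_imp_affine aff_dim_subspace intro!: exI[of _ T])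
qed

text \<open>Here \<kappa>1 / \<kappa>2 = b, so the factor of \<open>density_expand\<close> is b to
  the power (dim S - 1) - dim S * d / (d + 1), which is -(d + 1 - dim S) / (d + 1).\<close>

lemma lattice_density_expand:
  fixes S :: "(real \<times> (real ^ 'n)) set"
  assumes S: "rational_subspace S" and y: "0 < y" and b: "1 \<le> b"
    and v: "v \<in> S" "v \<noteq> 0" "m * norm (flow y x v) \<le> \<bar>fst (flow y x v)\<bar>" "0 < m"
  shows "lattice_density (y * b) x S
     \<le> (2 * real CARD('n) + 4) ^ (CARD('n) + 1) * b powr (- ((real CARD('n)
         + 1 - dim S) / (real CARD('n) + 1))) / m
       * lattice_density y x S"
proof -
  let ?d = "real CARD('n)"
  let ?l1 = "b powr (?d / (?d + 1))" and ?l2 = "b powr (- 1 / (?d + 1))"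
  let ?A = "(\<lambda>(p, q). (?l1 * p, ?l2 *\<^sub>R q)) :: real \<times> (real ^ 'n) \<Rightarrow> _"
  let ?X = "flow y x ` (integer_points \<inter> S)"
  have X: "discrete_subgroup ?X"
    by (intro discrete_flow y discrete_integer_subspace rational_subspace_subspace S)
  have eq: "flow (y * b) x ` (integer_points \<inter> S) = ?A ` ?X"
    unfolding image_image by (rule image_cong[OF refl], rule flow_mult) (use y b in auto)
  have "- 1 / (?d + 1) \<le> ?d / (?d + 1)" by (intro divide_right_mono) auto
  then have l: "0 < ?l2" "?l2 \<le> ?l1" using b by (auto intro!: powr_mono)
  have sp: "span ?X = flow y x ` S"
    using S by (simp add: linear_span_image[OF linear_flow] rational_subspace_def)
  have v': "flow y x v \<in> span ?X" "flow y x v \<noteq> 0"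
    using v(1) apply (simp add: sp)
    using v(2) linear_injective_0[OF linear_flow] inj_flow[OF y] by metis
  have dX: "dim ?X = dim S" using y by (simp add: rational_subspace_dim[OF S])
  have dpos: "dim S \<ge> 1"
  proof -
    have "S \<noteq> {0}" "S \<noteq> {}" using v by auto
    then show ?thesis using dim_eq_0[of S] by (metis One_nat_def Suc_leI gr0I subset_singletonD)
  qed
  have "(?l1 / ?l2) ^ (dim ?X - 1) / (m * ?l1 ^ dim ?X) = b powr (- ((?d + 1 - dim S) / (?d + 1))) / m"
  proof -
    have "?l1 / ?l2 = b powr (?d / (?d + 1) - - 1 / (?d + 1))" by (rule powr_diff[symmetric])
    also have "?d / (?d + 1) - - 1 / (?d + 1) = 1" by (simp add: field_simps)
    finally have "?l1 / ?l2 = b" using b by simp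
    then have "(?l1 / ?l2) ^ (dim ?X - 1) = b powr (real (dim S) - 1)"
      using b dpos by (simp add: dX powr_realpow[symmetric] of_nat_diff)
    moreover have "?l1 ^ dim ?X = b powr (?d / (?d + 1) * real (dim S))"
      using b by (simp add: dX powr_realpow[symmetric] powr_powr)
    ultimately have "(?l1 / ?l2) ^ (dim ?X - 1) / (m * ?l1 ^ dim ?X)
       = b powr ((real (dim S) - 1) - ?d / (?d + 1) * real (dim S)) / m"
      by (simp only: powr_diff) simp
    also have "(real (dim S) - 1) - ?d / (?d + 1) * real (dim S) = - ((?d + 1 - dim S) / (?d + 1))"
      by (simp add: field_simps)
    finally show ?thesis .
  qed
  moreover have "2 * real DIM(real \<times> (real ^ 'n)) + 2 = 2 * ?d + 4" "DIM(real \<times> (real ^ 'n)) = CARD('n) + 1"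
    by simp_all
  ultimately show ?thesis
    using density_expand[OF X l v'(1,2) v(3,4), folded eq] unfolding lattice_density_def
    by (simp only: times_divide_eq_right[symmetric] mult.assoc)
qed

text \<open>Expansion can fail only if every vector of the flowed S has a small first coordinate. If
  (1, 0) is not in S, then S is a graph p = -(q . a) over its projection W, and the first coordinate
  at x is a multiple of q . (x - a). It vanishes on all of S exactly when x lies in a plus the
  orthogonal complement of W, a subspace of codimension \<open>dim S\<close>.\<close>

lemma lattice_density_near_affine:
  fixes S :: "(real \<times> (real ^ 'n)) set"
  assumes S: "rational_subspace S" "1 \<le> dim S" "dim S \<le> CARD('n)"
  obtains A where "A \<in> affine_subspaces (CARD('n) - dim S)"
    "\<And>x y b. 0 < y \<Longrightarrow> 1 \<le> b \<Longrightarrow> 0 < infdist x A \<Longrightarrow>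
      lattice_density (y * b) x S \<le> (2 * real CARD('n) + 4) ^ (CARD('n) + 1)
       * b powr (- ((real CARD('n) + 1 - dim S) / (real CARD('n) + 1)))
       * (1 + 1 / (y * infdist x A)) * lattice_density y x S"
proof -
  let ?d = "real CARD('n)"
  let ?C = "\<lambda>b. (2 * real CARD('n) + 4) ^ (CARD('n) + 1)
       * b powr (- ((real CARD('n) + 1 - dim S) / (real CARD('n) + 1)))"
  have sS: "subspace S" by (rule rational_subspace_subspace[OF S(1)])
  show ?thesis
  proof (cases "(1, 0) \<in> S")
    case True
    \<comment> \<open>Any A will do: (1, 0) lies in S and is itself expanded, with m = 1.\<close>
    obtain A :: "(real ^ 'n) set" where A: "A \<in> affine_subspaces (CARD('n) - dim S)"
      using affine_subspaces_nonempty[of "CARD('n) - dim S", where 'a = "real ^ 'n"] by auto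
    show ?thesis
    proof (rule that[OF A])
      fix x :: "real ^ 'n" and y b :: real assume y: "0 < y" "1 \<le> b" and x: "0 < infdist x A"
      have "lattice_density (y * b) x S \<le> ?C b / 1 * lattice_density y x S"
        by (rule lattice_density_expand[OF S(1) y True]) (auto simp: zero_prod_def flow_def)
      also have "\<dots> \<le> ?C b * (1 + 1 / (y * infdist x A)) * lattice_density y x S"
        using x y by (intro mult_right_mono lattice_density_nonneg) (auto simp: field_simps)
      finally show "lattice_density (y * b) x S
          \<le> ?C b * (1 + 1 / (y * infdist x A)) * lattice_density y x S" .
    qed
  next
    case False
    \<comment> \<open>Here \<open>z\<close> is normal to S with positive first coordinate; dividing
      by that coordinate gives the \<open>a\<close> of the graph.\<close>
    obtain y0 z where z: "y0 \<in> S" "\<And>w. w \<in> S \<Longrightarrow> orthogonal z w" "(1, 0) = y0 + z"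
      using orthogonal_subspace_decomp_exists[of S "(1, 0)"] span_eq_iff[THEN iffD2, OF sS] by metis
    have z0: "z \<noteq> 0" using z(1,3) False by auto
    have "fst z = (1, 0) \<bullet> z" by (cases z) simp
    also have "\<dots> = z \<bullet> z" unfolding z(3) using z(2)[OF z(1)]
      by (simp add: inner_add_left inner_add_right orthogonal_def inner_commute)
    finally have fz: "fst z > 0" using z0 by simp
    define a where "a = snd z /\<^sub>R fst z"
    have on: "p = - (q \<bullet> a)" if "(p, q) \<in> S" for p q
    proof -
      have "fst z * p + snd z \<bullet> q = 0" using z(2)[OF that] by (cases z) (simp add: orthogonal_def)
      then show ?thesis using fz by (simp add: a_def inner_commute field_simps)
    qed
    define W where "W = snd ` S"
    have W: "subspace W" unfolding W_def by (intro linear_subspace_image[OF linear_snd] sS)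
    have inj: "inj_on snd S"
    proof (rule inj_onI)
      fix v w assume "v \<in> S" "w \<in> S" "snd v = snd w"
      then show "v = w" using on[of "fst v" "snd v"] on[of "fst w" "snd w"]
        by (metis prod.collapse prod_eqI)
    qed
    have dW: "dim W = dim S" unfolding W_def
      by (rule dim_image_eq[OF linear_snd]) (simp only: inj span_eq_iff[THEN iffD2, OF sS])
    define W' where "W' = {w. \<forall>q\<in>W. orthogonal q w}"
    have W': "subspace W'" "dim W' + dim W = CARD('n)"
    proof -
      show "subspace W'" unfolding W'_def by (rule subspace_orthogonal_to_vectors)
      show "dim W' + dim W = CARD('n)"
        using dim_subspace_orthogonal_to_vectors[OF W subspace_UNIV] unfolding W'_def by simp
    qed
    define A where "A = (+) a ` W'"
    have "affine A" unfolding A_def using W'(1)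
      by (simp add: affine_translation[symmetric] subspace_imp_affine)
    moreover have "aff_dim A = int (CARD('n) - dim S)"
      unfolding A_def using W' dW by (simp add: aff_dim_translation_eq aff_dim_subspace) 
    ultimately have A: "A \<in> affine_subspaces (CARD('n) - dim S)" by (simp add: affine_subspaces_def)
    show ?thesis
    proof (rule that[OF A])
      fix x :: "real ^ 'n" and y b :: real assume y: "0 < y" "1 \<le> b" and x: "0 < infdist x A"
      \<comment> \<open>The witness lies above the projection \<open>q\<close> of
        \<open>x - a\<close> to W: its flowed coordinates have the ratio \<open>y * norm q\<close>,
        and \<open>norm q\<close> is the distance from \<open>x\<close> to a point of A.\<close>
      obtain q w where q: "q \<in> W" "\<And>u. u \<in> W \<Longrightarrow> orthogonal w u" "x - a = q + w"
        using orthogonal_subspace_decomp_exists[of W "x - a"] span_eq_iff[THEN iffD2, OF W] by metis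
      have "w \<in> W'" unfolding W'_def using q(2) orthogonal_commute by blast
      then have "a + w \<in> A" by (auto simp: A_def)
      then have "infdist x A \<le> dist x (a + w)" by (rule infdist_le)
      also have "x - (a + w) = q" using q(3) by (simp add: algebra_simps)
      then have "dist x (a + w) = norm q" by (simp add: dist_norm)
      finally have iq: "infdist x A \<le> norm q" .
      then have q0: "norm q > 0" using x by linarith
      obtain v where v: "v \<in> S" "snd v = q" using q(1) by (auto simp: W_def)
      have v': "v = (- (q \<bullet> a), q)" using on[of "fst v" "snd v"] v by (cases v) auto
      have "q \<bullet> (x - a) = norm q * norm q"
        unfolding q(3) using q(2)[OF q(1)]
        by (simp add: inner_add_right orthogonal_def inner_commute power2_norm_eq_inner[symmetric]
            power2_eq_square)
      then have qx: "q \<bullet> x - q \<bullet> a = norm q * norm q" by (simp add: inner_diff_right)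
      define t where "t = y powr (- 1 / (?d + 1))"
      have t: "t > 0" "y powr (?d / (?d + 1)) = y * t"
      proof -
        show "t > 0" using y by (simp add: t_def)
        have "?d / (?d + 1) = 1 + (- 1) / (?d + 1)" by (simp add: field_simps)
        then have "y powr (?d / (?d + 1)) = y powr (1 + (- 1) / (?d + 1))" by (simp only:)
        also have "\<dots> = y powr 1 * t" unfolding t_def by (rule powr_add)
        finally show "y powr (?d / (?d + 1)) = y * t" using y by simp
      qed
      have fl: "flow y x v = (y * t * (norm q * norm q), t *\<^sub>R q)"
        unfolding flow_def v' using t(2) qx by (simp add: t_def)
      \<comment> \<open>This slope gives m = D / (D + 1) in \<open>lattice_density_expand\<close>,
        and 1 / m = 1 + 1 / D.\<close>
      define D where "D = y * norm q"
      have D: "D > 0" using y q0 by (simp add: D_def)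
      have "D / (D + 1) * norm (flow y x v) \<le> \<bar>fst (flow y x v)\<bar>"
      proof -
        have "norm (flow y x v) \<le> norm (y * t * (norm q * norm q)) + norm (t *\<^sub>R q)"
          unfolding fl by (rule norm_Pair_le)
        also have "\<dots> = (D + 1) * (t * norm q)" using y t(1) by (simp add: D_def abs_mult algebra_simps)
        finally have "D / (D + 1) * norm (flow y x v) \<le> D / (D + 1) * ((D + 1) * (t * norm q))"
          using D by (intro mult_left_mono) auto
        also have "\<dots> = D * (t * norm q)" using D by simp
        also have "\<dots> = \<bar>fst (flow y x v)\<bar>" unfolding fl using y t(1) by (simp add: D_def mult_ac abs_mult)
        finally show ?thesis .
      qed
      then have "lattice_density (y * b) x S \<le> ?C b / (D / (D + 1)) * lattice_density y x S"
        using D q0 v by (intro lattice_density_expand[OF S(1) y v(1)]) auto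
      also have "\<dots> = ?C b * (1 + 1 / D) * lattice_density y x S"
        using D by (simp add: field_simps)
      also have "\<dots> \<le> ?C b * (1 + 1 / (y * infdist x A)) * lattice_density y x S"
      proof -
        have "1 / D \<le> 1 / (y * infdist x A)" unfolding D_def using iq x y
          by (intro divide_left_mono mult_left_mono mult_pos_pos) auto
        then show ?thesis by (intro mult_right_mono mult_left_mono lattice_density_nonneg) auto
      qed
      finally show "lattice_density (y * b) x S
          \<le> ?C b * (1 + 1 / (y * infdist x A)) * lattice_density y x S" .
    qed
  qed
qed

section \<open>Hausdorff measure and cut sets of a self-similar set\<close>

text \<open>In a grid of mesh \<sigma> / DIM('a) two points of one cell are closer than \<sigma>, so
  each cell holds at most one.\<close>

lemma separated_card_le:
  fixes c :: "'b \<Rightarrow> 'a::euclidean_space"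
  assumes F: "finite F" and \<sigma>: "0 < \<sigma>" and L: "0 \<le> L"
    and sep: "\<And>u v. u \<in> F \<Longrightarrow> v \<in> F \<Longrightarrow> u \<noteq> v \<Longrightarrow> \<sigma> \<le> dist (c u) (c v)"
    and bnd: "\<And>u. u \<in> F \<Longrightarrow> dist x0 (c u) \<le> L"
  shows "real (card F) \<le> (2 * real DIM('a) * L / \<sigma> + 2) ^ DIM('a)"
proof -
  define \<tau> where "\<tau> = \<sigma> / real DIM('a)"
  have \<tau>: "\<tau> > 0" using \<sigma> by (simp add: \<tau>_def)
  define f where "f u = (\<lambda>b\<in>Basis. \<lfloor>((c u - x0) \<bullet> b) / \<tau>\<rfloor>)" for u
  define G where "G = (\<Pi>\<^sub>E b\<in>(Basis :: 'a set). {\<lfloor>- (L / \<tau>)\<rfloor> .. \<lfloor>L / \<tau>\<rfloor>})"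
  have "f ` F \<subseteq> G"
  proof (intro image_subsetI)
    fix u assume u: "u \<in> F"
    show "f u \<in> G" unfolding f_def G_def
    proof (rule restrict_PiE_iff[THEN iffD2], intro ballI)
      fix b :: 'a assume b: "b \<in> Basis"
      have "\<bar>(c u - x0) \<bullet> b\<bar> \<le> L" using Basis_le_norm[OF b, of "c u - x0"] bnd[OF u]
        by (simp add: dist_norm norm_minus_commute)
      then have "- L \<le> (c u - x0) \<bullet> b" "(c u - x0) \<bullet> b \<le> L" by auto
      then have "- (L / \<tau>) \<le> ((c u - x0) \<bullet> b) / \<tau>" "((c u - x0) \<bullet> b) / \<tau> \<le> L / \<tau>"
        using \<tau> by (auto simp: field_simps)
      then show "\<lfloor>((c u - x0) \<bullet> b) / \<tau>\<rfloor> \<in> {\<lfloor>- (L / \<tau>)\<rfloor>..\<lfloor>L / \<tau>\<rfloor>}"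
        by (auto intro: floor_mono)
    qed
  qed
  moreover have "inj_on f F"
  proof (rule inj_onI)
    fix u v assume uv: "u \<in> F" "v \<in> F" "f u = f v"
    have d: "\<bar>(c u - c v) \<bullet> b\<bar> < \<tau>" if b: "b \<in> Basis" for b
    proof -
      have "\<lfloor>((c u - x0) \<bullet> b) / \<tau>\<rfloor> = \<lfloor>((c v - x0) \<bullet> b) / \<tau>\<rfloor>"
        using fun_cong[OF uv(3), of b] b by (simp add: f_def)
      then have "\<bar>((c u - x0) \<bullet> b) / \<tau> - ((c v - x0) \<bullet> b) / \<tau>\<bar> < 1" by linarith
      then have "\<bar>((c u - c v) \<bullet> b) / \<tau>\<bar> < 1" by (simp add: diff_divide_distrib[symmetric] inner_diff_left)
      then show ?thesis using \<tau> by (simp add: abs_divide)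
    qed
    have "norm (c u - c v) \<le> (\<Sum>b\<in>Basis. \<bar>(c u - c v) \<bullet> b\<bar>)" by (rule norm_le_l1)
    also have "\<dots> < (\<Sum>b\<in>(Basis::'a set). \<tau>)" by (intro sum_strict_mono d) auto
    also have "\<dots> = \<sigma>" by (simp add: \<tau>_def)
    finally show "u = v" using sep[OF uv(1,2)] by (auto simp: dist_norm)
  qed
  moreover have "finite G" unfolding G_def by (intro finite_PiE) auto
  ultimately have "card F \<le> card G" by (intro card_inj_on_le)
  then have "real (card F) \<le> real (card G)" by simp
  also have "\<dots> = real (card {\<lfloor>- (L / \<tau>)\<rfloor> .. \<lfloor>L / \<tau>\<rfloor>}) ^ DIM('a)"
    unfolding G_def by (simp add: card_PiE)
  also have "\<dots> \<le> (2 * real DIM('a) * L / \<sigma> + 2) ^ DIM('a)"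
  proof (intro power_mono)
    have "L / \<tau> \<ge> 0" using L \<tau> by simp
    then have "real (card {\<lfloor>- (L / \<tau>)\<rfloor> .. \<lfloor>L / \<tau>\<rfloor>}) \<le> 2 * (L / \<tau>) + 2" by simp linarith
    also have "\<dots> = 2 * real DIM('a) * L / \<sigma> + 2" by (simp add: \<tau>_def)
    finally show "real (card {\<lfloor>- (L / \<tau>)\<rfloor> .. \<lfloor>L / \<tau>\<rfloor>}) \<le> 2 * real DIM('a) * L / \<sigma> + 2" .
  qed simp
  finally show ?thesis .
qed

section \<open>Covers and null sets of the Hausdorff outer measure\<close>

lemma hausdorff_pre_finite_cover:
  assumes "finite F" "\<And>w. w \<in> F \<Longrightarrow> bounded (U w)" "\<And>w. w \<in> F \<Longrightarrow> diameter (U w) \<le> \<delta>"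
    "A \<subseteq> (\<Union>w\<in>F. U w)" "0 < \<delta>"
  shows "hausdorff_pre s \<delta> A \<le> (\<Sum>w\<in>F. diam_power s (U w))"
proof -
  obtain f where f: "bij_betw f {0..<card F} F" using ex_bij_betw_nat_finite[OF assms(1)] by blast
  define V where "V i = (if i < card F then U (f i) else {})" for i
  have fi: "f i \<in> F" if "i < card F" for i using bij_betwE[OF f] that by auto
  have "hausdorff_pre s \<delta> A \<le> (\<Sum>i. diam_power s (V i))"
  proof (rule hausdorff_pre_lower)
    show "bounded (V i)" "diameter (V i) \<le> \<delta>" for i
      using assms(2,3)[OF fi, of i] assms(5) by (auto simp: V_def)
    show "A \<subseteq> (\<Union>i. V i)"
    proof
      fix x assume "x \<in> A"
      then obtain w where w: "w \<in> F" "x \<in> U w" using assms(4) by blast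
      then have "w \<in> f ` {0..<card F}" using f by (simp add: bij_betw_def)
      then obtain i where "i < card F" "w = f i" by auto
      then have "x \<in> V i" using w by (simp add: V_def)
      then show "x \<in> (\<Union>i. V i)" by blast
    qed
  qed
  also have "\<dots> = (\<Sum>i\<in>{0..<card F}. diam_power s (V i))"
    by (rule suminf_finite) (auto simp: V_def diam_power_def)
  also have "\<dots> = (\<Sum>i\<in>{0..<card F}. diam_power s (U (f i)))" by (rule sum.cong) (auto simp: V_def)
  also have "\<dots> = (\<Sum>w\<in>F. diam_power s (U w))" by (rule sum.reindex_bij_betw[OF f])
  finally show ?thesis .
qed

text \<open>Covers by sets of diameter at most 1 suffice, and for these a larger exponent only
  lowers the cost.\<close>

lemma hausdorff_outer_zero_mono:
  assumes "hausdorff_outer t A = 0" "0 \<le> t" "t \<le> s"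
  shows "hausdorff_outer s A = 0"
proof -
  have "hausdorff_pre s \<delta> A = 0" if "0 < \<delta>" for \<delta>
  proof -
    let ?d = "min \<delta> 1"
    have "hausdorff_pre s \<delta> A \<le> hausdorff_pre s ?d A" by (rule hausdorff_pre_antimono) simp
    also have "\<dots> \<le> hausdorff_pre t ?d A"
      unfolding hausdorff_pre_def[of t]
    proof (rule INF_greatest)
      fix U :: "nat \<Rightarrow> 'a set"
      assume U: "U \<in> {U. (\<forall>i. bounded (U i) \<and> diameter (U i) \<le> ?d) \<and> A \<subseteq> (\<Union>i. U i)}"
      have "hausdorff_pre s ?d A \<le> (\<Sum>i. diam_power s (U i))" using U by (intro hausdorff_pre_lower) auto
      also have "\<dots> \<le> (\<Sum>i. diam_power t (U i))"
      proof (intro suminf_le)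
        fix i
        have d: "0 \<le> diameter (U i)" "diameter (U i) \<le> 1"
          using U diameter_ge_0[of "U i"] by auto
        then have "diameter (U i) powr s \<le> diameter (U i) powr t"
        proof (cases "diameter (U i) = 0")
          case False
          then show ?thesis using d assms(3) by (simp add: powr_mono')
        qed simp
        moreover have "diameter (U i) powr s \<le> 1" if "0 \<le> s"
          using that d powr_mono2[of s "diameter (U i)" 1] by simp
        ultimately show "diam_power s (U i) \<le> diam_power t (U i)"
          using assms(2,3) by (auto simp: diam_power_def intro: ennreal_leI)
      qed auto
      finally show "hausdorff_pre s ?d A \<le> (\<Sum>i. diam_power t (U i))" .
    qed
    also have "\<dots> \<le> hausdorff_outer t A" using that by (intro hausdorff_pre_le_outer) simp
    finally show ?thesis using assms(1) by simp
  qed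
  then show ?thesis unfolding hausdorff_outer_def by (simp add: SUP_constant)
qed

lemma hausdorff_dim_le: "0 \<le> t \<Longrightarrow> hausdorff_outer t A = 0 \<Longrightarrow> hausdorff_dim A \<le> ereal t"
  unfolding hausdorff_dim_def by (rule INF_lower) auto

lemma hausdorff_dim_ge:
  assumes "hausdorff_outer s A \<noteq> 0" shows "ereal s \<le> hausdorff_dim A"
  unfolding hausdorff_dim_def
proof (rule INF_greatest)
  fix t assume "t \<in> {s. 0 \<le> s \<and> hausdorff_outer s A = 0}"
  then show "ereal s \<le> ereal t" using hausdorff_outer_zero_mono[of t A s] assms by force
qed

lemma hausdorff_dim_mono: "A \<subseteq> B \<Longrightarrow> hausdorff_dim A \<le> hausdorff_dim B"
  unfolding hausdorff_dim_def
  by (rule INF_superset_mono) (use hausdorff_outer_mono[of A B] in \<open>auto simp: le_zero_eq[symmetric]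
      simp del: le_zero_eq intro: order_trans\<close>)

text \<open>The exponent \<open>s\<close> is at first the solution of Moran's equation;
  \<open>hausdorff_dim_K\<close> identifies it with the Hausdorff dimension. The maps enter only
  through distances, ratios and images, not through their matrices.\<close>

locale self_similar =
  fixes \<Lambda> :: "'i set" and h :: "'i \<Rightarrow> 'a::euclidean_space \<Rightarrow> 'a" and \<rho> :: "'i \<Rightarrow> real"
    and K U :: "'a set" and s :: real
  assumes fin: "finite \<Lambda>" and ratio: "\<And>i. i \<in> \<Lambda> \<Longrightarrow> 0 < \<rho> i \<and> \<rho> i < 1"
    and sim: "\<And>i x y. i \<in> \<Lambda> \<Longrightarrow> dist (h i x) (h i y) = \<rho> i * dist x y"
    and onto: "\<And>i. i \<in> \<Lambda> \<Longrightarrow> surj (h i)"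
    and K: "compact K" "K \<noteq> {}" "K = (\<Union>i\<in>\<Lambda>. h i ` K)"
    and U: "open U" "U \<noteq> {}" "\<And>i. i \<in> \<Lambda> \<Longrightarrow> h i ` U \<subseteq> U"
      "\<And>i j. i \<in> \<Lambda> \<Longrightarrow> j \<in> \<Lambda> \<Longrightarrow> i \<noteq> j \<Longrightarrow> h i ` U \<inter> h j ` U = {}"
    and s: "0 \<le> s" "(\<Sum>i\<in>\<Lambda>. \<rho> i powr s) = 1"
begin

lemma ne: "\<Lambda> \<noteq> {}"
  using K(2,3) by auto

section \<open>Words and cut sets\<close>

primrec wmap :: "'i list \<Rightarrow> 'a \<Rightarrow> 'a" where
  "wmap [] = id"
| "wmap (i # w) = h i \<circ> wmap w"

primrec wratio :: "'i list \<Rightarrow> real" where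
  "wratio [] = 1"
| "wratio (i # w) = \<rho> i * wratio w"

text \<open>A word satisfies \<open>is_cut w r\<close> iff its ratio is at most \<open>r\<close> and that of no proper prefix is.\<close>

primrec is_cut :: "'i list \<Rightarrow> real \<Rightarrow> bool" where
  "is_cut [] r \<longleftrightarrow> 1 \<le> r"
| "is_cut (i # w) r \<longleftrightarrow> r < 1 \<and> i \<in> \<Lambda> \<and> is_cut w (r / \<rho> i)"

definition cuts :: "real \<Rightarrow> 'i list set" where "cuts r = {w. is_cut w r}"

definition rmin :: real where "rmin = Min (\<rho> ` \<Lambda>)"
definition rmax :: real where "rmax = Max (\<rho> ` \<Lambda>)"

lemma rmin: "0 < rmin" "rmin < 1" "i \<in> \<Lambda> \<Longrightarrow> rmin \<le> \<rho> i"
  using fin ne ratio unfolding rmin_def by (auto simp: Min_less_iff)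

lemma rmax: "0 < rmax" "rmax < 1" "i \<in> \<Lambda> \<Longrightarrow> \<rho> i \<le> rmax"
  using fin ne ratio unfolding rmax_def by (auto simp: Max_gr_iff)

lemma is_cut_set: "is_cut w r \<Longrightarrow> set w \<subseteq> \<Lambda>"
  by (induction w arbitrary: r) auto

lemma wratio_pos: "set w \<subseteq> \<Lambda> \<Longrightarrow> 0 < wratio w"
  by (induction w) (auto simp: ratio)

lemma wratio_append: "wratio (w @ v) = wratio w * wratio v"
  by (induction w) auto

lemma wmap_append: "wmap (w @ v) = wmap w \<circ> wmap v"
  by (induction w) auto

lemma dist_wmap: "set w \<subseteq> \<Lambda> \<Longrightarrow> dist (wmap w x) (wmap w y) = wratio w * dist x y"
  by (induction w arbitrary: x y) (auto simp: sim)

lemma surj_wmap: "set w \<subseteq> \<Lambda> \<Longrightarrow> surj (wmap w)"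
  by (induction w) (simp_all add: comp_surj onto del: comp_apply)

lemma wmap_image: "wmap (i # w) ` A = h i ` (wmap w ` A)"
  by (simp add: image_comp)

lemma wmap_append_image: "wmap (w @ v) ` A = wmap w ` (wmap v ` A)"
  by (simp add: image_comp wmap_append)

lemma is_cut_le: "0 < r \<Longrightarrow> is_cut w r \<Longrightarrow> wratio w \<le> r"
proof (induction w arbitrary: r)
  case (Cons i w)
  then have "\<rho> i > 0" "is_cut w (r / \<rho> i)" using ratio by auto
  then have "wratio w \<le> r / \<rho> i" using Cons.IH[of "r / \<rho> i"] Cons.prems by auto
  then show ?case using \<open>\<rho> i > 0\<close> by (simp add: field_simps)
qed auto

text \<open>Before its last letter the word still has ratio above r, and one letter costs at most a
  factor \<open>rmin\<close>. The words of one cut set therefore have comparable ratios.\<close>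

lemma is_cut_ge: "0 < r \<Longrightarrow> r \<le> 1 \<Longrightarrow> is_cut w r \<Longrightarrow> rmin * r \<le> wratio w"
proof (induction w arbitrary: r)
  case Nil
  then show ?case using rmin by auto
next
  case (Cons i w)
  then have i: "0 < \<rho> i" "rmin \<le> \<rho> i" and c: "is_cut w (r / \<rho> i)" using ratio rmin by auto
  show ?case
  proof (cases "r \<le> \<rho> i")
    case True
    then have "rmin * (r / \<rho> i) \<le> wratio w" using i Cons.prems by (intro Cons.IH c) (auto simp: field_simps)
    then show ?thesis using i by (simp add: field_simps)
  next
    case False
    then have "1 < r / \<rho> i" using i by (simp add: field_simps)
    then have "w = []" using c by (cases w) auto
    moreover have "rmin * r \<le> \<rho> i * 1" using i Cons.prems rmin(1) by (intro mult_mono) auto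
    ultimately show ?thesis by simp
  qed
qed

lemma cuts_ge1: "1 \<le> r \<Longrightarrow> cuts r = {[]}"
proof -
  assume "1 \<le> r"
  then have "is_cut w r \<longleftrightarrow> w = []" for w by (cases w) auto
  then show ?thesis by (auto simp: cuts_def)
qed

lemma cuts_less1: "r < 1 \<Longrightarrow> cuts r = (\<Union>i\<in>\<Lambda>. (#) i ` cuts (r / \<rho> i))"
proof -
  assume r: "r < 1"
  have "is_cut w r \<longleftrightarrow> (\<exists>i\<in>\<Lambda>. \<exists>v. w = i # v \<and> is_cut v (r / \<rho> i))" for w
    using r by (cases w) auto
  then show ?thesis by (auto simp: cuts_def)
qed

text \<open>The recursion for cut sets passes from r to r / \<rho> i, which is larger by at least
  the factor 1 / \<open>rmax\<close>, so that scale 1 is reached after finitely many steps.\<close>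

lemma scale_induct [consumes 1, case_names ge1 less1]:
  assumes "0 < r" and 1: "\<And>r. 1 \<le> r \<Longrightarrow> P r"
    and 2: "\<And>r. 0 < r \<Longrightarrow> r < 1 \<Longrightarrow> (\<And>i. i \<in> \<Lambda> \<Longrightarrow> P (r / \<rho> i)) \<Longrightarrow> P r"
  shows "P r"
proof -
  have "0 < r \<Longrightarrow> rmax ^ k \<le> r \<Longrightarrow> P r" for k
  proof (induction k arbitrary: r)
    case 0
    then show ?case using 1 by simp
  next
    case (Suc k)
    show ?case
    proof (cases "1 \<le> r")
      case False
      show ?thesis
      proof (rule 2)
        fix i assume i: "i \<in> \<Lambda>"
        have "rmax ^ k \<le> r / rmax" using Suc.prems rmax(1) by (simp add: field_simps)
        also have "\<dots> \<le> r / \<rho> i" using rmax(3)[OF i] ratio[OF i] Suc.prems by (intro divide_left_mono) auto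
        finally show "P (r / \<rho> i)" using Suc ratio[OF i] by auto
      qed (use False Suc in auto)
    qed (rule 1)
  qed
  moreover obtain k where "rmax ^ k < r" using real_arch_pow_inv[OF assms(1) rmax(2)] by blast
  ultimately show ?thesis using assms(1) less_imp_le by blast
qed

lemma finite_cuts: "0 < r \<Longrightarrow> finite (cuts r)"
  by (induction r rule: scale_induct) (auto simp: cuts_ge1 cuts_less1 fin)

lemma sum_cuts_less1:
  assumes "0 < r" "r < 1"
  shows "(\<Sum>w\<in>cuts r. f w) = (\<Sum>i\<in>\<Lambda>. \<Sum>v\<in>cuts (r / \<rho> i). f (i # v))"
proof -
  have "(\<Sum>w\<in>cuts r. f w) = (\<Sum>i\<in>\<Lambda>. sum f ((#) i ` cuts (r / \<rho> i)))"
    unfolding cuts_less1[OF assms(2)]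
    by (rule sum.UNION_disjoint[OF fin]) (use assms ratio in \<open>auto intro!: finite_cuts\<close>)
  also have "\<dots> = (\<Sum>i\<in>\<Lambda>. \<Sum>v\<in>cuts (r / \<rho> i). f (i # v))"
    by (rule sum.cong[OF refl]) (simp add: sum.reindex)
  finally show ?thesis .
qed

lemma wratio_powr_mult: "set w \<subseteq> \<Lambda> \<Longrightarrow> set v \<subseteq> \<Lambda> \<Longrightarrow>
  (wratio w * wratio v) powr t = wratio w powr t * wratio v powr t"
  using wratio_pos by (simp add: powr_mult less_imp_le)

lemma cuts_set: "w \<in> cuts r \<Longrightarrow> set w \<subseteq> \<Lambda>"
  using is_cut_set by (auto simp: cuts_def)

lemma cuts_ratio_pos: "w \<in> cuts r \<Longrightarrow> 0 < wratio w"
  using cuts_set wratio_pos by blast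

lemma cuts_ratio_le: "0 < r \<Longrightarrow> w \<in> cuts r \<Longrightarrow> wratio w \<le> r"
  using is_cut_le by (auto simp: cuts_def)

lemma cuts_ratio_ge: "0 < r \<Longrightarrow> r \<le> 1 \<Longrightarrow> w \<in> cuts r \<Longrightarrow> rmin * r \<le> wratio w"
  using is_cut_ge by (auto simp: cuts_def)

lemma sum_cuts: "0 < r \<Longrightarrow> (\<Sum>w\<in>cuts r. wratio w powr s) = 1"
proof (induction r rule: scale_induct)
  case (ge1 r)
  then show ?case by (simp add: cuts_ge1)
next
  case (less1 r)
  have "(\<Sum>w\<in>cuts r. wratio w powr s) = (\<Sum>i\<in>\<Lambda>. \<Sum>v\<in>cuts (r / \<rho> i). \<rho> i powr s * wratio v powr s)"
    unfolding sum_cuts_less1[OF less1(1,2)]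
    by (intro sum.cong refl) (use ratio cuts_ratio_pos in \<open>auto simp: powr_mult less_imp_le\<close>)
  also have "\<dots> = (\<Sum>i\<in>\<Lambda>. \<rho> i powr s * 1)"
    unfolding sum_distrib_left[symmetric] by (intro sum.cong refl) (simp add: less1)
  finally show ?case using s(2) by simp
qed

lemma limit_set_cuts: "0 < r \<Longrightarrow> K = (\<Union>w\<in>cuts r. wmap w ` K)"
proof (induction r rule: scale_induct)
  case (ge1 r)
  then show ?case by (simp add: cuts_ge1)
next
  case (less1 r)
  have "(\<Union>w\<in>cuts r. wmap w ` K) = (\<Union>i\<in>\<Lambda>. h i ` (\<Union>v\<in>cuts (r / \<rho> i). wmap v ` K))"
    unfolding cuts_less1[OF less1(2)] by (auto simp: wmap_image simp del: wmap.simps)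
  also have "\<dots> = (\<Union>i\<in>\<Lambda>. h i ` K)" using less1(3) by auto
  finally show ?case using K(3) by simp
qed

lemma wmap_limit_set: "set w \<subseteq> \<Lambda> \<Longrightarrow> wmap w ` K \<subseteq> K"
proof (induction w)
  case (Cons i w)
  then have "wmap (i # w) ` K \<subseteq> h i ` K" by (auto simp: wmap_image simp del: wmap.simps)
  also have "\<dots> \<subseteq> K" using Cons.prems by (subst (2) K(3)) auto
  finally show ?case .
qed simp

lemma wmap_open_set: "set w \<subseteq> \<Lambda> \<Longrightarrow> wmap w ` U \<subseteq> U"
proof (induction w)
  case (Cons i w)
  then have "wmap (i # w) ` U \<subseteq> h i ` U" by (auto simp: wmap_image simp del: wmap.simps)
  also have "\<dots> \<subseteq> U" using Cons.prems by (intro U(3)) auto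
  finally show ?case .
qed simp

lemma inj_h: "i \<in> \<Lambda> \<Longrightarrow> inj (h i)"
proof (rule injI)
  fix x y assume "i \<in> \<Lambda>" "h i x = h i y"
  then show "x = y" using sim[of i x y] ratio[of i] by simp
qed

text \<open>Neither of two distinct cut words is a prefix of the other; at the first letter where
  they differ the open set condition separates the images.\<close>

lemma is_cut_disjoint:
  "is_cut w r \<Longrightarrow> is_cut v r \<Longrightarrow> w \<noteq> v \<Longrightarrow> wmap w ` U \<inter> wmap v ` U = {}"
proof (induction w arbitrary: r v)
  case Nil
  then show ?case by (cases v) auto
next
  case (Cons i w)
  from Cons.prems obtain j v' where v: "v = j # v'" by (cases v) auto
  have i: "i \<in> \<Lambda>" "j \<in> \<Lambda>" "is_cut w (r / \<rho> i)" "is_cut v' (r / \<rho> j)" using Cons.prems v by auto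
  show ?case
  proof (cases "i = j")
    case True
    then have "wmap w ` U \<inter> wmap v' ` U = {}" using Cons.IH[OF i(3), of v'] i Cons.prems v by auto
    then have "h i ` (wmap w ` U) \<inter> h i ` (wmap v' ` U) = {}"
      using inj_h[OF i(1)] by (auto simp: inj_on_def)
    then show ?thesis using True v by (simp add: wmap_image del: wmap.simps)
  next
    case False
    have "wmap w ` U \<subseteq> U" "wmap v' ` U \<subseteq> U" using wmap_open_set is_cut_set i by auto
    then have "wmap (i # w) ` U \<subseteq> h i ` U" "wmap v ` U \<subseteq> h j ` U" using v
      by (auto simp: wmap_image simp del: wmap.simps)
    then show ?thesis using U(4)[OF i(1,2) False] by blast
  qed
qed

section \<open>Refinement of cut sets and packing\<close>

lemma is_cut_append:
  "0 < r' \<Longrightarrow> r' \<le> r \<Longrightarrow> is_cut w r \<Longrightarrow> is_cut (w @ v) r' \<longleftrightarrow> is_cut v (r' / wratio w)"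
proof (induction w arbitrary: r r')
  case (Cons i w)
  then have i: "i \<in> \<Lambda>" "\<rho> i > 0" "is_cut w (r / \<rho> i)" "r < 1" using ratio by auto
  have "is_cut (w @ v) (r' / \<rho> i) \<longleftrightarrow> is_cut v (r' / \<rho> i / wratio w)"
    using Cons.prems i by (intro Cons.IH[OF _ _ i(3)]) (auto intro: divide_right_mono)
  then show ?case using i Cons.prems by simp
qed simp

lemma is_cut_prefix:
  "0 < r' \<Longrightarrow> r' \<le> r \<Longrightarrow> is_cut u r' \<Longrightarrow> \<exists>w v. u = w @ v \<and> is_cut w r"
proof (induction u arbitrary: r r')
  case Nil
  then show ?case by auto
next
  case (Cons i u)
  show ?case
  proof (cases "1 \<le> r")
    case True
    then show ?thesis by (intro exI[of _ "[]"] exI[of _ "i # u"]) auto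
  next
    case False
    have i: "i \<in> \<Lambda>" "\<rho> i > 0" "is_cut u (r' / \<rho> i)" using ratio Cons.prems by auto
    then obtain w v where "u = w @ v" "is_cut w (r / \<rho> i)"
      using Cons.IH[of "r' / \<rho> i" "r / \<rho> i"] Cons.prems by (auto simp: divide_right_mono)
    then show ?thesis using False i by (intro exI[of _ "i # w"] exI[of _ v]) auto
  qed
qed

lemma is_cut_unique: "is_cut w r \<Longrightarrow> is_cut w' r \<Longrightarrow> w @ v = w' @ v' \<Longrightarrow> w = w'"
proof (induction w arbitrary: r w')
  case Nil
  then show ?case by (cases w') auto
next
  case (Cons i w)
  then show ?case by (cases w') auto
qed

text \<open>If w belongs to a coarser cut set, these are its descendants in \<open>cuts r'\<close>.
  The tails form a cut set at the relative scale \<open>r' / wratio w\<close>, so every estimate for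
  cut sets also holds inside a piece.\<close>

definition children :: "real \<Rightarrow> 'i list \<Rightarrow> 'i list set" where
  "children r' w = (@) w ` cuts (r' / wratio w)"

lemma children_subset_cuts: "0 < r' \<Longrightarrow> r' \<le> r \<Longrightarrow> w \<in> cuts r \<Longrightarrow> children r' w \<subseteq> cuts r'"
  using is_cut_append by (auto simp: children_def cuts_def)

lemma cuts_children: "0 < r' \<Longrightarrow> r' \<le> r \<Longrightarrow> cuts r' = (\<Union>w\<in>cuts r. children r' w)"
proof
  assume r: "0 < r'" "r' \<le> r"
  show "(\<Union>w\<in>cuts r. children r' w) \<subseteq> cuts r'" using children_subset_cuts[OF r] by blast
  show "cuts r' \<subseteq> (\<Union>w\<in>cuts r. children r' w)"
  proof
    fix u assume "u \<in> cuts r'"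
    then have "is_cut u r'" by (simp add: cuts_def)
    moreover from is_cut_prefix[OF r this] obtain w v where "u = w @ v" "is_cut w r" by blast
    ultimately have "u = w @ v" "is_cut w r" "is_cut (w @ v) r'" by auto
    then show "u \<in> (\<Union>w\<in>cuts r. children r' w)" using is_cut_append[OF r, of w v]
      by (auto simp: children_def cuts_def)
  qed
qed

lemma sum_children:
  assumes r: "0 < r'" "r' \<le> r" and V: "V \<subseteq> cuts r"
  shows "(\<Sum>u\<in>(\<Union>w\<in>V. children r' w). f u) = (\<Sum>w\<in>V. \<Sum>v\<in>cuts (r' / wratio w). f (w @ v))"
proof -
  have finV: "finite V" using V finite_cuts[of r] r finite_subset by auto
  have "(\<Sum>u\<in>(\<Union>w\<in>V. children r' w). f u) = (\<Sum>w\<in>V. sum f (children r' w))"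
  proof (rule sum.UNION_disjoint[OF finV])
    show "\<forall>w\<in>V. finite (children r' w)"
      using V cuts_ratio_pos r by (auto simp: children_def intro!: finite_imageI finite_cuts)
    show "\<forall>w\<in>V. \<forall>w'\<in>V. w \<noteq> w' \<longrightarrow> children r' w \<inter> children r' w' = {}"
    proof (intro ballI impI)
      fix w w' assume w: "w \<in> V" "w' \<in> V" "w \<noteq> w'"
      then have "is_cut w r" "is_cut w' r" using V by (auto simp: cuts_def)
      then show "children r' w \<inter> children r' w' = {}"
        using is_cut_unique[of w r w'] w(3) by (auto simp: children_def)
    qed
  qed
  also have "\<dots> = (\<Sum>w\<in>V. \<Sum>v\<in>cuts (r' / wratio w). f (w @ v))"
    unfolding children_def by (rule sum.cong[OF refl]) (simp add: sum.reindex inj_on_def)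
  finally show ?thesis .
qed

lemma sum_children_powr:
  assumes r: "0 < r'" "r' \<le> r" and V: "V \<subseteq> cuts r"
  shows "(\<Sum>u\<in>(\<Union>w\<in>V. children r' w). wratio u powr s) = (\<Sum>w\<in>V. wratio w powr s)"
  unfolding sum_children[OF assms]
proof (intro sum.cong refl)
  fix w assume "w \<in> V"
  then have w: "w \<in> cuts r" using V by blast
  have "(\<Sum>v\<in>cuts (r' / wratio w). wratio (w @ v) powr s)
      = wratio w powr s * (\<Sum>v\<in>cuts (r' / wratio w). wratio v powr s)"
    unfolding sum_distrib_left wratio_append
    by (intro sum.cong refl wratio_powr_mult) (use cuts_set w in auto)
  also have "(\<Sum>v\<in>cuts (r' / wratio w). wratio v powr s) = 1" using cuts_ratio_pos[OF w] r
    by (intro sum_cuts) auto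
  finally show "(\<Sum>v\<in>cuts (r' / wratio w). wratio (w @ v) powr s) = wratio w powr s" by simp
qed

lemma wmap_children_subset: "u \<in> children r' w \<Longrightarrow> wmap u ` K \<subseteq> wmap w ` K"
proof -
  assume "u \<in> children r' w"
  then obtain v where v: "u = w @ v" "v \<in> cuts (r' / wratio w)" by (auto simp: children_def)
  show "wmap u ` K \<subseteq> wmap w ` K"
    unfolding v(1) wmap_append_image by (rule image_mono[OF wmap_limit_set[OF cuts_set[OF v(2)]]])
qed

text \<open>The usual volume argument. A ball of radius \<open>a\<close> in U has images of radius
  at least \<open>rmin * r * a\<close> inside the disjoint images of U, so their centres are
  separated by that amount, while pieces that meet B keep the centres within
  \<open>r * (2 * M + 1)\<close> of each other. All lengths scale with r, hence a constant free of r
  and B.\<close>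

lemma packing:
  obtains C where "1 \<le> C"
    "\<And>r B. 0 < r \<Longrightarrow> (\<And>x y. x \<in> B \<Longrightarrow> y \<in> B \<Longrightarrow> dist x y \<le> r) \<Longrightarrow>
       real (card {w \<in> cuts r. wmap w ` K \<inter> B \<noteq> {}}) \<le> C"
proof -
  obtain z where z: "z \<in> U" using U(2) by blast
  then obtain a where a: "0 < a" "ball z a \<subseteq> U" using U(1) open_contains_ball by blast
  obtain M where M: "0 < M" "\<And>k. k \<in> K \<Longrightarrow> dist z k \<le> M"
  proof -
    have "bounded (dist z ` K)" using K(1) by (intro compact_imp_bounded compact_continuous_image
        continuous_intros)
    then obtain M where "\<And>k. k \<in> K \<Longrightarrow> \<bar>dist z k\<bar> \<le> M" unfolding bounded_iff by auto
    then show ?thesis using that[of "max M 1"] by fastforce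
  qed
  define C where "C = max 1 ((2 * real DIM('a) * (2 * M + 1) / (rmin * a) + 2) ^ DIM('a))"
  show ?thesis
  proof (rule that[of C])
    show "1 \<le> C" by (simp add: C_def)
    fix r :: real and B :: "'a set"
    assume r: "0 < r" and B: "\<And>x y. x \<in> B \<Longrightarrow> y \<in> B \<Longrightarrow> dist x y \<le> r"
    let ?F = "{w \<in> cuts r. wmap w ` K \<inter> B \<noteq> {}}"
    show "real (card ?F) \<le> C"
    proof (cases "r \<le> 1")
      case False
      then have "?F \<subseteq> {[]}" using cuts_ge1[of r] by auto
      then have "card ?F \<le> card {[] :: 'i list}" by (intro card_mono) auto
      then show ?thesis by (simp add: C_def)
    next
      case True
      show ?thesis
      proof (cases "?F = {}")
        case F: False
        then obtain w0 where w0: "w0 \<in> ?F" by blast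
        have finF: "finite ?F" using finite_cuts[OF r] by auto
        have near: "dist (wmap u z) (wmap v z) \<le> r * (2 * M + 1)" if uv: "u \<in> ?F" "v \<in> ?F" for u v
        proof -
          obtain k l where kl: "k \<in> K" "wmap u k \<in> B" "l \<in> K" "wmap v l \<in> B" using uv by auto
          have 1: "dist (wmap u z) (wmap u k) \<le> r * M" 
            using dist_wmap[of u z k] cuts_set[of u r] cuts_ratio_le[OF r, of u] M(2)[OF kl(1)] M(1)
                cuts_ratio_pos[of u r] uv
            by (auto intro!: mult_mono)
          have 2: "dist (wmap v z) (wmap v l) \<le> r * M" 
            using dist_wmap[of v z l] cuts_set[of v r] cuts_ratio_le[OF r, of v] M(2)[OF kl(3)] M(1)
                cuts_ratio_pos[of v r] uv
            by (auto intro!: mult_mono)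
          have "dist (wmap u z) (wmap v z) \<le> dist (wmap u z) (wmap u k) + dist (wmap u k) (wmap v l)
              + dist (wmap v z) (wmap v l)"
            using dist_triangle[of "wmap u z" "wmap v z" "wmap u k"] dist_triangle[of "wmap u k"
              "wmap v z" "wmap v l"]
            by (simp add: dist_commute)
          also have "\<dots> \<le> r * M + r + r * M" using 1 2 B[OF kl(2,4)] by linarith
          finally show ?thesis by (simp add: algebra_simps)
        qed
        have "real (card ?F) \<le> (2 * real DIM('a) * (r * (2 * M + 1)) / (rmin * r * a) + 2) ^ DIM('a)"
        proof (rule separated_card_le[OF finF, where c = "\<lambda>w. wmap w z" and ?x0.0 = "wmap w0 z"])
          show "0 < rmin * r * a" using rmin(1) r a(1) by simp
          show "0 \<le> r * (2 * M + 1)" using r M by simp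
          show "dist (wmap w0 z) (wmap u z) \<le> r * (2 * M + 1)" if "u \<in> ?F" for u using near[OF w0 that] .
          fix u v assume uv: "u \<in> ?F" "v \<in> ?F" "u \<noteq> v"
          then have u: "set u \<subseteq> \<Lambda>" "is_cut u r" "is_cut v r" "rmin * r \<le> wratio u"
            using cuts_set[of u r] cuts_ratio_ge[OF r True] by (auto simp: cuts_def)
          show "rmin * r * a \<le> dist (wmap u z) (wmap v z)"
          proof (rule ccontr)
            assume "\<not> ?thesis"
            moreover have "rmin * r * a \<le> wratio u * a" using u a by (intro mult_right_mono) auto
            ultimately have d: "dist (wmap u z) (wmap v z) < wratio u * a" by linarith
            \<comment> \<open>The centre of v would be the image under u of a point closer to
              \<open>z\<close> than \<open>a\<close>, that is, of a point of U.\<close>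
            obtain y where y: "wmap v z = wmap u y" using surj_wmap[OF u(1)] by (metis surjD)
            have "wratio u * dist z y < wratio u * a" using d dist_wmap[OF u(1)] y by simp
            then have "y \<in> U" using wratio_pos[OF u(1)] a(2) by (auto simp: subset_iff)
            then have "wmap v z \<in> wmap u ` U" using y by simp
            then have "wmap v z \<in> wmap u ` U \<inter> wmap v ` U" using z by blast
            then show False using is_cut_disjoint[OF u(2,3) uv(3)] by blast
          qed
        qed
        also have "2 * real DIM('a) * (r * (2 * M + 1)) / (rmin * r * a)
            = 2 * real DIM('a) * (2 * M + 1) / (rmin * a)"
          using r by simp
        finally show ?thesis by (simp add: C_def)
      next
        case True
        show ?thesis unfolding True by (simp add: C_def)
      qed
    qed
  qed
qed

text \<open>Group the words by their ancestors at the scale d of B: at most C of these meet B, each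
  of weight at most \<open>d powr s\<close>.\<close>

lemma packing_sum:
  obtains C where "1 \<le> C"
    "\<And>r d B. 0 < r \<Longrightarrow> r \<le> d \<Longrightarrow> (\<And>x y. x \<in> B \<Longrightarrow> y \<in> B \<Longrightarrow> dist x y \<le> d) \<Longrightarrow>
       (\<Sum>w | w \<in> cuts r \<and> wmap w ` K \<inter> B \<noteq> {}. wratio w powr s) \<le> C * d powr s"
proof -
  obtain C where C: "1 \<le> C" "\<And>r B. 0 < r \<Longrightarrow> (\<And>x y. x \<in> B \<Longrightarrow> y \<in> B \<Longrightarrow> dist x y \<le> r) \<Longrightarrow>
       real (card {w \<in> cuts r. wmap w ` K \<inter> B \<noteq> {}}) \<le> C" using packing by blast
  show ?thesis
  proof (rule that[OF C(1)])
    fix r d :: real and B :: "'a set"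
    assume r: "0 < r" "r \<le> d" and B: "\<And>x y. x \<in> B \<Longrightarrow> y \<in> B \<Longrightarrow> dist x y \<le> d"
    let ?F = "{w \<in> cuts d. wmap w ` K \<inter> B \<noteq> {}}"
    have d: "0 < d" using r by simp
    have "{w. w \<in> cuts r \<and> wmap w ` K \<inter> B \<noteq> {}} \<subseteq> (\<Union>w\<in>?F. children r w)"
    proof
      fix u assume u: "u \<in> {w. w \<in> cuts r \<and> wmap w ` K \<inter> B \<noteq> {}}"
      then obtain w where w: "w \<in> cuts d" "u \<in> children r w" using cuts_children[OF r] by blast
      then have "wmap u ` K \<subseteq> wmap w ` K" using wmap_children_subset by blast
      then show "u \<in> (\<Union>w\<in>?F. children r w)" using u w by blast
    qed
    moreover have "finite (\<Union>w\<in>?F. children r w)"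
      by (rule finite_subset[OF _ finite_cuts[OF r(1)]]) (use cuts_children[OF r] in auto)
    ultimately have "(\<Sum>w | w \<in> cuts r \<and> wmap w ` K \<inter> B \<noteq> {}. wratio w powr s)
        \<le> (\<Sum>w\<in>(\<Union>w\<in>?F. children r w). wratio w powr s)"
      by (intro sum_mono2) auto
    also have "\<dots> = (\<Sum>w\<in>?F. wratio w powr s)" by (rule sum_children_powr[OF r]) auto
    also have "\<dots> \<le> (\<Sum>w\<in>?F. d powr s)"
      using cuts_ratio_le[OF d] cuts_ratio_pos s(1) by (intro sum_mono powr_mono2) (auto intro: less_imp_le)
    also have "\<dots> = real (card ?F) * d powr s" by simp
    also have "\<dots> \<le> C * d powr s" by (intro mult_right_mono C(2)[OF d] B) auto
    finally show "(\<Sum>w | w \<in> cuts r \<and> wmap w ` K \<inter> B \<noteq> {}. wratio w powr s) \<le> C * d powr s" .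
  qed
qed

lemma compact_wmap_limit_set: "set w \<subseteq> \<Lambda> \<Longrightarrow> compact (wmap w ` K)"
proof (rule compact_continuous_image[OF _ K(1)])
  assume w: "set w \<subseteq> \<Lambda>"
  have "(wratio w)-lipschitz_on K (wmap w)"
    by (rule lipschitz_onI) (use dist_wmap[OF w] wratio_pos[OF w] in auto)
  then show "continuous_on K (wmap w)" by (rule lipschitz_on_continuous_on)
qed

end

section \<open>Word weights against Hausdorff measure\<close>

lemma diam_power_enlarge:
  fixes A :: "'a::metric_space set"
  assumes "A \<noteq> {}" "bounded A" "0 \<le> s" "0 < e"
  obtains d where "diameter A < d" "ennreal (d powr s) \<le> diam_power s A + ennreal e"
proof (cases "s = 0")
  case True
  \<comment> \<open>For exponent 0 a nonempty set costs 1 whatever its diameter, so any larger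
    number will do.\<close>
  have "ennreal ((\<bar>diameter A\<bar> + 1) powr s) = 1" using True by simp
  then show ?thesis
    using that[of "\<bar>diameter A\<bar> + 1"] True assms(1) by (auto simp: diam_power_def)
next
  case False
  let ?D = "diameter A"
  have d0: "0 \<le> ?D" using diameter_ge_0[OF assms(2)] .
  have "((\<lambda>d. d powr s) \<longlongrightarrow> ?D powr s) (at_right ?D)"
    using False assms(3) d0 by (intro tendsto_powr' tendsto_ident_at tendsto_const) (auto simp:
        eventually_at_right_field intro!: exI[of _ "?D + 1"])
  then have "\<forall>\<^sub>F d in at_right ?D. d powr s < ?D powr s + e"
    by (rule order_tendstoD(2)) (use assms(4) in simp)
  then obtain b where b: "b > ?D" "\<And>d. ?D < d \<Longrightarrow> d < b \<Longrightarrow> d powr s < ?D powr s + e"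
    by (auto simp: eventually_at_right_field)
  define d where "d = (?D + b) / 2"
  have d: "?D < d" "d powr s < ?D powr s + e" using b by (auto simp: d_def)
  have "ennreal (d powr s) \<le> ennreal (?D powr s + e)" using d(2) by (intro ennreal_leI) simp
  also have "\<dots> = diam_power s A + ennreal e"
    using assms False by (simp add: diam_power_def ennreal_plus)
  finally show ?thesis by (rule that[OF d(1)])
qed

lemma sum_UN_le:
  fixes f :: "'b \<Rightarrow> real"
  assumes "finite I" "\<And>i. i \<in> I \<Longrightarrow> finite (P i)" "\<And>x. 0 \<le> f x"
  shows "sum f (\<Union>i\<in>I. P i) \<le> (\<Sum>i\<in>I. sum f (P i))"
  using assms(1,2)
proof (induction I rule: finite_induct)
  case (insert i I)
  have "sum f (P i \<union> (\<Union>i\<in>I. P i)) \<le> sum f (P i) + sum f (\<Union>i\<in>I. P i)"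
    using insert by (subst sum.union_inter[symmetric]) (auto intro!: sum_nonneg assms(3))
  then show ?case using insert by simp
qed simp

lemma open_nbhd_open: "open (open_nbhd \<epsilon> L)"
  unfolding open_nbhd_def by (intro open_UN) auto

context self_similar
begin

text \<open>The weights \<open>wratio w powr s\<close> of the words take the place of the self-similar measure.\<close>

lemma mass_distribution:
  obtains C where "1 \<le> C"
    "\<And>r V F. 0 < r \<Longrightarrow> V \<subseteq> cuts r \<Longrightarrow> (\<And>w. w \<in> V \<Longrightarrow> wmap w ` K \<subseteq> F) \<Longrightarrow>
       ennreal (\<Sum>w\<in>V. wratio w powr s) \<le> ennreal C * hausdorff_outer s F"
proof -
  obtain C where C: "1 \<le> C"
    "\<And>r d B. 0 < r \<Longrightarrow> r \<le> d \<Longrightarrow> (\<And>x y. x \<in> B \<Longrightarrow> y \<in> B \<Longrightarrow> dist x y \<le> d) \<Longrightarrow>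
       (\<Sum>w | w \<in> cuts r \<and> wmap w ` K \<inter> B \<noteq> {}. wratio w powr s) \<le> C * d powr s"
    using packing_sum by blast
  have main: "ennreal (\<Sum>w\<in>V. wratio w powr s) \<le> ennreal C * (\<Sum>i. diam_power s (X i))"
    if r: "0 < r" and V: "V \<subseteq> cuts r" and F: "\<And>w. w \<in> V \<Longrightarrow> wmap w ` K \<subseteq> (\<Union>i. X i)"
      and X: "\<And>i. bounded (X i)" for r V and X :: "nat \<Rightarrow> 'a set"
  proof -
    have finV: "finite V" using V finite_cuts[OF r] finite_subset by blast
    have eps: "ennreal (\<Sum>w\<in>V. wratio w powr s)
        \<le> ennreal C * ((\<Sum>i. diam_power s (X i)) + ennreal e)" if e: "0 < e" for e
    proof -
      define \<eta> where "\<eta> i = e * (1/2) ^ Suc i" for i :: nat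
      have \<eta>: "\<eta> i > 0" for i using e by (simp add: \<eta>_def)
      \<comment> \<open>Covering sets are arbitrary; slightly enlarged open ones, at a total extra
        cost e, allow a finite subcover of the compact pieces.\<close>
      have "\<exists>d>0. \<exists>Y. open Y \<and> X i \<subseteq> Y \<and> (\<forall>x\<in>Y. \<forall>y\<in>Y. dist x y \<le> d) \<and>
         (Y = {} \<or> ennreal (d powr s) \<le> diam_power s (X i) + ennreal (\<eta> i))" for i
      proof (cases "X i = {}")
        case True
        then show ?thesis by (intro exI[of _ 1] conjI exI[of _ "{}"]) auto
      next
        case False
        obtain d where d: "diameter (X i) < d" "ennreal (d powr s) \<le> diam_power s (X i) + ennreal (\<eta> i)"
          using diam_power_enlarge[OF False X s(1) \<eta>] by blast
        define \<delta> where "\<delta> = (d - diameter (X i)) / 2"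
        have \<delta>: "\<delta> > 0" using d(1) by (simp add: \<delta>_def)
        show ?thesis
        proof (intro exI[of _ d] exI[of _ "\<Union>x\<in>X i. ball x \<delta>"] conjI ballI disjI2 d(2))
          show "d > 0" using d(1) diameter_ge_0[OF X, of i] by linarith
          show "X i \<subseteq> (\<Union>x\<in>X i. ball x \<delta>)" using \<delta> by force
          fix x y assume "x \<in> (\<Union>x\<in>X i. ball x \<delta>)" "y \<in> (\<Union>x\<in>X i. ball x \<delta>)"
          then obtain a b where ab: "a \<in> X i" "b \<in> X i" "dist a x < \<delta>" "dist b y < \<delta>" by auto
          have "dist x y \<le> dist a x + dist a b + dist b y"
            using dist_triangle[of x y a] dist_triangle[of a y b] by (simp add: dist_commute)
          also have "\<dots> \<le> \<delta> + diameter (X i) + \<delta>" using ab diameter_bounded_bound[OF X ab(1,2)] by linarith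
          finally show "dist x y \<le> d" by (simp add: \<delta>_def)
        qed auto
      qed
      then obtain d Y where d: "\<And>i. d i > 0" and Y: "\<And>i. open (Y i)" "\<And>i. X i \<subseteq> Y i"
        "\<And>i x y. x \<in> Y i \<Longrightarrow> y \<in> Y i \<Longrightarrow> dist x y \<le> d i"
        "\<And>i. Y i = {} \<or> ennreal (d i powr s) \<le> diam_power s (X i) + ennreal (\<eta> i)"
        by metis
      \<comment> \<open>For empty \<open>X i\<close> the number \<open>d i\<close> is arbitrary, so
        the cost is set to 0 separately.\<close>
      define c where "c i = (if Y i = {} then 0 else d i powr s)" for i
      have c: "0 \<le> c i" "ennreal (c i) \<le> diam_power s (X i) + ennreal (\<eta> i)" for i
        using Y(4)[of i] by (auto simp: c_def)
      have comp: "compact (\<Union>w\<in>V. wmap w ` K)" using finV V cuts_set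
        by (intro compact_UN compact_wmap_limit_set) auto
      have cov: "(\<Union>w\<in>V. wmap w ` K) \<subseteq> (\<Union>i\<in>UNIV. Y i)"
      proof
        fix x assume "x \<in> (\<Union>w\<in>V. wmap w ` K)"
        then obtain i where "x \<in> X i" using F by blast
        then show "x \<in> (\<Union>i\<in>UNIV. Y i)" using Y(2)[of i] by blast
      qed
      obtain I where I: "finite I" "(\<Union>w\<in>V. wmap w ` K) \<subseteq> (\<Union>i\<in>I. Y i)"
        by (rule compactE_image[OF comp Y(1) cov])
      \<comment> \<open>A scale below all bounds \<open>d i\<close>, so that
        \<open>packing_sum\<close> applies to every member of the finite subcover.\<close>
      define r' where "r' = Min (insert r (d ` I))"
      have r': "0 < r'" "r' \<le> r" "\<And>i. i \<in> I \<Longrightarrow> r' \<le> d i"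
        using I(1) r d by (auto simp: r'_def)
      define D where "D = (\<Union>w\<in>V. children r' w)"
      have DW: "D \<subseteq> cuts r'" using children_subset_cuts[OF r'(1,2)] V by (auto simp: D_def)
      define P where "P i = {w. w \<in> cuts r' \<and> wmap w ` K \<inter> Y i \<noteq> {}}" for i
      have finP: "finite (P i)" for i using finite_cuts[OF r'(1)] by (simp add: P_def)
      have DP: "D \<subseteq> (\<Union>i\<in>I. P i)"
      proof
        fix u assume u: "u \<in> D"
        then obtain w where w: "w \<in> V" "u \<in> children r' w" by (auto simp: D_def)
        obtain k where "k \<in> K" using K(2) by blast
        then have "wmap u k \<in> (\<Union>w\<in>V. wmap w ` K)" using wmap_children_subset[OF w(2)] w(1) by blast
        then obtain i where "i \<in> I" "wmap u k \<in> Y i" using I(2) by blast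
        then have "i \<in> I" "u \<in> P i" using DW u \<open>k \<in> K\<close> unfolding P_def by blast+
        then show "u \<in> (\<Union>i\<in>I. P i)" by blast
      qed
      have "(\<Sum>w\<in>V. wratio w powr s) = (\<Sum>u\<in>D. wratio u powr s)"
        unfolding D_def by (rule sum_children_powr[OF r'(1,2) V, symmetric])
      also have "\<dots> \<le> (\<Sum>u\<in>(\<Union>i\<in>I. P i). wratio u powr s)"
        using DP I(1) finP by (intro sum_mono2) auto
      also have "\<dots> \<le> (\<Sum>i\<in>I. \<Sum>u\<in>P i. wratio u powr s)"
        using I(1) finP by (intro sum_UN_le) auto
      also have "\<dots> \<le> (\<Sum>i\<in>I. C * c i)"
      proof (intro sum_mono)
        fix i assume i: "i \<in> I"
        show "(\<Sum>u\<in>P i. wratio u powr s) \<le> C * c i"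
        proof (cases "Y i = {}")
          case False
          then show ?thesis unfolding P_def c_def using C(2)[OF r'(1) r'(3)[OF i], of "Y i"] Y(3) by simp
        qed (simp add: P_def c_def)
      qed
      also have "\<dots> = C * (\<Sum>i\<in>I. c i)" by (simp add: sum_distrib_left)
      finally have "ennreal (\<Sum>w\<in>V. wratio w powr s) \<le> ennreal (C * (\<Sum>i\<in>I. c i))" by (rule ennreal_leI)
      also have "\<dots> = ennreal C * (\<Sum>i\<in>I. ennreal (c i))"
        using C(1) c(1) by (simp add: ennreal_mult sum_nonneg)
      also have "\<dots> \<le> ennreal C * (\<Sum>i\<in>I. diam_power s (X i) + ennreal (\<eta> i))"
        by (intro mult_left_mono sum_mono c) auto
      also have "\<dots> \<le> ennreal C * (\<Sum>i. diam_power s (X i) + ennreal (\<eta> i))"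
        using I(1) by (intro mult_left_mono sum_le_suminf) auto
      also have "(\<Sum>i. diam_power s (X i) + ennreal (\<eta> i)) = (\<Sum>i. diam_power s (X i)) + (\<Sum>i. ennreal (\<eta> i))"
        by (intro suminf_add[symmetric]) auto
      also have "(\<Sum>i. ennreal (\<eta> i)) = ennreal e"
      proof -
        have "(\<lambda>i. e * (1/2) ^ Suc i) sums (e * 1)" by (intro sums_mult power_half_series)
        then show ?thesis unfolding \<eta>_def using e by (intro suminf_ennreal_eq) auto
      qed
      finally show ?thesis .
    qed
    show ?thesis
    proof (rule ennreal_le_epsilon)
      fix e :: real assume e: "0 < e"
      have "ennreal C * ennreal (e / C) = ennreal e" using C(1) e by (simp add: ennreal_mult[symmetric])
      then show "ennreal (\<Sum>w\<in>V. wratio w powr s) \<le> ennreal C * (\<Sum>i. diam_power s (X i)) + ennreal e"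
        using eps[of "e / C"] e C(1) by (simp add: distrib_left)
    qed
  qed
  show ?thesis
  proof (rule that[OF C(1)])
    fix r V and F :: "'a set" assume r: "0 < r" "V \<subseteq> cuts r" "\<And>w. w \<in> V \<Longrightarrow> wmap w ` K \<subseteq> F"
    let ?S = "\<Sum>w\<in>V. wratio w powr s"
    have inv: "ennreal (1 / C) * (ennreal C * y) = y" "ennreal C * (ennreal (1 / C) * y) = y" for y
      using C(1) by (simp_all add: mult.assoc[symmetric] ennreal_mult[symmetric])
    have "ennreal (1 / C) * ennreal ?S \<le> hausdorff_pre s 1 F"
      unfolding hausdorff_pre_def
    proof (rule INF_greatest)
      fix X :: "nat \<Rightarrow> 'a set" assume "X \<in> {X. (\<forall>i. bounded (X i) \<and> diameter (X i) \<le> 1) \<and> F \<subseteq> (\<Union>i. X i)}"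
      then have "\<And>i. bounded (X i)" "F \<subseteq> (\<Union>i. X i)" by auto
      then have "ennreal ?S \<le> ennreal C * (\<Sum>i. diam_power s (X i))"
        using main[OF r(1,2), of X] r(3) by blast
      then have "ennreal (1 / C) * ennreal ?S \<le> ennreal (1 / C) * (ennreal C * (\<Sum>i. diam_power s (X i)))"
        by (rule mult_left_mono) simp
      then show "ennreal (1 / C) * ennreal ?S \<le> (\<Sum>i. diam_power s (X i))" unfolding inv .
    qed
    then have "ennreal C * (ennreal (1 / C) * ennreal ?S) \<le> ennreal C * hausdorff_pre s 1 F"
      by (rule mult_left_mono) simp
    then have "ennreal ?S \<le> ennreal C * hausdorff_pre s 1 F" unfolding inv .
    also have "\<dots> \<le> ennreal C * hausdorff_outer s F"
      by (intro mult_left_mono hausdorff_pre_le_outer) auto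
    finally show "ennreal (\<Sum>w\<in>V. wratio w powr s) \<le> ennreal C * hausdorff_outer s F" .
  qed
qed

text \<open>The summand 1 keeps this at least 1 even if K is a single point.\<close>

definition diamK :: real where "diamK = diameter K + 1"

lemma diamK: "1 \<le> diamK" "x \<in> K \<Longrightarrow> y \<in> K \<Longrightarrow> dist x y \<le> diamK"
  using diameter_ge_0[of K] diameter_bounded_bound[of K x y] compact_imp_bounded[OF K(1)]
  by (auto simp: diamK_def)

text \<open>Against exponent t the sums at scale r carry an extra factor of order r powr (t - t0),
  which tends to 0; boundedness at t0 is therefore enough. The exponent t0 may be negative.\<close>

lemma hausdorff_outer_zero_cover:
  fixes r :: "nat \<Rightarrow> real"
  assumes t: "0 < t" "t0 < t" and V: "\<And>n. V n \<subseteq> cuts (r n)" and r: "\<And>n. 0 < r n" "r \<longlonglongrightarrow> 0"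
    and A: "\<And>n. A \<subseteq> (\<Union>w\<in>V n. wmap w ` K)" and C: "\<And>n. (\<Sum>w\<in>V n. wratio w powr t0) \<le> C"
  shows "hausdorff_outer t A = 0"
proof -
  have C0: "0 \<le> C" using C[of 0] sum_nonneg[of "V 0" "\<lambda>w. wratio w powr t0"] by simp
  have le: "hausdorff_pre t \<delta> A \<le> ennreal (C * diamK powr t * r n powr (t - t0))" if n: "r n * diamK
      \<le> \<delta>" and \<delta>: "0 < \<delta>" for n \<delta>
  proof -
    have diam: "diameter (wmap w ` K) \<le> wratio w * diamK" "bounded (wmap w ` K)" if "w \<in> V n" for w
    proof -
      have w: "set w \<subseteq> \<Lambda>" using that V cuts_set by blast
      show "bounded (wmap w ` K)" using compact_wmap_limit_set[OF w] compact_imp_bounded by blast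
      show "diameter (wmap w ` K) \<le> wratio w * diamK"
      proof (rule diameter_le)
        fix x y assume "x \<in> wmap w ` K" "y \<in> wmap w ` K"
        then obtain a b where "a \<in> K" "b \<in> K" "x = wmap w a" "y = wmap w b" by auto
        then show "norm (x - y) \<le> wratio w * diamK"
          using dist_wmap[OF w, of a b] diamK(2)[of a b] wratio_pos[OF w]
            by (simp add: dist_norm[symmetric] mult_left_mono)
      qed (use K(2) in auto)
    qed
    have fin: "finite (V n)" using V finite_cuts[OF r(1)] finite_subset by blast
    have "hausdorff_pre t \<delta> A \<le> (\<Sum>w\<in>V n. diam_power t (wmap w ` K))"
    proof (rule hausdorff_pre_finite_cover[OF fin _ _ A \<delta>])
      fix w assume w: "w \<in> V n"
      show "bounded (wmap w ` K)" by (rule diam(2)[OF w])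
      have "wratio w * diamK \<le> r n * diamK" using cuts_ratio_le[OF r(1)[of n], of w] V w diamK(1)
        by (intro mult_right_mono) auto
      then show "diameter (wmap w ` K) \<le> \<delta>" using diam(1)[OF w] n by linarith
    qed
    also have "\<dots> \<le> (\<Sum>w\<in>V n. ennreal (wratio w powr t0 * (diamK powr t * r n powr (t - t0))))"
    proof (rule sum_mono)
      fix w assume w: "w \<in> V n"
      have wW: "w \<in> cuts (r n)" using V w by blast
      have "diameter (wmap w ` K) powr t \<le> (wratio w * diamK) powr t"
        using diam[OF w] diameter_ge_0 t(1) by (intro powr_mono2) auto
      also have "\<dots> = wratio w powr t0 * (diamK powr t * wratio w powr (t - t0))"
        using cuts_ratio_pos[OF wW] diamK(1) by (simp add: powr_mult powr_add[symmetric] mult_ac)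
      also have "\<dots> \<le> wratio w powr t0 * (diamK powr t * r n powr (t - t0))"
        using cuts_ratio_pos[OF wW] cuts_ratio_le[OF r(1) wW] t(2) by (intro mult_left_mono powr_mono2) auto
      finally show "diam_power t (wmap w ` K) \<le> ennreal (wratio w powr t0 * (diamK powr t
          * r n powr (t - t0)))"
        using t(1) by (auto simp: diam_power_def intro: ennreal_leI)
    qed
    also have "\<dots> = ennreal ((\<Sum>w\<in>V n. wratio w powr t0) * (diamK powr t * r n powr (t - t0)))"
      unfolding sum_distrib_right by (rule sum_ennreal) auto
    also have "\<dots> \<le> ennreal (C * diamK powr t * r n powr (t - t0))"
      using C[of n] by (intro ennreal_leI) (simp add: mult.assoc mult_right_mono)
    finally show ?thesis .
  qed
  have "hausdorff_pre t \<delta> A = 0" if \<delta>: "0 < \<delta>" for \<delta>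
  proof -
    have "(\<lambda>n. r n powr (t - t0)) \<longlonglongrightarrow> 0 powr (t - t0)"
      using r t by (intro tendsto_powr' tendsto_const) (auto simp: less_imp_le)
    then have "(\<lambda>n. C * diamK powr t * r n powr (t - t0)) \<longlonglongrightarrow> C * diamK powr t * 0"
      by (intro tendsto_mult tendsto_const) simp
    then have lim: "(\<lambda>n. ennreal (C * diamK powr t * r n powr (t - t0))) \<longlonglongrightarrow> 0"
      using tendsto_ennrealI by fastforce
    have "(\<lambda>n. r n * diamK) \<longlonglongrightarrow> 0 * diamK" by (intro tendsto_mult r tendsto_const)
    then have "\<forall>\<^sub>F n in sequentially. r n * diamK < \<delta>" using \<delta> by (auto dest: order_tendstoD)
    then have "\<forall>\<^sub>F n in sequentially. hausdorff_pre t \<delta> A \<le> ennreal (C * diamK powr t * r n powr (t - t0))"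
      by eventually_elim (use le \<delta> in auto)
    then have "hausdorff_pre t \<delta> A \<le> 0" by (rule tendsto_lowerbound[OF lim]) simp
    then show ?thesis by simp
  qed
  then show ?thesis unfolding hausdorff_outer_def by (simp add: SUP_constant)
qed

text \<open>The total weight is 1 at every scale. With \<open>mass_distribution\<close> this bounds
  the s-dimensional measure of K from below, and through the covers by pieces it makes every larger
  exponent null.\<close>

lemma hausdorff_dim_K: "hausdorff_dim K = ereal s"
proof (rule antisym)
  obtain C where C: "1 \<le> C"
    "\<And>r V F. 0 < r \<Longrightarrow> V \<subseteq> cuts r \<Longrightarrow> (\<And>w. w \<in> V \<Longrightarrow> wmap w ` K \<subseteq> F) \<Longrightarrow>
       ennreal (\<Sum>w\<in>V. wratio w powr s) \<le> ennreal C * hausdorff_outer s F"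
    using mass_distribution by blast
  have "ennreal (\<Sum>w\<in>cuts 1. wratio w powr s) \<le> ennreal C * hausdorff_outer s K"
    by (intro C(2)) (use wmap_limit_set cuts_set in auto)
  then have "hausdorff_outer s K \<noteq> 0" using sum_cuts[of 1] by auto
  then show "ereal s \<le> hausdorff_dim K" by (rule hausdorff_dim_ge)
  show "hausdorff_dim K \<le> ereal s"
  proof (rule ereal_le_epsilon2)
    fix e :: real assume e: "0 < e"
    have "hausdorff_outer (s + e) K = 0"
    proof (rule hausdorff_outer_zero_cover[where V = "\<lambda>n. cuts ((1/2) ^ n)" and r
        = "\<lambda>n. (1/2) ^ n" and ?t0.0 = s and C = 1])
      show "(\<lambda>n. (1 / 2 :: real) ^ n) \<longlonglongrightarrow> 0" by (rule LIMSEQ_power_zero) simp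
      show "K \<subseteq> (\<Union>w\<in>cuts ((1/2) ^ n). wmap w ` K)" for n using limit_set_cuts[of "(1/2) ^ n"] by simp
      show "(\<Sum>w\<in>cuts ((1/2) ^ n). wratio w powr s) \<le> 1" for n using sum_cuts[of "(1/2) ^ n"] by simp
    qed (use e s in auto)
    then show "hausdorff_dim K \<le> ereal s + ereal e" using hausdorff_dim_le[of "s + e" K] e s by simp
  qed
qed

end

section \<open>Similarity dimension and the decay exponents\<close>

lemma similarity_dimension_exists:
  assumes "finite \<Lambda>" "\<Lambda> \<noteq> {}" "\<And>i. i \<in> \<Lambda> \<Longrightarrow> 0 < \<rho> i \<and> \<rho> i < (1::real)"
  obtains s where "0 \<le> s" "(\<Sum>i\<in>\<Lambda>. \<rho> i powr s) = 1"
proof -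
  let ?f = "\<lambda>t. \<Sum>i\<in>\<Lambda>. \<rho> i powr t"
  have "((\<lambda>t. \<Sum>i\<in>\<Lambda>. \<rho> i powr t) \<longlongrightarrow> (\<Sum>i\<in>\<Lambda>. 0)) at_top"
  proof (intro tendsto_sum)
    fix i assume "i \<in> \<Lambda>"
    then have i: "0 < \<rho> i" "\<rho> i < 1" using assms by auto
    have "((\<lambda>t. exp (t * ln (\<rho> i))) \<longlongrightarrow> 0) at_top"
    proof (rule filterlim_compose[OF exp_at_bot])
      show "filterlim (\<lambda>t. t * ln (\<rho> i)) at_bot at_top"
        unfolding mult.commute[of _ "ln (\<rho> i)"]
        using i by (intro filterlim_tendsto_neg_mult_at_bot[OF tendsto_const _ filterlim_ident]) (auto
            simp: ln_less_zero)
    qed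
    then show "((\<lambda>t. \<rho> i powr t) \<longlongrightarrow> 0) at_top" using i by (simp add: powr_def)
  qed
  then have "\<forall>\<^sub>F t in at_top. ?f t < 1" by (rule order_tendstoD(2)) simp
  then have "\<forall>\<^sub>F t in at_top. ?f t < 1 \<and> 0 \<le> t" using eventually_ge_at_top[of 0] by eventually_elim auto
  then obtain t where t: "?f t < 1" "0 \<le> t" by (auto simp: eventually_at_top_linorder)
  have nz: "\<rho> i \<noteq> 0" if "i \<in> \<Lambda>" for i using assms(3)[OF that] by simp
  have f0: "?f 0 \<ge> 1"
  proof -
    have "?f 0 = (\<Sum>i\<in>\<Lambda>. 1)" by (rule sum.cong) (use nz in auto)
    then show ?thesis using assms by (simp add: Suc_leI card_gt_0_iff)
  qed
  have "continuous_on {0..t} ?f"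
    by (intro continuous_on_sum continuous_on_powr continuous_on_const continuous_on_id) (use nz in auto)
  then obtain s where "0 \<le> s" "s \<le> t" "?f s = 1" using IVT2'[of ?f t 1 0] t f0 by auto
  then show ?thesis by (intro that)
qed

text \<open>As ln \<epsilon> is negative, a lower bound for the quotient is an upper bound for the
  measure. An infinite supremum would make the quotient -\<infinity>, and a zero supremum satisfies
  the conclusion at once.\<close>

lemma alpha_gt_imp:
  fixes \<mu> :: "'a::euclidean_space measure"
  assumes "ereal \<beta> < alpha l \<mu>"
  obtains \<epsilon>0 where "0 < \<epsilon>0" "\<And>\<epsilon> L. 0 < \<epsilon> \<Longrightarrow> \<epsilon> < \<epsilon>0 \<Longrightarrow> L \<in> affine_subspaces (DIM('a) - l) \<Longrightarrow>
     emeasure \<mu> (open_nbhd \<epsilon> L) \<le> ennreal (\<epsilon> powr \<beta>)"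
proof -
  let ?S = "\<lambda>\<epsilon>. SUP L\<in>affine_subspaces (DIM('a) - l). emeasure \<mu> (open_nbhd \<epsilon> L)"
  have "\<forall>\<^sub>F \<epsilon> in at_right 0. ereal \<beta> < ln_ennreal (?S \<epsilon>) / ereal (ln \<epsilon>)"
    using le_Liminf_iff[THEN iffD1, OF order_refl, rule_format, OF assms[unfolded alpha_def]] .
  then obtain b where b: "b > 0" "\<And>\<epsilon>. 0 < \<epsilon> \<Longrightarrow> \<epsilon> < b \<Longrightarrow> ereal \<beta> < ln_ennreal (?S \<epsilon>) / ereal (ln \<epsilon>)"
    by (auto simp: eventually_at_right_field)
  show ?thesis
  proof (rule that[of "min b 1"])
    show "0 < min b 1" using b by simp
    fix \<epsilon> :: real and L :: "'a set" assume e: "0 < \<epsilon>"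
      "\<epsilon> < min b 1" and L: "L \<in> affine_subspaces (DIM('a) - l)"
    have ln: "ln \<epsilon> < 0" using e by simp
    have le: "emeasure \<mu> (open_nbhd \<epsilon> L) \<le> ?S \<epsilon>" by (rule SUP_upper[OF L])
    have lt: "ereal \<beta> < ln_ennreal (?S \<epsilon>) / ereal (ln \<epsilon>)" using b(2) e by simp
    have "?S \<epsilon> \<le> ennreal (\<epsilon> powr \<beta>)"
    proof (cases "?S \<epsilon> = 0")
      case False
      have "?S \<epsilon> \<noteq> \<infinity>"
      proof
        assume inf: "?S \<epsilon> = \<infinity>"
        have "ln_ennreal (?S \<epsilon>) / ereal (ln \<epsilon>) = \<infinity> / ereal (ln \<epsilon>)" unfolding inf
          by (simp add: ln_ennreal_def)
        also have "\<dots> = -\<infinity>" using ln by (simp add: divide_ereal_def)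
        finally show False using lt by simp
      qed
      then obtain q where q: "?S \<epsilon> = ennreal q" "0 \<le> q" by (cases "?S \<epsilon>") auto
      then have q0: "0 < q" using False by (cases "q = 0") auto
      have "ln_ennreal (?S \<epsilon>) = ereal (ln q)" using q q0 by (simp add: ln_ennreal_def)
      then have "\<beta> < ln q / ln \<epsilon>" using lt ln by (simp split: if_splits)
      then have "ln q < \<beta> * ln \<epsilon>" using ln by (simp add: field_simps)
      then have "exp (ln q) < exp (\<beta> * ln \<epsilon>)" by (simp only: exp_less_cancel_iff)
      then have "q < exp (\<beta> * ln \<epsilon>)" using q0 by simp
      then have "q \<le> \<epsilon> powr \<beta>" using e by (simp add: powr_def)
      then show ?thesis unfolding q(1) by (rule ennreal_leI)
    qed simp
    then show "emeasure \<mu> (open_nbhd \<epsilon> L) \<le> ennreal (\<epsilon> powr \<beta>)" by (rule order_trans[OF le])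
  qed
qed

context self_similar
begin

lemma emeasure_nbhd: "emeasure (hausdorff_measure_on s K) (open_nbhd \<epsilon> L)
    = hausdorff_outer s (open_nbhd \<epsilon> L \<inter> K)"
  by (rule emeasure_hausdorff_measure_on) (auto intro: borel_open open_nbhd_open borel_compact K)

text \<open>A word whose marked point is within \<tau> of A has its whole piece near A, because r is
  at most \<tau>; \<open>mass_distribution\<close> then turns decay of the measure into decay of the
  weights.\<close>

lemma weight_near_affine:
  assumes \<beta>: "ereal \<beta> < alpha l (hausdorff_measure_on s K)" "0 \<le> \<beta>" and x: "x \<in> K"
  obtains C where "1 \<le> C"
    "\<And>r \<tau> A. 0 < r \<Longrightarrow> r \<le> \<tau> \<Longrightarrow> A \<in> affine_subspaces (DIM('a) - l) \<Longrightarrow>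
       (\<Sum>w | w \<in> cuts r \<and> infdist (wmap w x) A \<le> \<tau>. wratio w powr s) \<le> C * \<tau> powr \<beta>"
proof -
  obtain \<epsilon>0 where \<epsilon>0: "0 < \<epsilon>0" "\<And>\<epsilon> L. 0 < \<epsilon> \<Longrightarrow> \<epsilon> < \<epsilon>0 \<Longrightarrow> L \<in> affine_subspaces (DIM('a) - l) \<Longrightarrow>
     emeasure (hausdorff_measure_on s K) (open_nbhd \<epsilon> L) \<le> ennreal (\<epsilon> powr \<beta>)"
    using alpha_gt_imp[OF \<beta>(1)] by blast
  obtain C1 where C1: "1 \<le> C1"
    "\<And>r V F. 0 < r \<Longrightarrow> V \<subseteq> cuts r \<Longrightarrow> (\<And>w. w \<in> V \<Longrightarrow> wmap w ` K \<subseteq> F) \<Longrightarrow>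
       ennreal (\<Sum>w\<in>V. wratio w powr s) \<le> ennreal C1 * hausdorff_outer s F"
    using mass_distribution by blast
  \<comment> \<open>The summand 2 leaves room for the strict inequality in the open neighbourhood,
    and \<open>diamK\<close> pays for the size of a piece.\<close>
  define k where "k = 2 + diamK"
  have k: "k > 0" using diamK(1) by (simp add: k_def)
  \<comment> \<open>The last entry handles neighbourhoods too wide for \<open>\<epsilon>0\<close>,
    where the total weight 1 serves as the bound.\<close>
  define C where "C = max 1 (max (C1 * k powr \<beta>) ((k / \<epsilon>0) powr \<beta>))"
  show ?thesis
  proof (rule that[of C])
    show "1 \<le> C" by (simp add: C_def)
    fix r \<tau> :: real and A :: "'a set" assume r: "0 < r" "r \<le> \<tau>" and A: "A \<in> affine_subspaces (DIM('a) - l)"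
    let ?V = "{w. w \<in> cuts r \<and> infdist (wmap w x) A \<le> \<tau>}"
    define \<epsilon> where "\<epsilon> = \<tau> * k"
    have \<epsilon>: "\<epsilon> > 0" using r k by (simp add: \<epsilon>_def)
    have "(\<Sum>w\<in>?V. wratio w powr s) \<le> max (C1 * k powr \<beta>) ((k / \<epsilon>0) powr \<beta>) * \<tau> powr \<beta>"
    proof (cases "\<epsilon> < \<epsilon>0")
      case True
      have Ane: "A \<noteq> {}" and Acl: "closed A" using A by (auto simp: affine_subspaces_def affine_closed)
      have "ennreal (\<Sum>w\<in>?V. wratio w powr s) \<le> ennreal C1 * hausdorff_outer s (open_nbhd \<epsilon> A \<inter> K)"
      proof (rule C1(2)[OF r(1)])
        fix w assume w: "w \<in> ?V"
        then have wW: "w \<in> cuts r" and wL: "set w \<subseteq> \<Lambda>" using cuts_set by auto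
        show "wmap w ` K \<subseteq> open_nbhd \<epsilon> A \<inter> K"
        proof
          fix y assume y: "y \<in> wmap w ` K"
          then have yK: "y \<in> K" using wmap_limit_set[OF wL] by blast
          obtain z where z: "z \<in> K" "y = wmap w z" using y by blast
          have "infdist (wmap w x) A < 2 * \<tau>" using w r by auto
          moreover obtain a where "a \<in> A" "infdist (wmap w x) A = dist (wmap w x) a"
            using infdist_attains_inf[OF Acl Ane] by blast
          ultimately have a: "a \<in> A" "dist (wmap w x) a < 2 * \<tau>" by auto
          have "dist y (wmap w x) = wratio w * dist z x" using z dist_wmap[OF wL] by simp
          also have "\<dots> \<le> \<tau> * diamK" using cuts_ratio_le[OF r(1) wW] cuts_ratio_pos[OF wW] diamK(2)[OF
              z(1) x] r by (intro mult_mono) auto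
          finally have "dist y a < \<epsilon>" using a(2) dist_triangle[of y a "wmap w x"]
            by (simp add: \<epsilon>_def k_def algebra_simps)
          then show "y \<in> open_nbhd \<epsilon> A \<inter> K" using a(1) yK by (auto simp: open_nbhd_def dist_commute)
        qed
      qed auto
      also have "\<dots> \<le> ennreal C1 * ennreal (\<epsilon> powr \<beta>)"
        unfolding emeasure_nbhd[symmetric] by (intro mult_left_mono \<epsilon>0(2) \<epsilon> True A) simp
      also have "\<dots> = ennreal (C1 * \<epsilon> powr \<beta>)" using C1(1) by (simp add: ennreal_mult)
      finally have "(\<Sum>w\<in>?V. wratio w powr s) \<le> C1 * \<epsilon> powr \<beta>"
        using C1(1) by (subst (asm) ennreal_le_iff) auto
      also have "\<dots> = C1 * k powr \<beta> * \<tau> powr \<beta>" using r k by (simp add: \<epsilon>_def powr_mult mult_ac)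
      finally show ?thesis by (rule order_trans) (intro mult_right_mono, auto)
    next
      case False
      have "(\<Sum>w\<in>?V. wratio w powr s) \<le> (\<Sum>w\<in>cuts r. wratio w powr s)"
        using finite_cuts[OF r(1)] by (intro sum_mono2) auto
      also have "\<dots> = 1" by (rule sum_cuts[OF r(1)])
      also have "1 \<le> (\<epsilon> / \<epsilon>0) powr \<beta>" using False \<epsilon>0(1) \<beta>(2)
        by (intro ge_one_powr_ge_zero) (auto simp: field_simps)
      also have "\<dots> = (k / \<epsilon>0) powr \<beta> * \<tau> powr \<beta>"
        using r k \<epsilon>0(1) by (simp add: \<epsilon>_def powr_mult[symmetric] mult_ac)
      finally show ?thesis by (rule order_trans) (intro mult_right_mono, auto)
    qed
    also have "\<dots> \<le> C * \<tau> powr \<beta>" by (intro mult_right_mono) (auto simp: C_def)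
    finally show "(\<Sum>w | w \<in> cuts r \<and> infdist (wmap w x) A \<le> \<tau>. wratio w powr s) \<le> C * \<tau> powr \<beta>" .
  qed
qed

text \<open>One cut word has weight of order \<open>r powr s\<close> and its marked point is itself
  a 0-dimensional subspace, so no exponent above s can bound the weights near points. In the theorem
  this keeps the minimum at most s / (d + 1).\<close>

lemma alpha_DIM_le: "alpha DIM('a) (hausdorff_measure_on s K) \<le> ereal s"
proof (rule ccontr)
  assume "\<not> ?thesis"
  then obtain \<beta> where \<beta>: "ereal s < ereal \<beta>" "ereal \<beta> < alpha DIM('a) (hausdorff_measure_on s K)"
    using ereal_dense2[of "ereal s" "alpha DIM('a) (hausdorff_measure_on s K)"] by (auto simp: not_le)
  then have s\<beta>: "s < \<beta>" and \<beta>0: "0 \<le> \<beta>" using s(1) by simp_all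
  obtain x where x: "x \<in> K" using K(2) by blast
  obtain C where C: "1 \<le> C"
    "\<And>r \<tau> A. 0 < r \<Longrightarrow> r \<le> \<tau> \<Longrightarrow> A \<in> affine_subspaces (DIM('a) - DIM('a)) \<Longrightarrow>
       (\<Sum>w | w \<in> cuts r \<and> infdist (wmap w x) A \<le> \<tau>. wratio w powr s) \<le> C * \<tau> powr \<beta>"
    using weight_near_affine[OF \<beta>(2) \<beta>0 x] by blast
  have le: "rmin powr s \<le> C * r powr (\<beta> - s)" if r: "0 < r" "r \<le> 1" for r
  proof -
    have "cuts r \<noteq> {}" using sum_cuts[OF r(1)] by auto
    then obtain w where w: "w \<in> cuts r" by blast
    have A: "{wmap w x} \<in> affine_subspaces (DIM('a) - DIM('a))" by (simp add: affine_subspaces_def)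
    have "(rmin * r) powr s \<le> wratio w powr s" using cuts_ratio_ge[OF r w] rmin(1) r s(1)
      by (intro powr_mono2) auto
    also have "\<dots> \<le> (\<Sum>v | v \<in> cuts r \<and> infdist (wmap v x) {wmap w x} \<le> r. wratio v powr s)"
      using w r finite_cuts[OF r(1)] by (intro member_le_sum) auto
    also have "\<dots> \<le> C * r powr \<beta>" by (rule C(2)[OF r(1) order_refl A])
    also have "r powr \<beta> = r powr (\<beta> - s) * r powr s" using r by (simp add: powr_add[symmetric])
    finally have "rmin powr s * r powr s \<le> C * r powr (\<beta> - s) * r powr s" using rmin(1) r
      by (simp add: powr_mult mult_ac)
    then show ?thesis using r by (simp add: mult_le_cancel_right)
  qed
  \<comment> \<open>Small enough for \<open>C * r powr (\<beta> - s)\<close> to be at most half of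
    \<open>rmin powr s\<close>.\<close>
  define r where "r = min 1 ((rmin powr s / (2 * C)) powr (1 / (\<beta> - s)))"
  have q: "rmin powr s / (2 * C) > 0" using rmin(1) C(1) by simp
  have r: "0 < r" "r \<le> 1" using q rmin(1) C(1) by (auto simp: r_def)
  have "r powr (\<beta> - s) \<le> ((rmin powr s / (2 * C)) powr (1 / (\<beta> - s))) powr (\<beta> - s)"
    using r s\<beta> by (intro powr_mono2) (auto simp: r_def)
  also have "\<dots> = rmin powr s / (2 * C)" using s\<beta> q C(1) by (simp add: powr_powr)
  finally have "C * r powr (\<beta> - s) \<le> C * (rmin powr s / (2 * C))" using C(1) by (intro mult_left_mono) auto
  also have "\<dots> = rmin powr s / 2" using C(1) by simp
  finally have "rmin powr s \<le> rmin powr s / 2" using le[OF r] by linarith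
  then show False using rmin(1) by simp
qed

end

section \<open>The height function\<close>

lemma filterlim_power_powr_at_top:
  fixes b :: real assumes "1 < b" "0 < e" shows "filterlim (\<lambda>n. (b ^ n) powr e) at_top sequentially"
proof -
  have "filterlim (\<lambda>n. (b powr e) ^ n) at_top sequentially"
    unfolding filterlim_at_top
  proof
    fix Z
    have a: "1 < b powr e" using assms by (rule gr_one_powr)
    then obtain N where N: "Z < (b powr e) ^ N" using real_arch_pow by blast
    have "Z \<le> (b powr e) ^ n" if "N \<le> n" for n
      using power_increasing[OF that, of "b powr e"] a N by linarith
    then show "\<forall>\<^sub>F n in sequentially. Z \<le> (b powr e) ^ n" by (auto simp: eventually_sequentially)
  qed
  moreover have "(b ^ n) powr e = (b powr e) ^ n" for n
    using assms by (simp add: powr_realpow[symmetric] powr_powr mult.commute)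
  ultimately show ?thesis by simp
qed

text \<open>One direction of Dani's correspondence. If T is the expansion of the first coordinate,
  the second contracts by T powr (-1 / d), and N close to c T balances the two: up to constants the
  flowed q is bounded by c powr (1 / d) and the flowed first coordinate by \<epsilon> / c.\<close>

lemma singular_short_vectors:
  fixes x :: "real ^ 'n"
  assumes x: "x \<in> Sing" and b: "1 < b" and e: "0 < e"
  obtains n0 where "\<And>n. n0 \<le> n \<Longrightarrow> \<exists>v\<in>integer_points. v \<noteq> 0 \<and> norm (flow (b ^ n) x v) \<le> e"
proof -
  let ?d = "real CARD('n)"
  \<comment> \<open>Makes sqrt d * c powr (1 / d) equal to e / 2; the root compares the Euclidean
    norm with the supremum norm.\<close>
  define c where "c = (e / (2 * sqrt ?d)) powr ?d"
  have c: "c > 0" using e by (simp add: c_def)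
  \<comment> \<open>Chosen after \<open>c\<close>, so that 2 \<epsilon> / c is at most e / 2; the
    second entry keeps \<epsilon> below 1.\<close>
  define \<epsilon> where "\<epsilon> = min (c * e / 4) (1 / 2)"
  have \<epsilon>: "0 < \<epsilon>" "\<epsilon> < 1" using c e by (auto simp: \<epsilon>_def min_less_iff_disj)
  obtain N0 :: nat where N0: "\<And>N. N \<ge> N0 \<Longrightarrow> \<exists>(p::int) (q :: int ^ 'n). (p, q) \<noteq> (0, 0) \<and>
           \<bar>of_int_vec q \<bullet> x + of_int p\<bar> \<le> \<epsilon> / real N \<and>
           infnorm (of_int_vec q :: real ^ 'n) \<le> real N powr (1 / ?d)"
    using x \<epsilon> unfolding Sing_def singular_vector_def by blast
  have "\<forall>\<^sub>F n in sequentially. max (2 / c) ((real N0 + 1) / c) \<le> (b ^ n) powr (?d / (?d + 1))"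
    using filterlim_power_powr_at_top[OF b, of "?d / (?d + 1)"] unfolding filterlim_at_top
    by (auto simp del: max.bounded_iff)
  then obtain n0 where n0: "\<And>n. n0 \<le> n \<Longrightarrow> max (2 / c) ((real N0 + 1) / c) \<le> (b ^ n) powr (?d / (?d + 1))"
    by (auto simp: eventually_sequentially)
  show ?thesis
  proof (rule that)
    fix n assume n: "n0 \<le> n"
    define y where "y = b ^ n"
    define T where "T = y powr (?d / (?d + 1))"
    have y: "y > 0" using b by (simp add: y_def)
    have T: "T > 0" "2 / c \<le> T" "(real N0 + 1) / c \<le> T"
      using n0[OF n] b unfolding T_def y_def by auto
    have Td: "y powr (- 1 / (?d + 1)) = T powr (- 1 / ?d)"
      unfolding T_def by (simp add: powr_powr)
    \<comment> \<open>Rounding down costs at most a factor 2, because c * T will be at least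
      2.\<close>
    define N where "N = nat \<lfloor>c * T\<rfloor>"
    have cT: "2 \<le> c * T" "real N0 + 1 \<le> c * T" using T c by (auto simp: field_simps)
    have N: "real N \<le> c * T" "c * T / 2 \<le> real N" "N0 \<le> N"
      unfolding N_def using cT by linarith+
    obtain p q where pq: "(p, q) \<noteq> (0, 0)" "\<bar>of_int_vec q \<bullet> x + of_int p\<bar> \<le> \<epsilon> / real N"
      "infnorm (of_int_vec q :: real ^ 'n) \<le> real N powr (1 / ?d)" using N0[OF N(3)] by blast
    let ?v = "(of_int p, of_int_vec q) :: real \<times> (real ^ 'n)"
    have "norm (flow y x ?v) \<le> norm (T * (of_int p + of_int_vec q \<bullet> x))
        + norm (T powr (- 1 / ?d) *\<^sub>R (of_int_vec q :: real ^ 'n))"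
      unfolding flow_def T_def[symmetric] Td by (simp only: prod.case) (rule norm_Pair_le)
    also have "norm (T * (of_int p + of_int_vec q \<bullet> x)) \<le> e / 2"
    proof -
      have "norm (T * (of_int p + of_int_vec q \<bullet> x)) = T * \<bar>of_int_vec q \<bullet> x + of_int p\<bar>"
        using T by (simp add: abs_mult add.commute)
      also have "\<dots> \<le> T * (\<epsilon> / real N)" using pq(2) T by (intro mult_left_mono) auto
      also have "\<dots> \<le> T * (\<epsilon> / (c * T / 2))"
        using N cT \<epsilon> T by (intro mult_left_mono divide_left_mono) auto
      also have "\<dots> = 2 * \<epsilon> / c" using T c by (simp add: field_simps)
      also have "\<dots> \<le> e / 2" using c unfolding \<epsilon>_def by (simp add: field_simps)
      finally show ?thesis .
    qed
    also have "norm (T powr (- 1 / ?d) *\<^sub>R (of_int_vec q :: real ^ 'n)) \<le> e / 2"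
    proof -
      have "norm (of_int_vec q :: real ^ 'n) \<le> sqrt ?d * infnorm (of_int_vec q :: real ^ 'n)"
        using norm_le_infnorm[of "of_int_vec q :: real ^ 'n"] by simp
      also have "\<dots> \<le> sqrt ?d * (c * T) powr (1 / ?d)"
        using pq(3) powr_mono2[OF _ _ N(1), of "1 / ?d"] by (intro mult_left_mono) auto
      also have "(c * T) powr (1 / ?d) = c powr (1 / ?d) * T powr (1 / ?d)"
        using c T by (simp add: powr_mult)
      also have "c powr (1 / ?d) = e / (2 * sqrt ?d)"
        unfolding c_def using e by (simp add: powr_powr)
      finally have "norm (of_int_vec q :: real ^ 'n) \<le> e / 2 * T powr (1 / ?d)" by simp
      then have "T powr (- 1 / ?d) * norm (of_int_vec q :: real ^ 'n)
          \<le> T powr (- 1 / ?d) * (e / 2 * T powr (1 / ?d))"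
        by (intro mult_left_mono) auto
      also have "\<dots> = e / 2" using T by (simp add: powr_minus_divide)
      finally show ?thesis by simp
    qed
    finally have "norm (flow y x ?v) \<le> e" by simp
    moreover have "?v \<in> integer_points" by (auto simp: integer_points_def)
    moreover have "?v \<noteq> 0" using pq(1) by (auto simp: zero_prod_def)
    ultimately show "\<exists>v\<in>integer_points. v \<noteq> 0 \<and> norm (flow (b ^ n) x v) \<le> e" unfolding y_def by blast
  qed
qed

text \<open>
  The exponents \<open>\<delta> / (D - k)\<close>, \<open>D = CARD('n) + 1\<close>, would equalize the contraction rates over all ranks \<open>k\<close>;
  \<open>\<eta>\<close> perturbs them so that their inverses become strictly concave in the rank.
\<close>

locale lattice_height =
  fixes n_type :: "'n::finite itself" and \<delta> \<eta> :: real
  assumes \<delta>: "0 < \<delta>" and \<eta>: "0 < \<eta>"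
begin

text \<open>Vanishes at full rank, where \<open>lattice_density_UNIV\<close> bounds the density
  outright; thus the concavity argument also covers two subspaces whose sum is the whole
  space.\<close>

definition rank_wt :: "nat \<Rightarrow> real" where
  "rank_wt k = (real CARD('n) + 1 - real k) * (1 + \<eta> * real k)"

definition expo :: "nat \<Rightarrow> real" where "expo k = \<delta> / rank_wt k"

definition proper_subs :: "(real \<times> (real ^ 'n)) set set" where
  "proper_subs = {S. rational_subspace S \<and> 1 \<le> dim S \<and> dim S \<le> CARD('n)}"

definition height :: "real \<Rightarrow> real ^ 'n \<Rightarrow> real" where
  "height y x = (SUP S\<in>proper_subs. lattice_density y x S powr expo (dim S))"

text \<open>The supremum need not be attained, hence the factor q. In \<open>height_step\<close> it
  is taken larger than anything a subspace can gain in one step.\<close>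

definition near_max :: "real \<Rightarrow> real \<Rightarrow> real ^ 'n \<Rightarrow> (real \<times> (real ^ 'n)) set set" where
  "near_max q y x = {S \<in> proper_subs. height y x \<le> q * lattice_density y x S powr expo (dim S)}"

lemma rank_wt_nonneg: "k \<le> CARD('n) + 1 \<Longrightarrow> 0 \<le> rank_wt k"
  unfolding rank_wt_def using \<eta> by (intro mult_nonneg_nonneg) auto

lemma rank_wt_ge1: "k \<le> CARD('n) \<Longrightarrow> 1 \<le> rank_wt k"
proof -
  assume "k \<le> CARD('n)"
  then have "1 * 1 \<le> (real CARD('n) + 1 - real k) * (1 + \<eta> * real k)" using \<eta> by (intro mult_mono) auto
  then show ?thesis by (simp add: rank_wt_def)
qed

lemma expo: "k \<le> CARD('n) \<Longrightarrow> 0 < expo k" "k \<le> CARD('n) \<Longrightarrow> expo k \<le> \<delta>"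
proof -
  assume "k \<le> CARD('n)"
  then have w: "1 \<le> rank_wt k" by (rule rank_wt_ge1)
  then show "0 < expo k" using \<delta> by (simp add: expo_def)
  have "\<delta> / rank_wt k \<le> \<delta> / 1" using w \<delta> by (intro divide_left_mono) auto
  then show "expo k \<le> \<delta>" by (simp add: expo_def)
qed

lemma proper_subs_dim: "S \<in> proper_subs \<Longrightarrow> dim S \<le> CARD('n)" "S \<in> proper_subs \<Longrightarrow>
  rational_subspace S" "S \<in> proper_subs \<Longrightarrow> 1 \<le> dim S"
  by (auto simp: proper_subs_def)

lemma line_in_proper_subs: "v \<in> integer_points \<Longrightarrow> v \<noteq> 0 \<Longrightarrow> span {v} \<in> proper_subs" "v \<noteq> 0 \<Longrightarrow>
  dim (span {v :: real \<times> (real ^ 'n)}) = 1"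
  by (auto simp: proper_subs_def rational_subspace_line Suc_leI)

lemma proper_subs_nonempty: "proper_subs \<noteq> {}"
proof -
  have "(1, 0) \<in> (integer_points :: (real \<times> (real ^ 'n)) set)"
    unfolding integer_points_def by (auto intro!: exI[of _ 1] exI[of _ 0])
  moreover have "(1, 0 :: real ^ 'n) \<noteq> (0 :: real \<times> (real ^ 'n))" by (simp add: zero_prod_def)
  ultimately show ?thesis using line_in_proper_subs(1) by blast
qed

lemma height_bdd: assumes "0 < y" shows "bdd_above ((\<lambda>S. lattice_density y x S powr expo (dim S)) `
    proper_subs)"
proof -
  obtain N where N: "1 \<le> N" "\<And>S. rational_subspace S \<Longrightarrow> lattice_density y x S \<le> N"
    using lattice_density_bdd[OF assms, of x] by blast
  show ?thesis
  proof (rule bdd_aboveI2)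
    fix S assume S: "S \<in> proper_subs"
    have "lattice_density y x S powr expo (dim S) \<le> N powr expo (dim S)"
      using expo(1)[of "dim S"] S N(2) by (intro powr_mono2 lattice_density_nonneg) (auto simp:
          proper_subs_def)
    also have "\<dots> \<le> N powr \<delta>" using expo(2)[of "dim S"] S N(1)
      by (intro powr_mono) (auto simp: proper_subs_def)
    finally show "lattice_density y x S powr expo (dim S) \<le> N powr \<delta>" .
  qed
qed

lemma height_upper: "0 < y \<Longrightarrow> S \<in> proper_subs \<Longrightarrow> lattice_density y x S powr expo (dim S) \<le> height y x"
  unfolding height_def by (rule cSUP_upper[OF _ height_bdd])

lemma height_least: "(\<And>S. S \<in> proper_subs \<Longrightarrow> lattice_density y x S powr expo (dim S) \<le> c) \<Longrightarrow> height y x \<le> c"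
  unfolding height_def by (rule cSUP_least[OF proper_subs_nonempty])

lemma height_nonneg: "0 < y \<Longrightarrow> 0 \<le> height y x"
  using proper_subs_nonempty height_upper powr_ge_zero order_trans by blast

lemma lattice_density_le_height:
  assumes "0 < y" "S \<in> proper_subs" shows "lattice_density y x S \<le> height y x powr (rank_wt (dim S) / \<delta>)"
proof -
  have w: "rank_wt (dim S) \<ge> 1" using assms(2) by (intro rank_wt_ge1) (auto simp: proper_subs_def)
  have "(lattice_density y x S powr expo (dim S)) powr (rank_wt (dim S) / \<delta>)
      \<le> height y x powr (rank_wt (dim S) / \<delta>)"
    using w \<delta> assms by (intro powr_mono2 height_upper) auto
  moreover have "expo (dim S) * (rank_wt (dim S) / \<delta>) = 1" using w \<delta> by (simp add: expo_def)
  ultimately show ?thesis using lattice_density_nonneg[of y x S] by (simp add: powr_powr)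
qed

text \<open>The linear part of \<open>rank_wt\<close> cancels in the second difference; the
  quadratic part -\<eta> k^2 leaves 2 \<eta> t^2, and t is at least 1 by integrality.\<close>

lemma rank_wt_concave:
  assumes "c < a" "c + e = 2 * a" shows "2 * \<eta> \<le> 2 * rank_wt a - rank_wt c - rank_wt e"
proof -
  define t where "t = real a - real c"
  have t: "t \<ge> 1" using assms(1) by (auto simp: t_def)
  have e: "real e = real a + t" "real c = real a - t" using assms(2) unfolding t_def by linarith+
  have "2 * rank_wt a - rank_wt c - rank_wt e = 2 * \<eta> * t\<^sup>2"
    unfolding rank_wt_def e by (simp add: algebra_simps power2_eq_square)
  moreover have "1 \<le> t\<^sup>2" using t by (simp add: one_le_power)
  then have "2 * \<eta> * 1 \<le> 2 * \<eta> * t\<^sup>2" using \<eta> by (intro mult_left_mono) auto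
  ultimately show ?thesis by simp
qed

text \<open>
  If two subspaces of the same rank came near the supremum, submodularity and strict concavity would make
  their sum or their intersection beat it.
\<close>

lemma near_max_unique:
  assumes q: "1 \<le> q"
  obtains M where "1 \<le> M"
    "\<And>y x S1 S2. 1 \<le> y \<Longrightarrow> M \<le> height y x \<Longrightarrow> S1 \<in> near_max q y x \<Longrightarrow> S2 \<in> near_max q y x \<Longrightarrow> dim S1 = dim S2 \<Longrightarrow>
      S1 = S2"
proof -
  define C where "C = (4 * real CARD('n) + 8) ^ (2 * CARD('n) + 2)"
  \<comment> \<open>An upper bound for the rank weights, to make the power of q uniform in the
    rank.\<close>
  define G where "G = (real CARD('n) + 1) * (1 + \<eta> * (real CARD('n) + 1))"
  define P where "P = C * 3 ^ (CARD('n) + 1) * q powr (2 * G / \<delta>)"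
  \<comment> \<open>Chosen so that \<open>M powr (2 * \<eta> / \<delta>)\<close> is P + 1, whereas
    two competitors of one rank force the height to this power to be at most P.\<close>
  define M where "M = (P + 1) powr (\<delta> / (2 * \<eta>))"
  have C1: "C \<ge> 1" unfolding C_def by (rule one_le_power) simp
  have P0: "P \<ge> 0" unfolding P_def using C1 by simp
  show ?thesis
  proof (rule that[of M])
    show M1: "1 \<le> M" unfolding M_def using P0 \<delta> \<eta> by (intro ge_one_powr_ge_zero) auto
    fix y x S1 S2
    assume y: "1 \<le> y" and M: "M \<le> height y x" and S: "S1 \<in> near_max q y x" "S2 \<in> near_max q y x"
      "dim S1 = dim S2"
    show "S1 = S2"
    proof (rule ccontr)
      assume ne: "S1 \<noteq> S2"
      let ?F = "height y x" and ?a = "dim S1"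
      have y0: "0 < y" using y by simp
      have F1: "1 \<le> ?F" using M M1 by simp
      have low: "0 < lattice_density y x T \<and> (?F / q) powr (rank_wt ?a / \<delta>) \<le> lattice_density y x T"
        if T: "T \<in> near_max q y x" "dim T = ?a" for T
      proof -
        have w: "rank_wt ?a \<ge> 1" using T by (intro rank_wt_ge1) (auto simp: near_max_def proper_subs_def)
        have le: "?F / q \<le> lattice_density y x T powr expo ?a" using T q
          by (simp add: near_max_def field_simps)
        then have "lattice_density y x T \<noteq> 0" using F1 q by (auto simp: divide_le_0_iff)
        then have pos: "0 < lattice_density y x T" using lattice_density_nonneg[of y x T] by simp
        have "(?F / q) powr (rank_wt ?a / \<delta>) \<le> (lattice_density y x T powr expo ?a) powr (rank_wt ?a / \<delta>)"
          using le F1 q w \<delta> by (intro powr_mono2) auto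
        also have "\<dots> = lattice_density y x T"
          using w \<delta> pos by (simp add: powr_powr expo_def)
        finally show ?thesis using pos by simp
      qed
      have r: "rational_subspace S1" "rational_subspace S2" using S
        by (auto simp: near_max_def proper_subs_def)
      obtain S3 S4 where 34: "rational_subspace S3" "rational_subspace S4" "S4 \<subseteq> S1 \<inter> S2"
        "?a + dim S2 = dim S3 + dim S4"
        "lattice_density y x S1 * lattice_density y x S2
            \<le> C * (lattice_density y x S3 * lattice_density y x S4)"
        using lattice_density_submodular[OF y0 r] low[OF S(1)] low[OF S(2)] S(3) unfolding C_def by metis
      have sub: "subspace S1" "subspace S2" "subspace S3" "subspace S4"
        using r 34 rational_subspace_subspace by auto
      \<comment> \<open>Distinct subspaces of one rank share only a subspace of smaller rank; this
        is what makes the concavity strict.\<close>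
      have lt: "dim S4 < ?a"
      proof (rule ccontr)
        assume "\<not> dim S4 < ?a"
        then have "S4 = S1" "S4 = S2"
          using subspace_dim_equal[OF sub(4) sub(1)] subspace_dim_equal[OF sub(4) sub(2)] 34(3) S(3) by auto
        then show False using ne by simp
      qed
      have sum: "dim S4 + dim S3 = 2 * ?a" using 34(4) S(3) by simp
      have aD: "?a \<le> CARD('n)" using S(1) by (auto simp: near_max_def proper_subs_def)
      have d3: "dim S3 \<le> CARD('n) + 1" using dim_subset_UNIV[of S3] by simp
      have 3: "lattice_density y x S3 \<le> 3 ^ (CARD('n) + 1) * ?F powr (rank_wt (dim S3) / \<delta>)"
      proof (cases "dim S3 = CARD('n) + 1")
        case True
        then have "S3 = UNIV" using sub(3) dim_eq_full[of S3]
          by (simp add: span_eq_iff[THEN iffD2, OF sub(3)])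
        moreover have "rank_wt (dim S3) = 0" using True by (simp add: rank_wt_def)
        ultimately show ?thesis using lattice_density_UNIV[OF y, of x] F1 by simp
      next
        case False
        then have "S3 \<in> proper_subs" using 34(1) d3 sum lt by (auto simp: proper_subs_def)
        then have "lattice_density y x S3 \<le> 1 * ?F powr (rank_wt (dim S3) / \<delta>)"
          using lattice_density_le_height[OF y0] by simp
        also have "\<dots> \<le> 3 ^ (CARD('n) + 1) * ?F powr (rank_wt (dim S3) / \<delta>)"
          by (intro mult_right_mono one_le_power) auto
        finally show ?thesis .
      qed
      \<comment> \<open>Rank 0 does not occur in the supremum; there the density is 1, and a power
        of the height, which is at least 1, dominates it.\<close>
      have 4: "lattice_density y x S4 \<le> ?F powr (rank_wt (dim S4) / \<delta>)"
      proof (cases "dim S4 = 0")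
        case True
        then have "S4 = {0}" using dim_eq_0[of S4] subspace_0[OF sub(4)] by auto
        then show ?thesis using F1 \<delta> rank_wt_nonneg[of "dim S4"]
          by (simp only: lattice_density_zero) (intro ge_one_powr_ge_zero divide_nonneg_pos, auto)
      next
        case False
        then have "1 \<le> dim S4" by linarith
        then have "S4 \<in> proper_subs" using 34(2) lt aD unfolding proper_subs_def by simp
        then show ?thesis by (rule lattice_density_le_height[OF y0])
      qed
      have Fq: "?F / q > 0" using F1 q by simp
      have "(?F / q) powr (2 * rank_wt ?a / \<delta>)
          = (?F / q) powr (rank_wt ?a / \<delta>) * (?F / q) powr (rank_wt ?a / \<delta>)"
        by (simp add: powr_add[symmetric])
      also have "\<dots> \<le> lattice_density y x S1 * lattice_density y x S2"
        using low[OF S(1)] low[OF S(2)] S(3) by (intro mult_mono) auto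
      also have "\<dots> \<le> C * (lattice_density y x S3 * lattice_density y x S4)" by (rule 34(5))
      also have "\<dots> \<le> C * ((3 ^ (CARD('n) + 1) * ?F powr (rank_wt (dim S3) / \<delta>))
          * ?F powr (rank_wt (dim S4) / \<delta>))"
        using C1 by (intro mult_left_mono mult_mono 3 4 lattice_density_nonneg) auto
      also have "\<dots> = C * 3 ^ (CARD('n) + 1) * ?F powr ((rank_wt (dim S3) + rank_wt (dim S4)) / \<delta>)"
        by (simp add: powr_add[symmetric] add_divide_distrib)
      finally have "?F powr (2 * rank_wt ?a / \<delta>) / q powr (2 * rank_wt ?a / \<delta>)
         \<le> C * 3 ^ (CARD('n) + 1) * ?F powr ((rank_wt (dim S3) + rank_wt (dim S4)) / \<delta>)"
        using F1 q by (simp add: powr_divide)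
      then have "?F powr (2 * rank_wt ?a / \<delta>)
         \<le> C * 3 ^ (CARD('n) + 1) * q powr (2 * rank_wt ?a / \<delta>) * ?F powr ((rank_wt (dim S3)
             + rank_wt (dim S4)) / \<delta>)"
        using q by (simp add: field_simps)
      also have "\<dots> \<le> P * ?F powr ((rank_wt (dim S3) + rank_wt (dim S4)) / \<delta>)"
      proof -
        have "rank_wt ?a \<le> G" unfolding rank_wt_def G_def using aD \<eta> by (intro mult_mono) auto
        then have "q powr (2 * rank_wt ?a / \<delta>) \<le> q powr (2 * G / \<delta>)"
          using q \<delta> by (intro powr_mono divide_right_mono) auto
        then show ?thesis unfolding P_def using C1 by (intro mult_right_mono mult_left_mono) auto
      qed
      finally have "?F powr (2 * rank_wt ?a / \<delta>) / ?F powr ((rank_wt (dim S3) + rank_wt (dim S4)) / \<delta>) \<le> P"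
        using F1 by (simp add: field_simps)
      then have "?F powr ((2 * rank_wt ?a - rank_wt (dim S4) - rank_wt (dim S3)) / \<delta>) \<le> P"
        by (simp add: powr_diff[symmetric] diff_divide_distrib[symmetric] algebra_simps)
      moreover have "?F powr (2 * \<eta> / \<delta>)
          \<le> ?F powr ((2 * rank_wt ?a - rank_wt (dim S4) - rank_wt (dim S3)) / \<delta>)"
        using rank_wt_concave[OF lt sum] F1 \<delta> by (intro powr_mono divide_right_mono) auto
      moreover have "P + 1 \<le> ?F powr (2 * \<eta> / \<delta>)"
      proof -
        have "P + 1 = M powr (2 * \<eta> / \<delta>)" unfolding M_def using P0 \<delta> \<eta> by (simp add: powr_powr)
        also have "\<dots> \<le> ?F powr (2 * \<eta> / \<delta>)" using M M1 \<delta> \<eta> by (intro powr_mono2) auto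
        finally show ?thesis .
      qed
      ultimately show False by linarith
    qed
  qed
qed

end

section \<open>Contraction of the height along the words\<close>

text \<open>By \<open>aff\<close> an affine subspace can be pulled back through a word, so that
  weight estimates for the whole set apply inside every piece. The condition \<open>decay\<close> is
  put on the unperturbed exponents; the perturbed \<open>expo l\<close> are smaller.\<close>

locale self_similar_height = self_similar \<Lambda> h \<rho> K U s + lattice_height "TYPE('n)" \<delta> \<eta>
  for \<Lambda> :: "'i set" and h :: "'i \<Rightarrow> real ^ 'n \<Rightarrow> real ^ 'n" and \<rho> K U s \<delta> \<eta> +
  assumes aff: "\<And>i A k. i \<in> \<Lambda> \<Longrightarrow> A \<in> affine_subspaces k \<Longrightarrow> h i -` A \<in> affine_subspaces k"
    and decay: "\<And>l. 1 \<le> l \<Longrightarrow> l \<le> CARD('n) \<Longrightarrow>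
      ereal (\<delta> / (real CARD('n) + 1 - real l)) < alpha l (hausdorff_measure_on s K)"
begin

definition base_point :: "real ^ 'n" where "base_point = (SOME x. x \<in> K)"

definition wpoint :: "'i list \<Rightarrow> real ^ 'n" where "wpoint w = wmap w base_point"

text \<open>In rank l the decay exponent is expo l * (d + 1 - l) / (d + 1) = \<delta> / ((d + 1) *
  (1 + \<eta> * l)); the smallest value is the one at l = d.\<close>

definition rate :: real where
  "rate = \<delta> / ((real CARD('n) + 1) * (1 + \<eta> * real CARD('n)))"

lemma base_point: "base_point \<in> K"
  unfolding base_point_def using K(2) some_in_eq by blast

lemma wmap_vimage_affine: "set w \<subseteq> \<Lambda> \<Longrightarrow> A \<in> affine_subspaces k \<Longrightarrow> wmap w -` A \<in> affine_subspaces k"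
  by (induction w arbitrary: A) (auto simp: vimage_comp[symmetric] aff simp del: comp_apply)

lemma infdist_vimage:
  assumes w: "set w \<subseteq> \<Lambda>" and A: "A \<in> affine_subspaces k"
  shows "wratio w * infdist x (wmap w -` A) \<le> infdist (wmap w x) A"
proof -
  have "closed A" "A \<noteq> {}" using A by (auto simp: affine_subspaces_def affine_closed)
  then obtain a where a: "a \<in> A" "infdist (wmap w x) A = dist (wmap w x) a"
    using infdist_attains_inf by blast
  obtain a' where a': "a = wmap w a'" using surj_wmap[OF w] by (metis surjD)
  have "infdist x (wmap w -` A) \<le> dist x a'" using a a' by (intro infdist_le) auto
  then have "wratio w * infdist x (wmap w -` A) \<le> wratio w * dist x a'" using wratio_pos[OF w] by simp
  then show ?thesis using a a' dist_wmap[OF w, of x a'] by simp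
qed

lemma lattice_density_move_diam:
  fixes x x' :: "real ^ 'n"
  assumes S: "rational_subspace S" and y: "0 < y" and d: "y * dist x x' \<le> diamK"
  shows "lattice_density y x' S \<le> (1 + diamK) ^ (CARD('n) + 1) * lattice_density y x S"
proof -
  have "lattice_density y x' S \<le> (1 + y * dist x x') ^ (CARD('n) + 1) * lattice_density y x S"
    by (rule lattice_density_move[OF y S])
  also have "\<dots> \<le> (1 + diamK) ^ (CARD('n) + 1) * lattice_density y x S"
    using d y by (intro mult_right_mono power_mono lattice_density_nonneg) auto
  finally show ?thesis .
qed

lemma wpoint_near:
  assumes w: "w \<in> cuts (1 / y)" and y: "0 < y" and x: "x \<in> K"
  shows "y * dist (wpoint w) (wmap w x) \<le> diamK"
proof -
  have "y * dist (wpoint w) (wmap w x) = y * wratio w * dist base_point x"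
    unfolding wpoint_def using dist_wmap[OF cuts_set[OF w]] by simp
  also have "\<dots> \<le> 1 * diamK"
    using cuts_ratio_le[OF _ w] cuts_ratio_pos[OF w] y diamK(2)[OF base_point x]
      by (intro mult_mono) (auto simp: field_simps)
  finally show ?thesis by simp
qed

lemma weight_near_affine_expo:
  obtains C where "1 \<le> C"
    "\<And>l r \<tau> A. 1 \<le> l \<Longrightarrow> l \<le> CARD('n) \<Longrightarrow> 0 < r \<Longrightarrow> r \<le> \<tau> \<Longrightarrow> A \<in> affine_subspaces (CARD('n) - l) \<Longrightarrow>
       (\<Sum>w | w \<in> cuts r \<and> infdist (wpoint w) A \<le> \<tau>. wratio w powr s) \<le> C * \<tau> powr expo l"
proof -
  have "\<exists>C\<ge>1. \<forall>r \<tau> A. 0 < r \<longrightarrow> r \<le> \<tau> \<longrightarrow> A \<in> affine_subspaces (CARD('n) - l) \<longrightarrow>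
       (\<Sum>w | w \<in> cuts r \<and> infdist (wpoint w) A \<le> \<tau>. wratio w powr s)
           \<le> C * \<tau> powr expo l" if l: "l \<in> {1..CARD('n)}" for l
  proof -
    have "expo l \<le> \<delta> / (real CARD('n) + 1 - real l)"
      unfolding expo_def rank_wt_def using \<delta> \<eta> l
      by (intro divide_left_mono mult_pos_pos) (auto intro!: add_pos_nonneg simp: mult_le_cancel_left1)
    then have "ereal (expo l) \<le> ereal (\<delta> / (real CARD('n) + 1 - real l))" by simp
    also have "\<dots> < alpha l (hausdorff_measure_on s K)" using decay l by auto
    finally have e: "ereal (expo l) < alpha l (hausdorff_measure_on s K)" .
    have "0 \<le> expo l" using expo(1)[of l] l by simp
    show ?thesis
    proof (rule weight_near_affine[OF e \<open>0 \<le> expo l\<close> base_point])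
      fix C assume "1 \<le> C"
        "\<And>r \<tau> A. 0 < r \<Longrightarrow> r \<le> \<tau> \<Longrightarrow> A \<in> affine_subspaces (DIM(real ^ 'n) - l) \<Longrightarrow>
          (\<Sum>w | w \<in> cuts r \<and> infdist (wmap w base_point) A \<le> \<tau>. wratio w powr s) \<le> C * \<tau> powr expo l"
      then show ?thesis unfolding wpoint_def by (intro exI[of _ C]) simp
    qed
  qed
  then have "\<forall>l\<in>{1..CARD('n)}. \<exists>C. 1 \<le> C \<and> (\<forall>r \<tau> A. 0 < r \<longrightarrow> r \<le> \<tau> \<longrightarrow> A \<in> affine_subspaces (CARD('n) - l) \<longrightarrow>
       (\<Sum>w | w \<in> cuts r \<and> infdist (wpoint w) A \<le> \<tau>. wratio w powr s) \<le> C * \<tau> powr expo l)"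
    by (rule ballI)
  then obtain C where *: "\<forall>l\<in>{1..CARD('n)}. 1 \<le> C l \<and> (\<forall>r \<tau> A. 0 < r \<longrightarrow> r \<le> \<tau>
      \<longrightarrow> A \<in> affine_subspaces (CARD('n) - l) \<longrightarrow>
       (\<Sum>w | w \<in> cuts r \<and> infdist (wpoint w) A \<le> \<tau>. wratio w powr s) \<le> C l * \<tau> powr expo l)"
    by (rule exE[OF bchoice])
  have C: "1 \<le> C l" "0 < r \<Longrightarrow> r \<le> \<tau> \<Longrightarrow> A \<in> affine_subspaces (CARD('n) - l) \<Longrightarrow>
       (\<Sum>w | w \<in> cuts r \<and> infdist (wpoint w) A \<le> \<tau>. wratio w powr s) \<le> C l * \<tau> powr expo l"
    if "l \<in> {1..CARD('n)}" for l and r \<tau> :: real and A :: "(real ^ 'n) set"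
    using * that by blast+
  define C' where "C' = (\<Sum>l\<in>{1..CARD('n)}. C l)"
  have le: "C l \<le> C'" if "l \<in> {1..CARD('n)}" for l
    unfolding C'_def using that C(1) by (intro member_le_sum) force+
  show ?thesis
  proof (rule that[of C'])
    have "1 \<in> {1..CARD('n)}" by (simp add: Suc_leI)
    then show "1 \<le> C'" using C(1) le order_trans by blast
    fix l and r \<tau> :: real and A :: "(real ^ 'n) set"
    assume l: "1 \<le> l" "l \<le> CARD('n)" and r: "0 < r" "r \<le> \<tau>" "A \<in> affine_subspaces (CARD('n) - l)"
    then have l': "l \<in> {1..CARD('n)}" by simp
    show "(\<Sum>w | w \<in> cuts r \<and> infdist (wpoint w) A \<le> \<tau>. wratio w powr s) \<le> C' * \<tau> powr expo l"
      by (rule order_trans[OF C(2)[OF l' r]]) (intro mult_right_mono le l', simp)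
  qed
qed

lemma wpoint_child_near:
  assumes y: "1 \<le> y" and b: "1 \<le> b" and w: "w \<in> cuts (1 / y)" and v: "v \<in> cuts (1 / (y * b) / wratio w)"
  shows "y * dist (wpoint w) (wpoint (w @ v)) \<le> diamK"
proof -
  have "wmap v base_point \<in> K" using wmap_limit_set[OF cuts_set[OF v]] base_point by blast
  then show ?thesis using wpoint_near[OF w, of "wmap v base_point"] y by (simp add: wpoint_def wmap_append)
qed

text \<open>Inside the piece of w, the relative weight within 2^-j / y of the exceptional subspace
  is of order 2^(-j \<beta>), while the density to the power \<beta> may be larger there by 2^(j
  \<beta>). All scales contribute alike, so the price is only the factor k + 1. Below 2^-k the
  growth bound is worse than the contraction by just b = 2^k, which closes the sum.\<close>

lemma single_subspace_step:
  obtains P where "1 \<le> P"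
    "\<And>k y w S. 1 \<le> y \<Longrightarrow> w \<in> cuts (1 / y) \<Longrightarrow> S \<in> proper_subs \<Longrightarrow>
      (\<Sum>v\<in>cuts (1 / (y * 2 ^ k) / wratio w). wratio v powr s * lattice_density (y
          * 2 ^ k) (wpoint (w @ v)) S powr expo (dim S))
        \<le> (real k + 1) * P * (2 ^ k) powr - rate * lattice_density y (wpoint w) S powr expo (dim S)"
proof -
  obtain C0 where C0: "1 \<le> C0"
    "\<And>l r \<tau> A. 1 \<le> l \<Longrightarrow> l \<le> CARD('n) \<Longrightarrow> 0 < r \<Longrightarrow> r \<le> \<tau> \<Longrightarrow> A \<in> affine_subspaces (CARD('n) - l) \<Longrightarrow>
       (\<Sum>w | w \<in> cuts r \<and> infdist (wpoint w) A \<le> \<tau>. wratio w powr s) \<le> C0 * \<tau> powr expo l"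
    using weight_near_affine_expo by blast
  define Ce where "Ce = (2 * real CARD('n) + 4) ^ (CARD('n) + 1)"
  define Cm where "Cm = (1 + diamK) ^ (CARD('n) + 1)"
  have Ce: "1 \<le> Ce" unfolding Ce_def by (rule one_le_power) simp
  have Cm: "1 \<le> Cm" unfolding Cm_def using diamK(1) by (intro one_le_power) simp
  have CC: "1 \<le> Ce * Cm" using Ce Cm mult_mono[of 1 Ce 1 Cm] by simp
  have rm: "1 \<le> 4 / rmin" using rmin by (simp add: field_simps)
  define P where "P = (Ce * Cm) powr \<delta> * C0 * (4 / rmin) powr \<delta>"
  show ?thesis
  proof (rule that[of P])
    have "1 * 1 * 1 \<le> P" unfolding P_def
      using CC C0(1) rm \<delta> by (intro mult_mono ge_one_powr_ge_zero) (auto intro: ge_one_powr_ge_zero)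
    then show "1 \<le> P" by simp
    fix k y w S
    assume y: "1 \<le> y" and w: "w \<in> cuts (1 / y)" and S: "S \<in> proper_subs"
    define b :: real where "b = 2 ^ k"
    let ?l = "dim S"
    let ?\<beta> = "expo ?l"
    define r' where "r' = 1 / (y * b) / wratio w"
    define \<theta> where "\<theta> = lattice_density y (wpoint w) S"
    have b: "1 \<le> b" by (simp add: b_def)
    have y0: "0 < y" using y by simp
    have l: "1 \<le> ?l" "?l \<le> CARD('n)" and rS: "rational_subspace S" using S by (auto simp: proper_subs_def)
    have \<beta>: "0 < ?\<beta>" "?\<beta> \<le> \<delta>" using expo l by auto
    have wL: "set w \<subseteq> \<Lambda>" and rw: "0 < wratio w" using cuts_set[OF w] cuts_ratio_pos[OF w] .
    have r': "0 < r'" using y b rw by (simp add: r'_def)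
    have \<theta>0: "0 \<le> \<theta>" by (simp add: \<theta>_def lattice_density_nonneg)
    obtain A where A: "A \<in> affine_subspaces (CARD('n) - ?l)"
      "\<And>x y b. 0 < y \<Longrightarrow> 1 \<le> b \<Longrightarrow> 0 < infdist x A \<Longrightarrow>
        lattice_density (y * b) x S \<le> Ce * b powr (- ((real CARD('n) + 1 - ?l) / (real CARD('n) + 1)))
         * (1 + 1 / (y * infdist x A)) * lattice_density y x S"
      using lattice_density_near_affine[OF rS l] unfolding Ce_def by blast
    \<comment> \<open>The contraction factor for points far from A.\<close>
    define u where "u = b powr (- ((real CARD('n) + 1 - ?l) / (real CARD('n) + 1)))"
    have u: "0 < u" using b by (simp add: u_def)
    define E where "E = Ce * Cm * u * \<theta>"
    have E0: "0 \<le> E" unfolding E_def using Ce Cm u \<theta>0 by simp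
    \<comment> \<open>dyadic decomposition by the distance from \<open>A\<close>, down to the scale where the trivial growth bound takes over\<close>
    define good where "good j v \<longleftrightarrow> j = 0 \<or> y * infdist (wpoint (w @ v)) A \<le> (1/2) ^ j" for j :: nat and v
    define t where "t j = (2 ^ (j + 2) :: real) powr ?\<beta>" for j :: nat
    have point: "lattice_density (y * b) (wpoint (w @ v)) S powr ?\<beta>
        \<le> E powr ?\<beta> * (\<Sum>j\<le>k. t j * of_bool (good j v))"
      if v: "v \<in> cuts r'" for v
    proof -
      let ?z = "wpoint (w @ v)"
      define D where "D = y * infdist ?z A"
      have near: "lattice_density y ?z S \<le> Cm * \<theta>"
        unfolding Cm_def \<theta>_def using wpoint_child_near[OF y b w] v
        by (intro lattice_density_move_diam[OF rS y0]) (auto simp: r'_def)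
      have "\<exists>j\<le>k. good j v \<and> lattice_density (y * b) ?z S \<le> E * 2 ^ (j + 2)"
      proof (cases "D \<le> (1/2) ^ k")
        case True
        have "lattice_density (y * b) ?z S \<le> b powr (?l / (real CARD('n) + 1)) * lattice_density y ?z S"
          by (rule lattice_density_step[OF y0 b rS])
        \<comment> \<open>The growth bound loses exactly one factor b against u.\<close>
        also have "b powr (?l / (real CARD('n) + 1)) = u * b"
        proof -
          have "real ?l / (real CARD('n) + 1) = - ((real CARD('n) + 1 - ?l) / (real CARD('n) + 1)) + 1"
            by (simp add: field_simps)
          then have "b powr (?l / (real CARD('n) + 1))
              = b powr (- ((real CARD('n) + 1 - ?l) / (real CARD('n) + 1)) + 1)"
            by (simp only:)
          also have "\<dots> = u * b powr 1" unfolding u_def by (rule powr_add)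
          finally show ?thesis using b by simp
        qed
        also have "u * b * lattice_density y ?z S \<le> u * b * (Cm * \<theta>)"
          using u b by (intro mult_left_mono near) auto
        also have "\<dots> \<le> Ce * (u * b * (Cm * \<theta>))"
          using Ce u b Cm \<theta>0 mult_right_mono[OF Ce, of "u * b * (Cm * \<theta>)"] by simp
        also have "\<dots> = E * b" by (simp add: E_def mult_ac)
        also have "\<dots> \<le> E * 2 ^ (k + 2)" unfolding b_def by (intro mult_left_mono power_increasing E0) auto
        finally show ?thesis using True by (intro exI[of _ k]) (auto simp: good_def D_def)
      next
        case False
        define j where "j = (LEAST j. (1/2) ^ Suc j < D)"
        have exj: "(1/2) ^ Suc k < D"
        proof -
          have "(1/2 :: real) ^ Suc k \<le> (1/2) ^ k" by (intro power_decreasing) auto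
          then show ?thesis using False by linarith
        qed
        have j: "(1/2) ^ Suc j < D" "j \<le> k"
          unfolding j_def using exj by (rule LeastI, intro Least_le)
        have "good j v"
        proof (cases j)
          case (Suc i)
          then have "\<not> (1/2) ^ Suc i < D" using not_less_Least[of i "\<lambda>j. (1/2) ^ Suc j < D"]
            unfolding j_def[symmetric] by simp
          then show ?thesis using Suc by (auto simp: good_def D_def)
        qed (simp add: good_def)
        have D0: "0 < D" using j(1) by (meson less_trans zero_less_power half_gt_zero zero_less_one)
        then have i0: "0 < infdist ?z A" using y0 by (simp add: D_def zero_less_mult_iff)
        have "1 / D \<le> 1 / (1/2) ^ Suc j" using j(1) D0 by (intro divide_left_mono) auto
        then have "1 / D \<le> 2 ^ Suc j" by (simp add: power_divide)
        moreover have "(1 :: real) \<le> 2 ^ Suc j" by (rule one_le_power) simp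
        ultimately have D2: "1 + 1 / D \<le> 2 ^ (j + 2)" by simp
        have "lattice_density (y * b) ?z S \<le> Ce * u * (1 + 1 / D) * lattice_density y ?z S"
          unfolding D_def u_def by (rule A(2)[OF y0 b i0])
        also have "\<dots> \<le> Ce * u * (2 ^ (j + 2)) * (Cm * \<theta>)"
          using Ce u D2 D0 by (intro mult_mono mult_left_mono near lattice_density_nonneg) auto
        also have "\<dots> = E * 2 ^ (j + 2)" by (simp add: E_def mult_ac)
        finally show ?thesis using \<open>good j v\<close> j(2) by blast
      qed
      then obtain j where j: "j \<le> k" "good j v" "lattice_density (y * b) ?z S \<le> E * 2 ^ (j + 2)" by blast
      have "lattice_density (y * b) ?z S powr ?\<beta> \<le> (E * 2 ^ (j + 2)) powr ?\<beta>"
        using \<beta> j(3) by (intro powr_mono2 lattice_density_nonneg) auto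
      also have "\<dots> = E powr ?\<beta> * (t j * of_bool (good j v))" using j(2) E0 by (simp add: powr_mult t_def)
      also have "\<dots> \<le> E powr ?\<beta> * (\<Sum>j\<le>k. t j * of_bool (good j v))"
        using j(1) by (intro mult_left_mono member_le_sum) (auto simp: t_def)
      finally show ?thesis .
    qed
    have weight: "(\<Sum>v\<in>cuts r'. wratio v powr s * of_bool (good j v))
        \<le> C0 * ((1/2) ^ j / rmin) powr ?\<beta>" if j: "j \<le> k" for j
    proof (cases "j = 0")
      case True
      then have "(\<Sum>v\<in>cuts r'. wratio v powr s * of_bool (good j v)) = 1" using sum_cuts[OF r']
        by (simp add: good_def)
      moreover have "1 * 1 \<le> C0 * ((1/2) ^ j / rmin) powr ?\<beta>"
        using True C0(1) rmin \<beta> by (intro mult_mono ge_one_powr_ge_zero) (auto simp: field_simps)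
      ultimately show ?thesis by simp
    next
      case False
      \<comment> \<open>A distance (1/2)^j / y inside the piece becomes at most this after rescaling
        by \<open>wratio w\<close>, which is at least rmin / y.\<close>
      define \<tau> where "\<tau> = (1/2) ^ j / rmin"
      have "1 / y \<le> 1" using y by simp
      then have rwl: "rmin / y \<le> wratio w" using cuts_ratio_ge[OF _ _ w] y0 by simp
      \<comment> \<open>The weight estimate requires \<tau> to be at least the scale of the cut set;
        here j \<le> k enters.\<close>
      have "r' \<le> 1 / (y * b) / (rmin / y)" unfolding r'_def
        using rwl y0 rmin(1) b rw by (intro divide_left_mono) auto
      also have "\<dots> = (1/2) ^ k / rmin" using y0 by (simp add: b_def power_divide field_simps)
      also have "\<dots> \<le> \<tau>" unfolding \<tau>_def using j rmin(1) by (intro divide_right_mono power_decreasing) auto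
      finally have r\<tau>: "r' \<le> \<tau>" .
      let ?A' = "wmap w -` A"
      have A': "?A' \<in> affine_subspaces (CARD('n) - ?l)" by (rule wmap_vimage_affine[OF wL A(1)])
      have sub: "infdist (wpoint v) ?A' \<le> \<tau>" if "good j v" for v
      proof -
        have "wratio w * infdist (wpoint v) ?A' \<le> infdist (wpoint (w @ v)) A"
          using infdist_vimage[OF wL A(1), of "wmap v base_point"] by (simp add: wpoint_def wmap_append)
        also have "\<dots> \<le> (1/2) ^ j / y" using that False y0 by (simp add: good_def field_simps)
        finally have "rmin / y * infdist (wpoint v) ?A' \<le> (1/2) ^ j / y"
          using mult_right_mono[OF rwl infdist_nonneg[of "wpoint v" ?A']] by linarith
        then show ?thesis using y0 rmin(1) by (simp add: \<tau>_def field_simps)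
      qed
      have "(\<Sum>v\<in>cuts r'. wratio v powr s * of_bool (good j v)) \<le> (\<Sum>v\<in>cuts r'. if infdist (wpoint v) ?A'
          \<le> \<tau> then wratio v powr s else 0)"
        using sub by (intro sum_mono) auto
      also have "\<dots> = (\<Sum>v | v \<in> cuts r' \<and> infdist (wpoint v) ?A' \<le> \<tau>. wratio v powr s)"
        by (rule sum.inter_filter[OF finite_cuts[OF r'], symmetric])
      also have "\<dots> \<le> C0 * \<tau> powr ?\<beta>" by (rule C0(2)[OF l r' r\<tau> A'])
      finally show ?thesis by (simp add: \<tau>_def)
    qed
    have tj: "t j * (C0 * ((1/2) ^ j / rmin) powr ?\<beta>) \<le> C0 * (4 / rmin) powr \<delta>" for j
    proof -
      have "t j * ((1/2) ^ j / rmin) powr ?\<beta> = (2 ^ (j + 2) * ((1/2) ^ j / rmin)) powr ?\<beta>"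
        unfolding t_def using rmin(1) by (subst powr_mult) auto
      also have "2 ^ (j + 2) * ((1/2) ^ j / rmin) = 4 / rmin" by (simp add: power_divide)
      also have "(4 / rmin) powr ?\<beta> \<le> (4 / rmin) powr \<delta>" using rm \<beta> by (intro powr_mono) auto
      finally show ?thesis using C0(1) by (simp add: mult.left_commute)
    qed
    have "(\<Sum>v\<in>cuts r'. wratio v powr s * lattice_density (y * b) (wpoint (w @ v)) S powr ?\<beta>)
      \<le> (\<Sum>v\<in>cuts r'. wratio v powr s * (E powr ?\<beta> * (\<Sum>j\<le>k. t j * of_bool (good j v))))"
      by (intro sum_mono mult_left_mono point) auto
    also have "\<dots> = E powr ?\<beta> * (\<Sum>j\<le>k. t j * (\<Sum>v\<in>cuts r'. wratio v powr s * of_bool (good j v)))"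
      unfolding sum_distrib_left by (subst sum.swap) (simp add: mult_ac)
    also have "\<dots> \<le> E powr ?\<beta> * (\<Sum>j\<le>k. t j * (C0 * ((1/2) ^ j / rmin) powr ?\<beta>))"
      by (intro mult_left_mono sum_mono weight) (auto simp: t_def)
    also have "\<dots> \<le> E powr ?\<beta> * (\<Sum>j\<le>k. C0 * (4 / rmin) powr \<delta>)"
      by (intro mult_left_mono sum_mono tj) auto
    also have "\<dots> = E powr ?\<beta> * ((real k + 1) * (C0 * (4 / rmin) powr \<delta>))" by simp
    also have "E powr ?\<beta> \<le> (Ce * Cm) powr \<delta> * b powr - rate * \<theta> powr ?\<beta>"
    proof -
      have "E powr ?\<beta> = (Ce * Cm) powr ?\<beta> * u powr ?\<beta> * \<theta> powr ?\<beta>"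
        unfolding E_def using CC u \<theta>0 by (simp add: powr_mult)
      also have "\<dots> \<le> (Ce * Cm) powr \<delta> * b powr - rate * \<theta> powr ?\<beta>"
      proof (intro mult_right_mono mult_mono)
        show "(Ce * Cm) powr ?\<beta> \<le> (Ce * Cm) powr \<delta>" using CC \<beta> by (intro powr_mono) auto
        define m where "m = real CARD('n) + 1 - real ?l"
        have m: "m > 0" using l by (simp add: m_def)
        have "m / (real CARD('n) + 1) * ?\<beta> = \<delta> / ((real CARD('n) + 1) * (1 + \<eta> * real ?l))"
          using m by (simp add: expo_def rank_wt_def m_def[symmetric])
        moreover have "rate \<le> \<dots>"
          unfolding rate_def using \<delta> \<eta> l
          by (intro divide_left_mono mult_left_mono mult_pos_pos add_left_mono) (auto intro!:
              add_pos_nonneg)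
        moreover have "u powr ?\<beta> = b powr (- (m / (real CARD('n) + 1) * ?\<beta>))"
          by (simp add: u_def powr_powr m_def)
        ultimately show "u powr ?\<beta> \<le> b powr - rate" using b by (simp add: powr_mono)
      qed auto
      finally show ?thesis .
    qed
    finally have "(\<Sum>v\<in>cuts r'. wratio v powr s * lattice_density (y * b) (wpoint (w @ v)) S powr ?\<beta>)
      \<le> (Ce * Cm) powr \<delta> * b powr - rate * \<theta> powr ?\<beta> * ((real k + 1) * (C0 * (4 / rmin) powr \<delta>))"
      using C0(1) by (simp add: mult_right_mono)
    also have "\<dots> = (real k + 1) * P * b powr - rate * \<theta> powr ?\<beta>" by (simp add: P_def mult_ac)
    finally show "(\<Sum>v\<in>cuts (1 / (y * 2 ^ k) / wratio w). wratio v powr s * lattice_density (y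
        * 2 ^ k) (wpoint (w @ v)) S powr expo (dim S))
        \<le> (real k + 1) * P * (2 ^ k) powr - rate * lattice_density y (wpoint w) S powr expo (dim S)"
      by (simp add: r'_def b_def \<theta>_def)
  qed
qed

text \<open>The supremum at each child is bounded by a sum over the competitors at the parent plus a
  remainder. As the competitors do not depend on the child, the sum over the children can be taken
  for one subspace at a time.\<close>

lemma height_step:
  assumes \<kappa>: "\<kappa> < rate"
  obtains k M where "1 \<le> k" "1 \<le> M"
    "\<And>y w. 1 \<le> y \<Longrightarrow> w \<in> cuts (1 / y) \<Longrightarrow> M \<le> height y (wpoint w) \<Longrightarrow>
      (\<Sum>v\<in>cuts (1 / (y * 2 ^ k) / wratio w). wratio v powr s * height (y * 2 ^ k) (wpoint (w @ v)))
        \<le> (2 ^ k) powr - \<kappa> * height y (wpoint w)"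
proof -
  obtain P where P: "1 \<le> P"
    "\<And>k y w S. 1 \<le> y \<Longrightarrow> w \<in> cuts (1 / y) \<Longrightarrow> S \<in> proper_subs \<Longrightarrow>
      (\<Sum>v\<in>cuts (1 / (y * 2 ^ k) / wratio w). wratio v powr s * lattice_density (y
          * 2 ^ k) (wpoint (w @ v)) S powr expo (dim S))
        \<le> (real k + 1) * P * (2 ^ k) powr - rate * lattice_density y (wpoint w) S powr expo (dim S)"
    using single_subspace_step by blast
  define d where "d = real CARD('n)"
  have d: "d \<ge> 1" by (simp add: d_def Suc_leI)
  define c where "c = rate - \<kappa>"
  have c: "c > 0" using \<kappa> by (simp add: c_def)
  \<comment> \<open>The exponential gain beats the linear loss; \<open>k\<close> is fixed here,
    before q and M, which depend on it.\<close>
  have "((\<lambda>k. (d * P * (real k + 1) + 1) * 2 powr (- c * real k)) \<longlongrightarrow> 0) sequentially"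
    using c by real_asymp
  then have "\<forall>\<^sub>F k in sequentially. (d * P * (real k + 1) + 1) * 2 powr (- c * real k) < 1"
    by (rule order_tendstoD(2)) simp
  then obtain k0 where k0: "\<And>k. k0 \<le> k \<Longrightarrow> (d * P * (real k + 1) + 1) * 2 powr (- c * real k) < 1"
    by (auto simp: eventually_sequentially)
  define k where "k = max k0 1"
  define b :: real where "b = 2 ^ k"
  have b: "1 \<le> b" by (simp add: b_def)
  have kk: "(d * P * (real k + 1) + 1) * b powr - rate \<le> b powr - \<kappa>"
  proof -
    have "2 powr (- c * real k) = b powr - c"
      by (simp add: b_def powr_realpow[symmetric] powr_powr mult.commute)
    then have "(d * P * (real k + 1) + 1) * b powr - c \<le> 1" using k0[of k] by (simp add: k_def)
    then have "(d * P * (real k + 1) + 1) * b powr - c * b powr - \<kappa> \<le> 1 * b powr - \<kappa>"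
      by (intro mult_right_mono) auto
    moreover have "b powr - c * b powr - \<kappa> = b powr - rate" by (simp add: powr_add[symmetric] c_def)
    ultimately show ?thesis by (simp add: mult.assoc)
  qed
  define Cm where "Cm = (1 + diamK) ^ (CARD('n) + 1)"
  have Cm: "1 \<le> Cm" unfolding Cm_def using diamK(1) by (intro one_le_power) simp
  \<comment> \<open>One factor b * Cm bounds the growth of a density from the parent to a child, the
    other b leaves \<open>b powr - \<delta>\<close> to spare. The exponent \<delta> bounds all
    \<open>expo k\<close>.\<close>
  define q where "q = (b * b * Cm) powr \<delta>"
  have bC: "1 \<le> b * Cm" "1 \<le> b * b * Cm"
    using b Cm mult_mono[of 1 b 1 Cm] mult_mono[of 1 b 1 "b * Cm"] by (auto simp: mult.assoc)
  have q: "1 \<le> q" unfolding q_def using bC \<delta> by (intro ge_one_powr_ge_zero) auto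
  obtain M where M: "1 \<le> M"
    "\<And>y x S1 S2. 1 \<le> y \<Longrightarrow> M \<le> height y x \<Longrightarrow> S1 \<in> near_max q y x \<Longrightarrow> S2 \<in> near_max q y x \<Longrightarrow> dim S1 = dim S2 \<Longrightarrow>
      S1 = S2"
    using near_max_unique[OF q] by blast
  show ?thesis
  proof (rule that[of k M])
    show "1 \<le> k" by (simp add: k_def)
    show "1 \<le> M" by (rule M(1))
    fix y w assume y: "1 \<le> y" and w: "w \<in> cuts (1 / y)" and F: "M \<le> height y (wpoint w)"
    let ?F = "height y (wpoint w)" and ?Q = "near_max q y (wpoint w)"
    define r' where "r' = 1 / (y * b) / wratio w"
    have y0: "0 < y" using y by simp
    have F0: "0 \<le> ?F" by (rule height_nonneg[OF y0])
    have rw: "0 < wratio w" using cuts_ratio_pos[OF w] .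
    have r': "0 < r'" using y b rw by (simp add: r'_def)
    \<comment> \<open>At most one competitor for each rank, hence finitely many.\<close>
    have inj: "inj_on dim ?Q" using M(2)[OF y F] by (auto simp: inj_on_def)
    have im: "dim ` ?Q \<subseteq> {1..CARD('n)}" by (auto simp: near_max_def proper_subs_def)
    have finQ: "finite ?Q" using inj im finite_imageD finite_subset by blast
    have cQ: "real (card ?Q) \<le> d" unfolding d_def
      using card_mono[OF _ im] card_image[OF inj] by simp
    have Qs: "S \<in> proper_subs" if "S \<in> ?Q" for S using that by (simp add: near_max_def)
    have sum0: "0 \<le> (\<Sum>S\<in>?Q. lattice_density (y * b) x S powr expo (dim S))" for x by (intro sum_nonneg) auto
    have point: "height (y * b) (wpoint (w @ v))
        \<le> (\<Sum>S\<in>?Q. lattice_density (y * b) (wpoint (w @ v)) S powr expo (dim S)) + b powr - \<delta> * ?F"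
      if v: "v \<in> cuts r'" for v
    proof (rule height_least)
      fix S assume S: "S \<in> proper_subs"
      let ?\<beta> = "expo (dim S)" and ?z = "wpoint (w @ v)"
      show "lattice_density (y * b) ?z S powr ?\<beta>
          \<le> (\<Sum>S\<in>?Q. lattice_density (y * b) ?z S powr expo (dim S)) + b powr - \<delta> * ?F"
      proof (cases "S \<in> ?Q")
        case True
        then have "lattice_density (y * b) ?z S powr ?\<beta>
            \<le> (\<Sum>S\<in>?Q. lattice_density (y * b) ?z S powr expo (dim S))"
          using finQ by (intro member_le_sum) auto
        moreover have "0 \<le> b powr - \<delta> * ?F" using F0 by simp
        ultimately show ?thesis by linarith
      next
        case False
        have \<beta>: "0 < ?\<beta>" "?\<beta> \<le> \<delta>" using expo proper_subs_dim[OF S] by auto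
        have rS: "rational_subspace S" using proper_subs_dim[OF S] by simp
        have "lattice_density (y * b) ?z S \<le> b powr (dim S / (real CARD('n) + 1)) * lattice_density y ?z S"
          by (rule lattice_density_step[OF y0 b rS])
        also have "\<dots> \<le> b powr 1 * (Cm * lattice_density y (wpoint w) S)"
        proof (intro mult_mono powr_mono)
          show "lattice_density y ?z S \<le> Cm * lattice_density y (wpoint w) S"
            unfolding Cm_def using wpoint_child_near[OF y b w] v
              by (intro lattice_density_move_diam[OF rS y0]) (auto simp: r'_def)
          show "dim S / (real CARD('n) + 1) \<le> 1" using proper_subs_dim[OF S] by simp
        qed (use b lattice_density_nonneg in auto)
        also have "\<dots> = b * Cm * lattice_density y (wpoint w) S" using b by simp
        finally have "lattice_density (y * b) ?z S powr ?\<beta>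
            \<le> (b * Cm * lattice_density y (wpoint w) S) powr ?\<beta>"
          using \<beta> by (intro powr_mono2 lattice_density_nonneg) auto
        also have "\<dots> = (b * Cm) powr ?\<beta> * lattice_density y (wpoint w) S powr ?\<beta>"
          using bC lattice_density_nonneg by (simp add: powr_mult)
        also have "\<dots> \<le> (b * Cm) powr \<delta> * (?F / q)"
        proof (intro mult_mono)
          show "(b * Cm) powr ?\<beta> \<le> (b * Cm) powr \<delta>" using bC \<beta> by (intro powr_mono) auto
          show "lattice_density y (wpoint w) S powr ?\<beta> \<le> ?F / q"
            using False S q by (simp add: near_max_def field_simps)
        qed auto
        also have "\<dots> = b powr - \<delta> * ?F"
        proof -
          have "q = b powr \<delta> * (b * Cm) powr \<delta>" unfolding q_def mult.assoc[of b b Cm] using b bC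
            by (simp only: powr_mult)
          then show ?thesis using Cm b by (simp add: powr_minus_divide)
        qed
        finally show ?thesis using sum0[of ?z] by linarith
      qed
    qed
    have "(\<Sum>v\<in>cuts r'. wratio v powr s * height (y * b) (wpoint (w @ v)))
       \<le> (\<Sum>v\<in>cuts r'. wratio v powr s * ((\<Sum>S\<in>?Q. lattice_density (y
           * b) (wpoint (w @ v)) S powr expo (dim S)) + b powr - \<delta> * ?F))"
      by (intro sum_mono mult_left_mono point) auto
    also have "\<dots> = (\<Sum>S\<in>?Q. \<Sum>v\<in>cuts r'. wratio v powr s * lattice_density (y
        * b) (wpoint (w @ v)) S powr expo (dim S))
        + (\<Sum>v\<in>cuts r'. wratio v powr s) * (b powr - \<delta> * ?F)"
      unfolding distrib_left sum.distrib sum_distrib_left sum_distrib_right by (subst sum.swap) simp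
    also have "\<dots> \<le> (\<Sum>S\<in>?Q. (real k + 1) * P * b powr - rate * ?F) + 1 * (b powr - rate * ?F)"
    proof (intro add_mono sum_mono mult_mono)
      fix S assume "S \<in> ?Q"
      then have S: "S \<in> proper_subs" by (rule Qs)
      have "(\<Sum>v\<in>cuts r'. wratio v powr s * lattice_density (y * b) (wpoint (w @ v)) S powr expo (dim S))
         \<le> (real k + 1) * P * b powr - rate * lattice_density y (wpoint w) S powr expo (dim S)"
        unfolding r'_def b_def by (rule P(2)[OF y w S])
      also have "\<dots> \<le> (real k + 1) * P * b powr - rate * ?F"
        using P(1) by (intro mult_left_mono height_upper y0 S) auto
      finally show "(\<Sum>v\<in>cuts r'. wratio v powr s * lattice_density (y
          * b) (wpoint (w @ v)) S powr expo (dim S))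
         \<le> (real k + 1) * P * b powr - rate * ?F" .
    next
      show "(\<Sum>v\<in>cuts r'. wratio v powr s) \<le> 1" using sum_cuts[OF r'] by simp
      have "rate \<le> \<delta> / 1" unfolding rate_def
      proof (intro divide_left_mono)
        have "1 * 1 \<le> (real CARD('n) + 1) * (1 + \<eta> * real CARD('n))" using \<eta> by (intro mult_mono) auto
        then show "1 \<le> (real CARD('n) + 1) * (1 + \<eta> * real CARD('n))" by simp
        then show "0 < (real CARD('n) + 1) * (1 + \<eta> * real CARD('n)) * 1" by simp
      qed (use \<delta> in simp)
      then show "b powr - \<delta> \<le> b powr - rate" using b by (intro powr_mono) auto
    qed (use F0 in auto)
    also have "\<dots> = (real (card ?Q) * P * (real k + 1) + 1) * b powr - rate * ?F"
      by (simp add: algebra_simps)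
    also have "\<dots> \<le> (d * P * (real k + 1) + 1) * b powr - rate * ?F"
      using cQ P(1) F0 by (intro mult_right_mono add_right_mono) auto
    also have "\<dots> \<le> b powr - \<kappa> * ?F" by (intro mult_right_mono kk F0)
    finally show "(\<Sum>v\<in>cuts (1 / (y * 2 ^ k) / wratio w). wratio v powr s * height (y
        * 2 ^ k) (wpoint (w @ v)))
        \<le> (2 ^ k) powr - \<kappa> * height y (wpoint w)" by (simp add: r'_def b_def)
  qed
qed

end

section \<open>Covering the singular vectors\<close>

context self_similar_height
begin

text \<open>Along words that meet \<open>E n0\<close> the height stays above M from time n0 on, so
  \<open>height_step\<close> can be iterated and \<open>T n\<close> decays like b powr (-\<kappa>
  n). Since the height is at least 1 there, so does the plain weight; ratios are of order b^-n,
  hence the sums of \<open>wratio w powr (s - \<kappa>)\<close> stay bounded. The gap between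
  \<kappa>' and \<kappa> then gives measure zero.\<close>

lemma hausdorff_outer_Sing_zero:
  assumes \<kappa>: "0 < \<kappa>'" "\<kappa>' < \<kappa>" "\<kappa> < rate" "\<kappa>' < s"
  shows "hausdorff_outer (s - \<kappa>') (Sing \<inter> K) = 0"
proof -
  obtain k M where k: "1 \<le> k" and M: "1 \<le> M"
    and step: "\<And>y w. 1 \<le> y \<Longrightarrow> w \<in> cuts (1 / y) \<Longrightarrow> M \<le> height y (wpoint w) \<Longrightarrow>
      (\<Sum>v\<in>cuts (1 / (y * 2 ^ k) / wratio w). wratio v powr s * height (y * 2 ^ k) (wpoint (w @ v)))
        \<le> (2 ^ k) powr - \<kappa> * height y (wpoint w)"
    using height_step[OF \<kappa>(3)] by blast
  define b :: real where "b = 2 ^ k"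
  have b: "1 < b" using k by (simp add: b_def)
  define Cm where "Cm = (1 + diamK) ^ (CARD('n) + 1)"
  have Cm: "1 \<le> Cm" unfolding Cm_def using diamK(1) by (intro one_le_power) simp
  have ex1: "0 < expo 1" by (rule expo(1)) (simp add: Suc_leI)
  \<comment> \<open>A vector this short anywhere in a piece forces a rank one density of at least
    \<open>M powr (1 / expo 1)\<close> at the marked point; Cm is the loss for moving there.\<close>
  define e where "e = 1 / (Cm * M powr (1 / expo 1))"
  have e: "0 < e" using Cm M by (simp add: e_def)
  \<comment> \<open>The time from which the vectors stay short varies with the point; fixing it
    costs only a countable union.\<close>
  define E where "E n0 = {x \<in> K. \<forall>n\<ge>n0. \<exists>v\<in>integer_points. v \<noteq> 0 \<and> norm (flow (b ^ n) x v) \<le> e}" for n0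
  have cover: "Sing \<inter> K \<subseteq> (\<Union>n0. E n0)"
  proof
    fix x assume x: "x \<in> Sing \<inter> K"
    then obtain n0 where "\<And>n. n0 \<le> n \<Longrightarrow> \<exists>v\<in>integer_points. v \<noteq> 0 \<and> norm (flow (b ^ n) x v) \<le> e"
      using singular_short_vectors[OF _ b e, of x] by blast
    then have "x \<in> E n0" using x by (auto simp: E_def)
    then show "x \<in> (\<Union>n0. E n0)" by blast
  qed
  have "hausdorff_outer (s - \<kappa>') (E n0) = 0" for n0
  proof -
    define V where "V n = {w \<in> cuts (1 / b ^ n). wmap w ` K \<inter> E n0 \<noteq> {}}" for n
    have bn: "1 \<le> b ^ n" "0 < b ^ n" for n using b by (auto intro: one_le_power)
    have finV: "finite (V n)" for n unfolding V_def using finite_cuts[of "1 / b ^ n"] bn by auto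
    have high: "M \<le> height (b ^ n) (wpoint w)" if n: "n0 \<le> n" and w: "w \<in> V n" for n w
    proof -
      obtain x where x: "x \<in> K" "wmap w x \<in> E n0" using w by (auto simp: V_def)
      obtain v where v: "v \<in> integer_points" "v \<noteq> 0" "norm (flow (b ^ n) (wmap w x) v) \<le> e"
        using x(2) n by (auto simp: E_def)
      let ?S = "span {v}"
      have rS: "rational_subspace ?S" by (rule rational_subspace_line[OF v(1)])
      have f0: "norm (flow (b ^ n) (wmap w x) v) > 0"
        using v(2) linear_injective_0[OF linear_flow] inj_flow[OF bn(2)] zero_less_norm_iff by metis
      have "1 / e \<le> 1 / norm (flow (b ^ n) (wmap w x) v)" using v(3) f0
        by (intro divide_left_mono) (auto simp: e)
      also have "\<dots> \<le> lattice_density (b ^ n) (wmap w x) ?S" by (rule lattice_density_line[OF v(1,2) bn(2)])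
      also have "\<dots> \<le> Cm * lattice_density (b ^ n) (wpoint w) ?S"
        unfolding Cm_def using w by (intro lattice_density_move_diam[OF rS bn(2)] wpoint_near bn x)
            (auto simp: V_def)
      finally have "M powr (1 / expo 1) \<le> lattice_density (b ^ n) (wpoint w) ?S"
        using Cm by (simp add: e_def)
      then have "(M powr (1 / expo 1)) powr expo 1 \<le> lattice_density (b ^ n) (wpoint w) ?S powr expo 1"
        using ex1 by (intro powr_mono2) auto
      also have "\<dots> \<le> height (b ^ n) (wpoint w)"
        using height_upper[OF bn(2) line_in_proper_subs(1)[OF v(1,2)]] line_in_proper_subs(2)[OF v(2)]
          by simp
      finally show ?thesis using ex1 M by (simp add: powr_powr)
    qed
    define T where "T n = (\<Sum>w\<in>V n. wratio w powr s * height (b ^ n) (wpoint w))" for n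
    have dec: "T (Suc n) \<le> b powr - \<kappa> * T n" if n: "n0 \<le> n" for n
    proof -
      have r: "0 < 1 / b ^ Suc n" "1 / b ^ Suc n \<le> 1 / b ^ n"
        using b bn[of n] by (auto intro!: divide_left_mono simp: mult_le_cancel_right1)
      \<comment> \<open>The ancestor of a word that meets \<open>E n0\<close> meets it too, so
        passing to all children of \<open>V n\<close> only adds nonnegative terms.\<close>
      have sub: "V (Suc n) \<subseteq> (\<Union>w\<in>V n. children (1 / b ^ Suc n) w)"
      proof
        fix u assume u: "u \<in> V (Suc n)"
        then obtain w where w: "w \<in> cuts (1 / b ^ n)" "u \<in> children (1 / b ^ Suc n) w"
          using cuts_children[OF r] by (auto simp: V_def)
        then have "wmap u ` K \<subseteq> wmap w ` K" by (intro wmap_children_subset)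
        then have "w \<in> V n" using u w by (auto simp: V_def)
        then show "u \<in> (\<Union>w\<in>V n. children (1 / b ^ Suc n) w)" using w by blast
      qed
      have VW: "V n \<subseteq> cuts (1 / b ^ n)" by (auto simp: V_def)
      have "T (Suc n) \<le> (\<Sum>u\<in>(\<Union>w\<in>V n. children (1 / b ^ Suc n) w). wratio u powr s
          * height (b ^ Suc n) (wpoint u))"
        unfolding T_def
      proof (rule sum_mono2[OF _ sub])
        have "(\<Union>w\<in>V n. children (1 / b ^ Suc n) w) \<subseteq> cuts (1 / b ^ Suc n)"
          using children_subset_cuts[OF r] VW by blast
        then show "finite (\<Union>w\<in>V n. children (1 / b ^ Suc n) w)" using finite_cuts[OF r(1)] finite_subset
          by blast
        show "0 \<le> wratio u powr s * height (b ^ Suc n) (wpoint u)" for u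
          by (intro mult_nonneg_nonneg height_nonneg bn) simp
      qed
      also have "\<dots> = (\<Sum>w\<in>V n. \<Sum>v\<in>cuts (1 / b ^ Suc n / wratio w). wratio (w @ v) powr s
          * height (b ^ Suc n) (wpoint (w @ v)))"
        by (rule sum_children[OF r VW])
      also have "\<dots> \<le> (\<Sum>w\<in>V n. b powr - \<kappa> * (wratio w powr s * height (b ^ n) (wpoint w)))"
      proof (rule sum_mono)
        fix w assume w: "w \<in> V n"
        then have wW: "w \<in> cuts (1 / b ^ n)" using VW by blast
        have y: "b ^ Suc n = b ^ n * 2 ^ k" by (simp add: b_def mult.commute)
        have "(\<Sum>v\<in>cuts (1 / b ^ Suc n / wratio w). wratio (w @ v) powr s
            * height (b ^ Suc n) (wpoint (w @ v)))
          = wratio w powr s * (\<Sum>v\<in>cuts (1 / (b ^ n * 2 ^ k) / wratio w). wratio v powr s * height (b ^ n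
              * 2 ^ k) (wpoint (w @ v)))"
          unfolding sum_distrib_left y by (intro sum.cong refl) (simp add: wratio_append powr_mult)
        also have "\<dots> \<le> wratio w powr s * ((2 ^ k) powr - \<kappa> * height (b ^ n) (wpoint w))"
          by (intro mult_left_mono step bn wW high n w) simp
        finally show "(\<Sum>v\<in>cuts (1 / b ^ Suc n / wratio w). wratio (w @ v) powr s
            * height (b ^ Suc n) (wpoint (w @ v)))
           \<le> b powr - \<kappa> * (wratio w powr s * height (b ^ n) (wpoint w))" by (simp add: b_def mult_ac)
      qed
      also have "\<dots> = b powr - \<kappa> * T n" by (simp add: T_def sum_distrib_left)
      finally show ?thesis .
    qed
    have T: "T (n0 + m) \<le> (b powr - \<kappa>) ^ m * T n0" for m
    proof (induction m)
      case (Suc m)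
      have "T (n0 + Suc m) \<le> b powr - \<kappa> * T (n0 + m)" using dec[of "n0 + m"] by simp
      also have "\<dots> \<le> b powr - \<kappa> * ((b powr - \<kappa>) ^ m * T n0)" by (intro mult_left_mono Suc) simp
      finally show ?case by simp
    qed simp
    \<comment> \<open>In the constant C, the power of rmin accounts for ratios as small as rmin /
      b^n, and the power of b^n0 for the decay starting only at time n0.\<close>
    show ?thesis
    proof (rule hausdorff_outer_zero_cover[where V = "\<lambda>m. V (n0 + m)" and r = "\<lambda>m. 1 / b ^ (n0 + m)"
          and ?t0.0 = "s - \<kappa>" and C = "rmin powr - \<kappa> * (b ^ n0) powr \<kappa> * T n0"])
      show "0 < s - \<kappa>'" "s - \<kappa> < s - \<kappa>'" using \<kappa> by auto
      show "V (n0 + m) \<subseteq> cuts (1 / b ^ (n0 + m))" for m by (auto simp: V_def)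
      show "0 < 1 / b ^ (n0 + m)" for m using bn by simp
      have "(\<lambda>m. (1 / b) ^ (n0 + m)) \<longlonglongrightarrow> 0"
        using LIMSEQ_ignore_initial_segment[OF LIMSEQ_power_zero[of "1 / b"], of n0] b
          by (simp add: add.commute)
      then show "(\<lambda>m. 1 / b ^ (n0 + m)) \<longlonglongrightarrow> 0" by (simp add: power_one_over)
      show "E n0 \<subseteq> (\<Union>w\<in>V (n0 + m). wmap w ` K)" for m
      proof
        fix x assume x: "x \<in> E n0"
        then have "x \<in> K" by (simp add: E_def)
        moreover have "K = (\<Union>w\<in>cuts (1 / b ^ (n0 + m)). wmap w ` K)"
          using bn[of "n0 + m"] by (intro limit_set_cuts) simp
        ultimately obtain w where "w \<in> cuts (1 / b ^ (n0 + m))" "x \<in> wmap w ` K" by blast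
        then show "x \<in> (\<Union>w\<in>V (n0 + m). wmap w ` K)" using x by (auto simp: V_def)
      qed
      fix m
      let ?n = "n0 + m"
      have "(\<Sum>w\<in>V ?n. wratio w powr (s - \<kappa>))
          \<le> (\<Sum>w\<in>V ?n. rmin powr - \<kappa> * (b ^ ?n) powr \<kappa> * (wratio w powr s * height (b ^ ?n) (wpoint w)))"
      proof (rule sum_mono)
        fix w assume w: "w \<in> V ?n"
        then have wW: "w \<in> cuts (1 / b ^ ?n)" by (simp add: V_def)
        have "rmin * (1 / b ^ ?n) \<le> wratio w" using bn[of ?n] by (intro cuts_ratio_ge[OF _ _ wW]) auto
        then have "wratio w powr - \<kappa> \<le> (rmin * (1 / b ^ ?n)) powr - \<kappa>"
          using \<kappa> rmin(1) bn[of ?n] by (intro powr_mono2') auto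
        also have "\<dots> = rmin powr - \<kappa> * (b ^ ?n) powr \<kappa>"
          using bn[of ?n] by (simp add: powr_mult powr_divide powr_minus_divide)
        finally have 1: "wratio w powr - \<kappa> \<le> rmin powr - \<kappa> * (b ^ ?n) powr \<kappa>" .
        have "wratio w powr (s - \<kappa>) = wratio w powr s * wratio w powr - \<kappa>"
          by (simp add: powr_add[symmetric])
        also have "\<dots> \<le> (wratio w powr s * height (b ^ ?n) (wpoint w)) * (rmin powr - \<kappa> * (b ^ ?n) powr \<kappa>)"
        proof (intro mult_mono 1)
          have "1 \<le> height (b ^ ?n) (wpoint w)" using high[OF _ w] M by simp
          then show "wratio w powr s \<le> wratio w powr s * height (b ^ ?n) (wpoint w)"
            using mult_left_mono[of 1 "height (b ^ ?n) (wpoint w)" "wratio w powr s"] by simp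
        qed (auto intro!: mult_nonneg_nonneg height_nonneg bn)
        finally show "wratio w powr (s - \<kappa>)
            \<le> rmin powr - \<kappa> * (b ^ ?n) powr \<kappa> * (wratio w powr s * height (b ^ ?n) (wpoint w))"
          by (simp only: mult_ac)
      qed
      also have "\<dots> = rmin powr - \<kappa> * (b ^ ?n) powr \<kappa> * T ?n" by (simp add: T_def sum_distrib_left)
      also have "\<dots> \<le> rmin powr - \<kappa> * (b ^ ?n) powr \<kappa> * ((b powr - \<kappa>) ^ m * T n0)"
        by (intro mult_left_mono T) auto
      also have "(b ^ ?n) powr \<kappa> = (b ^ n0) powr \<kappa> * (b powr \<kappa>) ^ m"
        using b by (simp add: power_add powr_mult powr_realpow[symmetric] powr_powr mult.commute)
      also have "rmin powr - \<kappa> * ((b ^ n0) powr \<kappa> * (b powr \<kappa>) ^ m) * ((b powr - \<kappa>) ^ m * T n0)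
        = rmin powr - \<kappa> * (b ^ n0) powr \<kappa> * T n0 * (b powr \<kappa> * b powr - \<kappa>) ^ m"
        by (simp add: power_mult_distrib mult_ac)
      also have "b powr \<kappa> * b powr - \<kappa> = 1" using b by (simp add: powr_add[symmetric])
      finally show "(\<Sum>w\<in>V ?n. wratio w powr (s - \<kappa>)) \<le> rmin powr - \<kappa> * (b ^ n0) powr \<kappa> * T n0" by simp
    qed
  qed
  then have "(\<Sum>n0. hausdorff_outer (s - \<kappa>') (E n0)) = 0" by simp
  moreover have "hausdorff_outer (s - \<kappa>') (Sing \<inter> K) \<le> (\<Sum>n0. hausdorff_outer (s - \<kappa>') (E n0))"
    by (rule order_trans[OF hausdorff_outer_mono[OF cover] hausdorff_outer_subadd])
  ultimately show ?thesis by simp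
qed

end

section \<open>Choice of the parameters and conclusion\<close>

lemma affine_subspaces_vimage:
  fixes f :: "'a::euclidean_space \<Rightarrow> 'a"
  assumes f: "linear f" "bij f" and A: "A \<in> affine_subspaces k"
  shows "(\<lambda>x. f x + b) -` A \<in> affine_subspaces k"
proof -
  let ?h = "\<lambda>x. f x + b"
  let ?B = "?h -` A"
  have "surj ?h"
  proof (rule surjI)
    fix y show "?h (inv f (y - b)) = y" using f(2) by (simp add: bij_is_surj surj_f_inv_f)
  qed
  then have img: "(+) b ` (f ` ?B) = A" by (auto simp: image_comp surj_image_vimage_eq add.commute)
  have "affine ?B"
    unfolding affine_def
  proof (intro ballI allI impI)
    fix x y u v assume xy: "x \<in> ?B" "y \<in> ?B" and uv: "u + v = (1::real)"
    have "?h (u *\<^sub>R x + v *\<^sub>R y) = u *\<^sub>R ?h x + v *\<^sub>R ?h y"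
      using uv scaleR_left_distrib[of u v b] by (simp add: linear_add[OF f(1)] linear_scale[OF f(1)]
          algebra_simps)
    moreover have "u *\<^sub>R ?h x + v *\<^sub>R ?h y \<in> A"
      using A xy uv by (auto simp: affine_subspaces_def affine_def)
    ultimately show "u *\<^sub>R x + v *\<^sub>R y \<in> ?B" by simp
  qed
  moreover have "aff_dim ?B = aff_dim A"
    using aff_dim_translation_eq[of b "f ` ?B"] aff_dim_injective_linear_image[OF f(1) bij_is_inj[OF
        f(2)], of ?B]
    unfolding img by simp
  ultimately show ?thesis using A by (simp add: affine_subspaces_def)
qed

theorem theorem1:
  fixes \<Lambda> :: "'i set"
    and h :: "'i \<Rightarrow> real ^ 'n \<Rightarrow> real ^ 'n"
    and K :: "(real ^ 'n) set"
    and s :: real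
    and \<mu> :: "(real ^ 'n) measure"
  assumes "iterated_function_system \<Lambda> h"
    and "open_set_condition \<Lambda> h"
    and "is_limit_set \<Lambda> h K"
    and "hausdorff_dim K = ereal s"
    and "\<mu> = hausdorff_measure_on s K"
  shows "hausdorff_dim (Sing \<inter> K) \<le>
    ereal s - (MIN l\<in>{1..CARD('n)}.
      ereal (real (CARD('n) - l + 1)) * alpha l \<mu> / ereal (real (CARD('n) + 1)))"
proof -
  have fin: "finite \<Lambda>" and cs: "\<And>i. i \<in> \<Lambda> \<Longrightarrow> contractive_similarity (h i)"
    using assms(1) by (auto simp: iterated_function_system_def)
  have "\<forall>i\<in>\<Lambda>. \<exists>\<rho> f b. 0 < \<rho> \<and> \<rho> < 1 \<and> orthogonal_transformation f \<and> h i = (\<lambda>x. \<rho> *\<^sub>R f x + b)"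
  proof
    fix i assume "i \<in> \<Lambda>"
    then obtain \<rho> Q b where q: "0 < \<rho>" "\<rho> < 1" "rotation_matrix Q" "h i = (\<lambda>x. \<rho> *\<^sub>R (Q *v x) + b)"
      using cs unfolding contractive_similarity_def by blast
    have "orthogonal_matrix Q" using q(3) by (simp add: rotation_matrix_def)
    then have "orthogonal_transformation ((*v) Q)"
      by (simp add: orthogonal_transformation_matrix)
    then show "\<exists>\<rho> f b. 0 < \<rho> \<and> \<rho> < 1 \<and> orthogonal_transformation f \<and> h i = (\<lambda>x. \<rho> *\<^sub>R f x + b)"
      using q by blast
  qed
  then obtain \<rho> f b where simh: "\<And>i. i \<in> \<Lambda> \<Longrightarrow> 0 < \<rho> i \<and> \<rho> i < 1"
    "\<And>i. i \<in> \<Lambda> \<Longrightarrow> orthogonal_transformation (f i)" "\<And>i. i \<in> \<Lambda> \<Longrightarrow> h i = (\<lambda>x. \<rho> i *\<^sub>R f i x + b i)"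
    by metis
  obtain U where U: "open U" "U \<noteq> {}" "\<And>i. i \<in> \<Lambda> \<Longrightarrow> h i ` U \<subseteq> U"
    "\<And>i j. i \<in> \<Lambda> \<Longrightarrow> j \<in> \<Lambda> \<Longrightarrow> i \<noteq> j \<Longrightarrow> h i ` U \<inter> h j ` U = {}"
    using assms(2) unfolding open_set_condition_def by metis
  have K: "compact K" "K \<noteq> {}" "K = (\<Union>i\<in>\<Lambda>. h i ` K)" using assms(3) by (auto simp: is_limit_set_def)
  have lin: "linear (\<lambda>x. \<rho> i *\<^sub>R f i x)" "bij (\<lambda>x. \<rho> i *\<^sub>R f i x)" if i: "i \<in> \<Lambda>" for i
  proof -
    have o: "orthogonal_transformation (f i)" by (rule simh(2)[OF i])
    show "linear (\<lambda>x. \<rho> i *\<^sub>R f i x)"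
      by (intro linear_compose_scale_right orthogonal_transformation_linear o)
    have "bij (\<lambda>x :: real ^ 'n. \<rho> i *\<^sub>R x)" using simh(1)[OF i]
      by (intro o_bij[where g = "\<lambda>x. x /\<^sub>R \<rho> i"]) (auto simp: o_def)
    then show "bij (\<lambda>x. \<rho> i *\<^sub>R f i x)" using bij_comp[OF orthogonal_transformation_bij[OF o]]
      by (simp add: o_def)
  qed
  have ne: "\<Lambda> \<noteq> {}" using K by auto
  \<comment> \<open>The dimension s is not yet known to solve Moran's equation, so a root s' is
    taken first; s' = s then follows from \<open>hausdorff_dim_K\<close>.\<close>
  obtain s' where s': "0 \<le> s'" "(\<Sum>i\<in>\<Lambda>. \<rho> i powr s') = 1"
    by (rule similarity_dimension_exists[OF fin ne simh(1)])
  interpret self_similar \<Lambda> h \<rho> K U s'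
  proof
    fix i x y assume i: "i \<in> \<Lambda>"
    have "dist (f i x) (f i y) = dist x y" using simh(2)[OF i]
      by (simp add: orthogonal_transformation_isometry)
    then show "dist (h i x) (h i y) = \<rho> i * dist x y"
      using simh(1)[OF i] by (simp add: simh(3)[OF i] dist_norm scaleR_diff_right[symmetric])
  next
    fix i assume i: "i \<in> \<Lambda>"
    show "surj (h i)" unfolding simh(3)[OF i]
    proof (rule surjI)
      fix y show "\<rho> i *\<^sub>R f i (inv (\<lambda>x. \<rho> i *\<^sub>R f i x) (y - b i)) + b i = y"
        using surj_f_inv_f[OF bij_is_surj[OF lin(2)[OF i]], of "y - b i"] by simp
    qed
  qed (use fin simh(1) K U s' in auto)
  have ss: "s' = s" using hausdorff_dim_K assms(4) by simp
  let ?d = "real CARD('n)"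
  let ?t = "\<lambda>l. ereal (real (CARD('n) - l + 1)) * alpha l \<mu> / ereal (real (CARD('n) + 1))"
  define m where "m = (MIN l\<in>{1..CARD('n)}. ?t l)"
  have m_le: "m \<le> ?t l" if "1 \<le> l" "l \<le> CARD('n)" for l
    unfolding m_def using that by (intro Min_le) auto
  have dimK: "hausdorff_dim (Sing \<inter> K) \<le> ereal s"
    using hausdorff_dim_mono[of "Sing \<inter> K" K] assms(4) by simp
  have main: "hausdorff_dim (Sing \<inter> K) \<le> ereal s - ereal \<kappa>" if \<kappa>: "0 < \<kappa>" "ereal \<kappa> < m" "\<kappa> < s" for \<kappa>
  proof -
    obtain \<kappa>2 where k2: "\<kappa> < \<kappa>2" "ereal \<kappa>2 < m" using ereal_dense2[OF \<kappa>(2)] by auto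
    \<comment> \<open>With this \<delta> the condition \<open>decay\<close> in rank l says that
      \<kappa>2 lies below (d + 1 - l) * alpha l \<mu> / (d + 1), which is part of \<kappa>2 <
      m.\<close>
    define \<delta> where "\<delta> = \<kappa>2 * (?d + 1)"
    \<comment> \<open>Makes \<kappa> * (1 + \<eta> * d) the mean of \<kappa> and \<kappa>2, so that
      the rate \<kappa>2 / (1 + \<eta> * d) still exceeds \<kappa>.\<close>
    define \<eta> where "\<eta> = (\<kappa>2 / \<kappa> - 1) / (2 * ?d)"
    have d: "?d > 0" by simp
    have \<delta>: "\<delta> > 0" using k2 \<kappa> by (simp add: \<delta>_def)
    have \<eta>: "\<eta> > 0" using k2 \<kappa> d by (simp add: \<eta>_def)
    interpret self_similar_height \<Lambda> h \<rho> K U s' \<delta> \<eta>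
    proof
      fix i A k assume i: "i \<in> \<Lambda>" and A: "A \<in> (affine_subspaces k :: (real ^ 'n) set set)"
      show "h i -` A \<in> affine_subspaces k"
        unfolding simh(3)[OF i] by (rule affine_subspaces_vimage[OF lin[OF i] A])
    next
      fix l assume l: "1 \<le> l" "l \<le> CARD('n)"
      have c: "real (CARD('n) - l + 1) = ?d + 1 - real l" using l by simp
      have c0: "0 < ?d + 1 - real l" using l by simp
      have "ereal \<kappa>2 < ?t l" using k2(2) m_le[OF l] by simp
      then have "ereal \<kappa>2 < ereal (?d + 1 - real l) * alpha l \<mu> / ereal (?d + 1)" unfolding c
        by (simp add: add.commute)
      then show "ereal (\<delta> / (?d + 1 - real l)) < alpha l (hausdorff_measure_on s' K)"
        unfolding ss assms(5)[symmetric] \<delta>_def using c0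
        by (cases "alpha l \<mu>") (auto simp: field_simps)
    qed (use \<delta> \<eta> in auto)
    have "\<kappa> < rate"
    proof -
      have "\<kappa> * (1 + \<eta> * ?d) < \<kappa>2"
      proof -
        have "\<kappa> * (1 + \<eta> * ?d) = (\<kappa> + \<kappa>2) / 2" unfolding \<eta>_def using \<kappa> d by (simp add: field_simps)
        then show ?thesis using k2 by simp
      qed
      moreover have "0 < 1 + \<eta> * ?d" using \<eta> d by (intro add_pos_pos) auto
      ultimately have "\<kappa> < \<kappa>2 / (1 + \<eta> * ?d)" by (simp add: field_simps)
      also have "\<dots> = rate" unfolding rate_def unfolding \<delta>_def using d by simp
      finally show ?thesis .
    qed
    then obtain \<kappa>1 where "\<kappa> < \<kappa>1" "\<kappa>1 < rate" using dense by blast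
    then have "hausdorff_outer (s - \<kappa>) (Sing \<inter> K) = 0"
      using hausdorff_outer_Sing_zero[of \<kappa> \<kappa>1] \<kappa> unfolding ss by blast
    then show ?thesis using hausdorff_dim_le[of "s - \<kappa>" "Sing \<inter> K"] \<kappa> by simp
  qed
  have "hausdorff_dim (Sing \<inter> K) \<le> ereal s - m"
  proof (cases "m \<le> 0")
    \<comment> \<open>The claim is then no stronger than the bound by the dimension of K; this
      includes m = -\<infinity>.\<close>
    case True
    then have "ereal s \<le> ereal s - m" by (cases m) auto
    then show ?thesis using dimK by (rule order_trans[rotated])
  next
    case False
    \<comment> \<open>Rank d alone shows that m is finite and at most s / (d + 1), which gives
      \<kappa> < s below.\<close>
    have "m \<le> ?t CARD('n)" by (intro m_le) (auto simp: Suc_leI)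
    moreover have "alpha CARD('n) \<mu> \<le> ereal s" using alpha_DIM_le unfolding ss assms(5) by simp
    ultimately have ms: "m \<le> ereal (s / (?d + 1))"
      by (cases "alpha CARD('n) \<mu>"; cases m) (auto simp: field_simps split: if_splits)
    then obtain m' where m': "m = ereal m'" using False by (cases m) auto
    have m0: "0 < m'" using False m' by simp
    have "m' * (?d + 1) \<le> s" using ms m' by (simp add: field_simps)
    moreover have "m' * 1 \<le> m' * (?d + 1)" using m0 by (intro mult_left_mono) auto
    ultimately have m's: "m' \<le> s" by simp
    show ?thesis
    proof (rule ereal_le_epsilon2)
      fix e :: real assume e: "0 < e"
      \<comment> \<open>Below m' by at most e, yet positive: the second entry takes over when e is
        large.\<close>
      define \<kappa> where "\<kappa> = max (m' - e) (m' / 2)"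
      have "hausdorff_dim (Sing \<inter> K) \<le> ereal s - ereal \<kappa>"
        by (rule main) (use m0 e m' m's in \<open>auto simp: \<kappa>_def\<close>)
      also have "\<dots> \<le> ereal s - m + ereal e"
      proof -
        have "m' - e \<le> \<kappa>" by (simp add: \<kappa>_def)
        then show ?thesis unfolding m' by simp
      qed
      finally show "hausdorff_dim (Sing \<inter> K) \<le> ereal s - m + ereal e" .
    qed
  qed
  then show ?thesis unfolding m_def .
qed

end
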